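(* Let $G=\langle r_0,\dots,r_{n-1}\rangle$ be a crystallographic linear Coxeter group with string diagram, with $n\ge 3$, let the odd prime $p$ be generic for $G$, and suppose that at least one of the node labels $b_1\cdot b_1,\dots,b_{n-2}\cdot b_{n-2}$ of $\Delta(G)$ is a nonzero square in $\mathbb{Z}_p$. All groups below are subgroups of $O(V)$ fixing the relevant $W^\perp$ pointwise and are compared with $O(W)$, $\widehat{O}(W)$, etc. by restriction to $W$. (a) Suppose $V_0$, $V_{n-1}$ and $V_{0,n-1}$ are non-singular and $G_0^p$, $G_{n-1}^p$ are of orthogonal type. Then: (i) $G_0^p\cap G_{n-1}^p$ acts trivially on $V_{0,n-1}^\perp$, and $O_1(V_{0,n-1})\le G_0^p\cap G_{n-1}^p\le O(V_{0,n-1})$; (ii) if $G_0^p=O(V_0)$ and $G_{n-1}^p=O(V_{n-1})$, then $G_0^p\cap G_{n-1}^p=O(V_{0,n-1})$; (iii) if $G_0^p=O_1(V_0)$ or $G_{n-1}^p=O_1(V_{n-1})$, then $G_0^p\cap G_{n-1}^p=O_1(V_{0,n-1})$. (b) Suppose $V$, $V_0$, $V_{n-1}$ are non-singular, $V_{0,n-1}$ is singular (so $n\ge4$), and $G_0^p$, $G_{n-1}^p$ are of orthogonal type. Then: (i) $G_0^p\cap G_{n-1}^p$ acts trivially on $V_{0,n-1}^\perp$, and $\widehat{O}_1(V_{0,n-1})\le G_0^p\cap G_{n-1}^p\le \widehat{O}(V_{0,n-1})$; (ii) if $G_0^p=O(V_0)$ and $G_{n-1}^p=O(V_{n-1})$,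 then $G_0^p\cap G_{n-1}^p=\widehat{O}(V_{0,n-1})$; (iii) if $G_0^p=O_1(V_0)$ or $G_{n-1}^p=O_1(V_{n-1})$, then $G_0^p\cap G_{n-1}^p=\widehat{O}_1(V_{0,n-1})$. (c) Suppose $V$ and $V_{0,n-1}$ are non-singular while at least one of $V_0$, $V_{n-1}$ is singular. Suppose also that $G_{0,n-1}^p$ is of orthogonal type, and that $G^p=O_1(V)$ whenever $G_{0,n-1}^p=O_1(V_{0,n-1})$. Then $G_0^p\cap G_{n-1}^p=G_{0,n-1}^p$.
   Context: A crystallographic linear Coxeter group with string diagram $[p_1,\dots,p_{n-1}]$ ($p_i\in\{2,3,4,6,\infty\}$) is the standard geometric representation $G=\langle r_0,\dots,r_{n-1}\rangle$ on $\mathbb{R}^n$ of the Coxeter group with relations $\rho_i^2=1$, $(\rho_{i-1}\rho_i)^{p_i}=1$, $(\rho_i\rho_j)^2=1$ ($|i-j|\ge 2$), realized by a basic system of roots $b_0,\dots,b_{n-1}$ (a basis) and a symmetric bilinear form $x\cdot y$ with Gram matrix $B=[b_i\cdot b_j]$ having entries in $\mathbb{Z}[1/2]$, so that $r_i(x)=x-2\frac{x\cdot b_i}{b_i\cdot b_i}b_i$ has integral matrix; the diagram $\Delta(G)$ records this basic system, with node $i$ labelled $b_i\cdot b_i$. For an odd prime $p$, $G^p\le GL_n(\mathbb{Z}_p)$ is the group generated by the reductions mod $p$ of the $r_i$ (still called $r_i$); it preserves the possibly singular form on $V=\mathbb{Z}_p^n$ with Gram matrix $B$ mod $p$. The prime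 $p$ is generic for $G$ if $p\ge5$, or $p=3$ and no $p_i$ equals $6$. For $J\subseteq\{0,\dots,n-1\}$, $G_J^p=\langle r_j: j\notin J\rangle$ and $V_J=\mathrm{span}\{b_j: j\notin J\}$ (which is $G_J^p$-invariant); $G_k^p$, $G_{k,l}^p$, $V_k$, $V_{k,l}$ are the cases $J=\{k\}$, $\{k,l\}$. $G^p$ is a string C-group if $\langle r_i: i\in I\rangle\cap\langle r_i: i\in J\rangle=\langle r_i: i\in I\cap J\rangle$ for all $I,J$. For a subspace $W$, $O(W)$ is the group of isometries of $W$ with the restricted form; $\mathrm{rad}\,W=W\cap W^\perp$; $W$ is non-singular if $\mathrm{rad}\,W=0$. $O_1(W)$ is the subgroup generated by reflections $r_a$ with $a\in W$, $a\cdot a=1$. $\widehat{O}(W)$ is the subgroup of $O(W)$ acting trivially on $\mathrm{rad}\,W$ (generated by reflections in anisotropic roots of $W$), and $\widehat{O}_1(W)$ is its subgroup generated by reflections whose spinor norm (for $r_a$, the class of $a\cdot a$ modulo nonzero squares) is a square. A group $G_J^p$ is of orthogonal type if its action on $V_J$ is the full orthogonal group $O(V_J)$ or one of its reflection subgroups $O_j(V_J)$ generated by all reflections in roots $a\in V_J$ with $a\cdot a=j$ (e.g. $O_1$). The statement "$G_0^p=O_1(V_0)$" etc. refers to the action on $V_0$. *)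

theory Defs
  imports
    Complex_Main
    "HOL-Library.Extended_Nat"
    "HOL-Algebra.Bij"
    "HOL-Algebra.Generated_Groups"
    "Jordan_Normal_Form.VS_Connect"
    "Berlekamp_Zassenhaus.Finite_Field"
begin

section \<open>Symmetric bilinear forms, reflections and their groups\<close>

text \<open>Coordinates are taken with respect to the basis \<open>b\<^sub>0, \<dots>, b\<^sub>n\<^sub>-\<^sub>1\<close>, so \<open>b\<^sub>i\<close> is
  \<open>unit_vec n i\<close> and a form is given by its Gram matrix \<open>B\<close>.\<close>

definition form :: "'a::comm_ring_1 mat \<Rightarrow> 'a vec \<Rightarrow> 'a vec \<Rightarrow> 'a" where
  "form B x y = x \<bullet> (B *\<^sub>v y)"

definition reflection :: "'a::field mat \<Rightarrow> 'a vec \<Rightarrow> 'a vec \<Rightarrow> 'a vec" where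
  "reflection B a x = x - (2 * (form B x a / form B a a)) \<cdot>\<^sub>v a"

text \<open>Orthogonal complement in the whole space of dimension \<open>dim_row B\<close>.\<close>

definition perp :: "'a::comm_ring_1 mat \<Rightarrow> 'a vec set \<Rightarrow> 'a vec set" where
  "perp B W = {x \<in> carrier_vec (dim_row B). \<forall>y\<in>W. form B x y = 0}"

definition rad :: "'a::comm_ring_1 mat \<Rightarrow> 'a vec set \<Rightarrow> 'a vec set" where
  "rad B W = W \<inter> perp B W"

definition nonsingular :: "'a::comm_ring_1 mat \<Rightarrow> 'a vec set \<Rightarrow> bool" where
  "nonsingular B W \<longleftrightarrow> rad B W = {0\<^sub>v (dim_row B)}"

definition nonzero_square :: "'a::field \<Rightarrow> bool" where
  "nonzero_square x \<longleftrightarrow> (\<exists>s. s \<noteq> 0 \<and> x = s ^ 2)"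

text \<open>Isometries of a subspace \<open>W\<close> are elements of \<^const>\<open>BijGroup\<close> \<open>W\<close>, i.e. permutations of
  \<open>W\<close> that are \<^const>\<open>undefined\<close> outside \<open>W\<close>.\<close>

definition isometries :: "'a::comm_ring_1 mat \<Rightarrow> 'a vec set \<Rightarrow> ('a vec \<Rightarrow> 'a vec) set" where
  "isometries B W =
     {f \<in> Bij W. (\<forall>x\<in>W. \<forall>y\<in>W. f (x + y) = f x + f y)
                \<and> (\<forall>c. \<forall>x\<in>W. f (c \<cdot>\<^sub>v x) = c \<cdot>\<^sub>v f x)
                \<and> (\<forall>x\<in>W. \<forall>y\<in>W. form B (f x) (f y) = form B x y)}"

text \<open>The group \<open>O\<^sub>j(W)\<close>.\<close>

definition refl_subgroup :: "'a::field mat \<Rightarrow> 'a \<Rightarrow> 'a vec set \<Rightarrow> ('a vec \<Rightarrow> 'a vec) set" where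
  "refl_subgroup B j W =
     generate (BijGroup W) {restrict (reflection B a) W | a. a \<in> W \<and> form B a a = j}"

text \<open>The groups \<open>O^(W)\<close> and \<open>O^\<^sub>1(W)\<close>; the spinor norm of the reflection in \<open>a\<close> is the class
  of \<open>a \<cdot> a\<close> modulo nonzero squares.\<close>

definition isometries_hat :: "'a::comm_ring_1 mat \<Rightarrow> 'a vec set \<Rightarrow> ('a vec \<Rightarrow> 'a vec) set" where
  "isometries_hat B W = {f \<in> isometries B W. \<forall>x \<in> rad B W. f x = x}"

definition refl_subgroup_hat :: "'a::field mat \<Rightarrow> 'a vec set \<Rightarrow> ('a vec \<Rightarrow> 'a vec) set" where
  "refl_subgroup_hat B W =
     generate (BijGroup W) {restrict (reflection B a) W | a. a \<in> W \<and> nonzero_square (form B a a)}"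

definition restr :: "'a::comm_ring_1 vec set \<Rightarrow> 'a mat \<Rightarrow> 'a vec \<Rightarrow> 'a vec" where
  "restr W g = restrict (\<lambda>x. g *\<^sub>v x) W"

definition orthogonal_type :: "'a::field mat \<Rightarrow> 'a vec set \<Rightarrow> 'a mat set \<Rightarrow> bool" where
  "orthogonal_type B W H \<longleftrightarrow>
     restr W ` H = isometries B W \<or> (\<exists>j. j \<noteq> 0 \<and> restr W ` H = refl_subgroup B j W)"


section \<open>Crystallographic linear Coxeter groups with string diagram\<close>

text \<open>The diagram \<open>[p\<^sub>1, \<dots>, p\<^sub>n\<^sub>-\<^sub>1]\<close> is a function \<open>ps\<close> used on \<open>{1..n-1}\<close>; \<open>ps i\<close> belongs
  to the pair of nodes \<open>i - 1, i\<close>.\<close>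

definition coxeter_entry :: "(nat \<Rightarrow> enat) \<Rightarrow> nat \<Rightarrow> nat \<Rightarrow> enat" where
  "coxeter_entry ps i j =
     (if i = j then 1 else if j = Suc i then ps j else if i = Suc j then ps i else 2)"

fun cos_pi_div :: "enat \<Rightarrow> real" where
  "cos_pi_div (enat m) = cos (pi / real m)"
| "cos_pi_div \<infinity> = 1"

definition dyadic :: "real \<Rightarrow> bool" where
  "dyadic x \<longleftrightarrow> (\<exists>(m::int) (k::nat). x = of_int m / 2 ^ k)"

text \<open>The matrix of the reflection \<open>r\<^sub>i\<close>; its \<open>l\<close>-th column is \<open>r\<^sub>i(b\<^sub>l)\<close>.\<close>

definition refl_matrix :: "nat \<Rightarrow> 'a::field mat \<Rightarrow> nat \<Rightarrow> 'a mat" where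
  "refl_matrix n B i = mat n n (\<lambda>(k, l). reflection B (unit_vec n i) (unit_vec n l) $ k)"

text \<open>\<open>B\<close> is the Gram matrix of a basic system: up to the lengths of the roots, it is the form
  \<open>-cos (\<pi> / m\<^sub>i\<^sub>j)\<close> of the standard geometric representation. The case \<open>i = j\<close> of the third
  condition only says that the label \<open>B\<^sub>i\<^sub>i\<close> equals itself.\<close>

definition crystallographic_coxeter :: "nat \<Rightarrow> (nat \<Rightarrow> enat) \<Rightarrow> real mat \<Rightarrow> bool" where
  "crystallographic_coxeter n ps B \<longleftrightarrow>
     B \<in> carrier_mat n n
     \<and> (\<forall>i\<in>{1..n - 1}. ps i \<in> {2, 3, 4, 6, \<infinity>})
     \<and> (\<forall>i<n. 0 < B $$ (i, i))
     \<and> (\<forall>i<n. \<forall>j<n. B $$ (i, j) =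
           - cos_pi_div (coxeter_entry ps i j) * sqrt (B $$ (i, i)) * sqrt (B $$ (j, j)))
     \<and> (\<forall>i<n. \<forall>j<n. dyadic (B $$ (i, j)))
     \<and> (\<forall>i<n. \<forall>k<n. \<forall>l<n. refl_matrix n B i $$ (k, l) \<in> \<int>)"

definition generic_prime :: "nat \<Rightarrow> (nat \<Rightarrow> enat) \<Rightarrow> nat \<Rightarrow> bool" where
  "generic_prime n ps p \<longleftrightarrow> p \<ge> 5 \<or> (p = 3 \<and> (\<forall>i\<in>{1..n - 1}. ps i \<noteq> 6))"


section \<open>Reduction modulo p\<close>

text \<open>The ring homomorphism from \<open>\<int>[1/2]\<close> to \<open>\<int>\<^sub>p\<close> for odd \<open>p = CARD('p)\<close>
  (extending \<open>of_int\<close>); only meaningful on \<^const>\<open>dyadic\<close> arguments.\<close>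

definition dyadic_mod :: "real \<Rightarrow> 'p::prime_card mod_ring" where
  "dyadic_mod x = (THE y. \<exists>(m::int) (k::nat). x = of_int m / 2 ^ k \<and> y = of_int m / 2 ^ k)"

lemma two_mod_ring_nonzero:
  assumes "odd CARD('p::prime_card)"
  shows "(2 :: 'p mod_ring) \<noteq> 0"
proof
  assume "(2 :: 'p mod_ring) = 0"
  then have "(of_int_mod_ring 2 :: 'p mod_ring) = 0"
    by (metis of_int_numeral of_int_of_int_mod_ring)
  then have "2 mod int CARD('p) = 0"
    by (metis of_int_mod_ring.rep_eq to_int_mod_ring.rep_eq zero_mod_ring.rep_eq)
  then have "CARD('p) dvd 2"
    by presburger
  then have "CARD('p) = 1 \<or> CARD('p) = 2"
    by (metis prime_nat_iff two_is_prime_nat)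
  then show False
    using assms prime_card[where 'a='p] by auto
qed

lemma dyadic_mod_eq:
  assumes "odd CARD('p::prime_card)"
  shows "(dyadic_mod (of_int m / 2 ^ k) :: 'p mod_ring) = of_int m / 2 ^ k"
  unfolding dyadic_mod_def
proof (rule the_equality)
  show "\<exists>(m'::int) (k'::nat). (of_int m / 2 ^ k :: real) = of_int m' / 2 ^ k'
      \<and> (of_int m / 2 ^ k :: 'p mod_ring) = of_int m' / 2 ^ k'"
    by blast
next
  fix y :: "'p mod_ring"
  assume "\<exists>(m'::int) (k'::nat). (of_int m / 2 ^ k :: real) = of_int m' / 2 ^ k' \<and> y = of_int m' / 2 ^ k'"
  then obtain m' :: int and k' :: nat
    where eq: "(of_int m / 2 ^ k :: real) = of_int m' / 2 ^ k'" and y: "y = of_int m' / 2 ^ k'"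
    by blast
  from eq have "(of_int (m * 2 ^ k') :: real) = of_int (m' * 2 ^ k)"
    by (simp add: field_simps)
  then have "m * 2 ^ k' = m' * 2 ^ k"
    by (simp only: of_int_eq_iff)
  then have "(of_int (m * 2 ^ k') :: 'p mod_ring) = of_int (m' * 2 ^ k)"
    by simp
  then have "(of_int m * 2 ^ k' :: 'p mod_ring) = of_int m' * 2 ^ k"
    by simp
  then show "y = of_int m / 2 ^ k"
    using two_mod_ring_nonzero[OF assms] by (simp add: y field_simps)
qed

text \<open>\<open>G\<^sub>J\<^sup>p\<close>, a subgroup of the group of units of the matrix ring; \<open>J = {}\<close> gives \<open>G\<^sup>p\<close>.\<close>

definition reduced_group :: "nat \<Rightarrow> real mat \<Rightarrow> nat set \<Rightarrow> 'p::prime_card mod_ring mat set" where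
  "reduced_group n B J =
     generate (units_of (ring_mat TYPE('p mod_ring) n ()))
       {map_mat dyadic_mod (refl_matrix n B j) | j. j < n \<and> j \<notin> J}"

text \<open>\<open>V\<^sub>J\<close>; \<open>J = {}\<close> gives the whole space \<open>V\<close>.\<close>

definition coord_subspace :: "nat \<Rightarrow> nat set \<Rightarrow> 'a::field vec set" where
  "coord_subspace n J =
     LinearCombinations.module.span class_ring (module_vec TYPE('a) n) {unit_vec n j | j. j < n \<and> j \<notin> J}"

end

theory Submission
  imports Defs "HOL-Combinatorics.Permutations"
begin

text \<open>All groups are treated as sets of words in reflections. The spinor norm enters through the sign
  of the permutation that \<open>r\<^sub>a\<close> induces on the sphere \<open>x \<cdot> x = t\<close>, which is \<open>-1\<close> exactly if
  \<open>t (a \<cdot> a)\<close> is a square; hence the parities of the numbers of square and of non-square roots in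
  a word only depend on the isometry. Since \<open>g x - x\<close> lies in \<open>V\<^sub>0 \<inter> V\<^sub>n\<^sub>-\<^sub>1 = W\<close> for every \<open>g\<close> in the
  intersection \<open>T\<close> of the two groups, \<open>g\<close> fixes \<open>W\<^sup>\<bottom>\<close> modulo \<open>rad W\<close>, in fact pointwise, and
  Cartan--Dieudonne (for possibly singular \<open>W\<close>) writes \<open>g\<close> as a word in roots of \<open>W\<close>. Conversely, a
  word in roots of \<open>W\<close> lies in \<open>T\<close> as soon as it lies in both groups after restriction.
  If one of the groups only contains isometries of trivial spinor norm, the number of non-square
  roots is even, and for \<open>p \<ge> 5\<close> such words can be rewritten in square roots. For \<open>p = 3\<close> this is
  false in general, but then all labels are 1, the group is a quotient of a product of symmetric
  groups, and the stabiliser of a vector orthogonal to \<open>W\<close> is the expected parabolic subgroup.\<close>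


section \<open>Squares in finite fields of odd order\<close>

text \<open>The groups act on \<open>V\<close> but are compared on \<open>W\<close>, so an element
  must be recovered from its restriction. If \<open>g x - x\<close> always lies in \<open>W\<close>
  and \<open>rad W = 0\<close>, this is immediate. For singular \<open>W\<close> it can fail; what
  helps is that \<open>W\<close> is a hyperplane of the non-singular \<open>V\<^sub>0\<close>, so
  \<open>rad W\<close> is at most a line, and that the orthogonal complement of \<open>W\<close> is
  fixed. Reading spinor norms off finite spheres avoids Clifford algebras and makes sense on
  singular subspaces as well. Both parities matter: a generator with square label is a word with one
  square letter, which rules out \<open>O\<^sub>j\<close> for non-square \<open>j\<close>;
  membership in \<open>O\<^sub>1\<close> forces an even number of non-square letters. Characteristic
  3 is an obstacle because two non-square roots spanning a degenerate plane are joined through a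
  third root of the same norm \<open>A\<close>, whose products with them may be 0 and
  \<open>2 * A\<close>; the plane spanned with the second root is non-degenerate only if
  \<open>(2 * A)^2 - A^2 = 3 * A^2\<close> is nonzero.\<close>

text \<open>Squaring is two-to-one on nonzero elements, because \<open>t\<close> and
  \<open>- t\<close> differ when \<open>2 \<noteq> 0\<close>.\<close>

lemma card_nonzero_squares:
  assumes two: "(2::'a::{field,finite}) \<noteq> 0"
  shows "2 * card {x::'a. nonzero_square x} = CARD('a) - 1"
proof -
  let ?S = "{x::'a. nonzero_square x}"
  have fib: "card {s::'a. s \<noteq> 0 \<and> s ^ 2 = x} = 2" if "x \<in> ?S" for x
  proof -
    from that obtain t where t: "t \<noteq> 0" "x = t ^ 2"
      by (auto simp: nonzero_square_def)
    have "t \<noteq> - t"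
      using t two by (metis add_eq_0_iff mult_2 mult_eq_0_iff)
    moreover have "{s. s \<noteq> 0 \<and> s ^ 2 = x} = {t, - t}"
      using t by (auto simp: power2_eq_iff)
    ultimately show ?thesis
      by simp
  qed
  have "UNIV - {0} = (\<Union>x\<in>?S. {s::'a. s \<noteq> 0 \<and> s ^ 2 = x})"
    by (auto simp: nonzero_square_def)
  then have "card (UNIV - {0::'a}) = (\<Sum>x\<in>?S. card {s::'a. s \<noteq> 0 \<and> s ^ 2 = x})"
    by (subst card_UN_disjoint[symmetric]) auto
  also have "\<dots> = 2 * card ?S"
    using fib by simp
  finally show ?thesis
    by (simp add: card_Diff_singleton)
qed

lemma exists_nonsquare:
  assumes "(2::'a::{field,finite}) \<noteq> 0"
  shows "\<exists>x::'a. x \<noteq> 0 \<and> \<not> nonzero_square x"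
proof (rule ccontr)
  assume "\<not> ?thesis"
  then have "{x::'a. nonzero_square x} = UNIV - {0}"
    by (auto simp: nonzero_square_def)
  then have "2 * (CARD('a) - 1) = CARD('a) - 1"
    using card_nonzero_squares[OF assms] by (simp add: card_Diff_singleton)
  moreover have "card {0, 1::'a} \<le> CARD('a)"
    by (rule card_mono) auto
  ultimately show False
    by simp
qed

lemma nonzero_square_mult:
  "nonzero_square x \<Longrightarrow> nonzero_square y \<Longrightarrow> nonzero_square (x * y)"
  unfolding nonzero_square_def by (metis mult_eq_0_iff power_mult_distrib)

lemma nonzero_square_inverse: "nonzero_square x \<Longrightarrow> nonzero_square (inverse x)"
  unfolding nonzero_square_def by (metis inverse_nonzero_iff_nonzero power_inverse)

lemma nonzero_square_mult_iff:
  assumes "nonzero_square x"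
  shows "nonzero_square (x * y) \<longleftrightarrow> nonzero_square y"
proof
  assume "nonzero_square (x * y)"
  then have "nonzero_square (inverse x * (x * y))"
    using assms nonzero_square_inverse nonzero_square_mult by blast
  moreover have "x \<noteq> 0"
    using assms by (auto simp: nonzero_square_def)
  ultimately show "nonzero_square y"
    by (simp add: mult.assoc[symmetric])
qed (use assms nonzero_square_mult in blast)

text \<open>The nonzero squares and their multiples by the non-square \<open>x\<close> are disjoint
  sets, each containing half of the nonzero elements; so \<open>y\<close> lies in the second
  one.\<close>

lemma nonsquare_mult:
  fixes x y :: "'a::{field,finite}"
  assumes two: "(2::'a) \<noteq> 0"
    and x: "x \<noteq> 0" "\<not> nonzero_square x" and y: "y \<noteq> 0" "\<not> nonzero_square y"
  shows "nonzero_square (x * y)"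
proof -
  let ?S = "{x::'a. nonzero_square x}"
  have disj: "?S \<inter> (*) x ` ?S = {}"
    using nonzero_square_mult_iff x(2) by (auto simp: mult.commute)
  have inj: "inj_on ((*) x) ?S"
    using x(1) by (auto simp: inj_on_def)
  have sub: "?S \<union> (*) x ` ?S \<subseteq> UNIV - {0}"
    using x(1) by (auto simp: nonzero_square_def)
  have "card (?S \<union> (*) x ` ?S) = 2 * card ?S"
    using disj card_image[OF inj] by (simp add: card_Un_disjoint)
  also have "\<dots> = card (UNIV - {0::'a})"
    using card_nonzero_squares[OF two] by (simp add: card_Diff_singleton)
  finally have "?S \<union> (*) x ` ?S = UNIV - {0}"
    using sub by (intro card_subset_eq) auto
  then have "y \<in> (*) x ` ?S"
    using y by auto
  then obtain s where s: "nonzero_square s" "y = x * s"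
    by auto
  then have "x * y = s * x ^ 2"
    by (simp add: power2_eq_square)
  moreover have "nonzero_square (x ^ 2)"
    using x(1) by (auto simp: nonzero_square_def)
  ultimately show ?thesis
    using s(1) nonzero_square_mult by metis
qed

text \<open>Pigeonhole: the values of \<open>a * x^2\<close> and those of \<open>c - d * y^2\<close>
  both fill more than half of the field, so they meet.\<close>

lemma binary_form_surj:
  fixes a d c :: "'a::{field,finite}"
  assumes two: "(2::'a) \<noteq> 0" and ad: "a \<noteq> 0" "d \<noteq> 0"
  shows "\<exists>x y. a * x ^ 2 + d * y ^ 2 = c"
proof -
  let ?S = "{x::'a. nonzero_square x}"
  let ?Q = "insert 0 ?S"
  let ?A = "(*) a ` ?Q" and ?D = "(\<lambda>z. c - d * z) ` ?Q"
  have "0 \<notin> ?S"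
    by (auto simp: nonzero_square_def)
  then have Q: "card ?Q = Suc (card ?S)"
    by simp
  have sq: "\<exists>x. z = x ^ 2" if "z \<in> ?Q" for z :: 'a
    using that by (auto simp: nonzero_square_def intro: exI[of _ 0])
  have "?A \<inter> ?D \<noteq> {}"
  proof
    assume "?A \<inter> ?D = {}"
    then have "card (?A \<union> ?D) = card ?A + card ?D"
      by (intro card_Un_disjoint) auto
    also have "card ?A = card ?Q"
      using ad by (intro card_image) (auto simp: inj_on_def)
    also have "card ?D = card ?Q"
      using ad by (intro card_image) (auto simp: inj_on_def)
    finally have "card (?A \<union> ?D) = CARD('a) + 1"
      using Q card_nonzero_squares[OF two] zero_less_card_finite[where 'a='a] by linarith
    moreover have "card (?A \<union> ?D) \<le> CARD('a)"
      by (rule card_mono) auto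
    ultimately show False
      by simp
  qed
  then obtain z w where "z \<in> ?Q" "w \<in> ?Q" "a * z = c - d * w"
    by blast
  then show ?thesis
    using sq by (metis diff_add_cancel)
qed


section \<open>The sign of an involution\<close>

text \<open>Composing with the transposition of \<open>a\<close> and \<open>f a\<close> leaves an
  involution with two moved points fewer.\<close>

lemma sign_involution:
  fixes f :: "'b \<Rightarrow> 'b"
  assumes "finite {x. f x \<noteq> x}" and "\<And>x. f (f x) = x"
  shows "even (card {x. f x \<noteq> x}) \<and> permutation f \<and> sign f = (- 1) ^ (card {x. f x \<noteq> x} div 2)"
  using assms
proof (induction "card {x. f x \<noteq> x}" arbitrary: f rule: less_induct)
  case less
  show ?case
  proof (cases "{x. f x \<noteq> x} = {}")
    case True
    then have "f = id"
      by auto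
    then show ?thesis
      by (auto simp: permutation_id)
  next
    case False
    then obtain a where a: "f a \<noteq> a"
      by blast
    define g where "g = transpose a (f a) \<circ> f"
    have inj: "f x = f y \<longleftrightarrow> x = y" for x y
      using less.prems(2) by metis
    have gx: "g x = (if x = a \<or> x = f a then x else f x)" for x
      using less.prems(2) inj by (auto simp: g_def transpose_def)
    have gg: "g (g x) = x" for x
      using less.prems(2) by (auto simp: gx) metis+
    have supp: "{x. f x \<noteq> x} = insert a (insert (f a) {x. g x \<noteq> x})"
      using a less.prems(2) by (auto simp: gx)
    have fin: "finite {x. g x \<noteq> x}"
      using less.prems(1) supp by (metis finite_insert)
    have card: "card {x. f x \<noteq> x} = card {x. g x \<noteq> x} + 2"
      using a fin by (simp add: supp) (auto simp: gx)
    have IH: "even (card {x. g x \<noteq> x})" "permutation g"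
      "sign g = (- 1) ^ (card {x. g x \<noteq> x} div 2)"
      using less.hyps[OF _ fin gg] card by auto
    have f: "f = transpose a (f a) \<circ> g"
      by (simp add: g_def fun_eq_iff)
    have pf: "permutation f"
      by (subst f) (simp add: permutation_compose permutation_swap_id IH(2))
    have "sign f = sign (transpose a (f a)) * sign g"
      by (subst f) (simp add: sign_compose permutation_swap_id IH(2))
    then show ?thesis
      using pf IH card a by (simp add: sign_swap_id)
  qed
qed

text \<open>Every orbit of the group generated by \<open>f\<close> and \<open>g\<close> has four
  elements; that \<open>f (g x)\<close> differs from \<open>x\<close> is the condition
  \<open>f x \<noteq> g x\<close>. Orbits are removed one at a time.\<close>

lemma four_dvd_card_klein:
  assumes "finite S"
    and "\<And>x. x \<in> S \<Longrightarrow> f x \<in> S \<and> g x \<in> S \<and> f (f x) = x \<and> g (g x) = x \<and> f (g x) = g (f x)"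
    and "\<And>x. x \<in> S \<Longrightarrow> f x \<noteq> x \<and> g x \<noteq> x \<and> f x \<noteq> g x"
  shows "4 dvd card S"
  using assms
proof (induction "card S" arbitrary: S rule: less_induct)
  case less
  show ?case
  proof (cases "S = {}")
    case False
    then obtain x where x: "x \<in> S"
      by blast
    let ?O = "{x, f x, g x, f (g x)}"
    have O: "?O \<subseteq> S"
      using x less.prems(2) by auto
    have d: "x \<noteq> f (g x)" "f x \<noteq> f (g x)" "g x \<noteq> f (g x)"
      using less.prems(2,3) x by metis+
    have c: "card ?O = 4"
      using d less.prems(3)[OF x] by auto
    have lt: "card (S - ?O) < card S"
      using less.prems(1) x by (intro psubset_card_mono) auto
    have closed: "f z \<in> ?O \<and> g z \<in> ?O" if z: "z \<in> ?O" for z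
    proof -
      have "f (f x) = x" "g (g x) = x" "f (g x) = g (f x)" "f (f (g x)) = g x" "g (g (f x)) = f x"
        using less.prems(2) x by auto
      then show ?thesis
        using z by auto
    qed
    have stable: "f y \<notin> ?O \<and> g y \<notin> ?O" if y: "y \<in> S - ?O" for y
    proof -
      have "f (f y) = y" "g (g y) = y"
        using less.prems(2) y by auto
      then show ?thesis
        using y closed[of "f y"] closed[of "g y"] by auto
    qed
    have "4 dvd card (S - ?O)"
      by (rule less.hyps[OF lt]) (use less.prems stable in auto)
    moreover have "card S = card (S - ?O) + card ?O"
      using O less.prems(1) by (metis card_Diff_subset card_mono finite_subset le_add_diff_inverse2)
    ultimately show ?thesis
      using c by simp
  qed simp
qed


section \<open>Words in reflections\<close>

text \<open>The head of the list acts last, so a list is read like a product of reflections.\<close>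

definition refls :: "'a::field mat \<Rightarrow> 'a vec list \<Rightarrow> 'a vec \<Rightarrow> 'a vec" where
  "refls B as = foldr (reflection B) as"

lemma refls_Nil [simp]: "refls B [] x = x"
  and refls_Cons [simp]: "refls B (a # as) x = reflection B a (refls B as x)"
  and refls_append [simp]: "refls B (as @ bs) x = refls B as (refls B bs x)"
  by (simp_all add: refls_def)

text \<open>The form may be singular. Finiteness of the field makes subspaces finite sets, which
  provides signs of permutations, induction on cardinality and surjectivity by counting.\<close>

locale symmetric_form =
  fixes n :: nat and B :: "'a::{field,finite} mat"
  assumes B [simp]: "B \<in> carrier_mat n n"
    and B_sym: "\<And>i j. i < n \<Longrightarrow> j < n \<Longrightarrow> B $$ (i, j) = B $$ (j, i)"
    and two: "(2::'a) \<noteq> 0"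
begin

abbreviation bil (infixl \<open>\<sqdot>\<close> 70) where "x \<sqdot> y \<equiv> form B x y"

lemma dim_B [simp]: "dim_row B = n" "dim_col B = n"
  using carrier_matD[OF B] .

lemma B_mult_vec [simp]: "x \<in> carrier_vec n \<Longrightarrow> B *\<^sub>v x \<in> carrier_vec n"
  by (rule mult_mat_vec_carrier[OF B])

lemma form_sum:
  assumes "x \<in> carrier_vec n" "y \<in> carrier_vec n"
  shows "x \<sqdot> y = (\<Sum>i<n. \<Sum>j<n. x $ i * B $$ (i, j) * y $ j)"
  using assms
  by (simp add: form_def scalar_prod_def sum_distrib_left mult.assoc atLeast0LessThan)

lemma form_sym:
  assumes "x \<in> carrier_vec n" "y \<in> carrier_vec n"
  shows "x \<sqdot> y = y \<sqdot> x"
proof -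
  have "x \<sqdot> y = (\<Sum>j<n. \<Sum>i<n. x $ i * B $$ (i, j) * y $ j)"
    unfolding form_sum[OF assms] by (rule sum.swap)
  also have "\<dots> = (\<Sum>j<n. \<Sum>i<n. y $ j * B $$ (j, i) * x $ i)"
    by (intro sum.cong) (auto simp: B_sym mult_ac)
  finally show ?thesis
    unfolding form_sum[OF assms(2,1)] .
qed

lemma form_add_left [simp]:
  "x \<in> carrier_vec n \<Longrightarrow> y \<in> carrier_vec n \<Longrightarrow> z \<in> carrier_vec n
    \<Longrightarrow> (x + y) \<sqdot> z = x \<sqdot> z + y \<sqdot> z"
  unfolding form_def by (rule add_scalar_prod_distrib[of _ n]) auto

lemma form_smult_left [simp]:
  "x \<in> carrier_vec n \<Longrightarrow> z \<in> carrier_vec n \<Longrightarrow> (c \<cdot>\<^sub>v x) \<sqdot> z = c * (x \<sqdot> z)"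
  unfolding form_def by (rule smult_scalar_prod_distrib[of _ n]) auto

lemma form_minus_left [simp]:
  "x \<in> carrier_vec n \<Longrightarrow> y \<in> carrier_vec n \<Longrightarrow> z \<in> carrier_vec n
    \<Longrightarrow> (x - y) \<sqdot> z = x \<sqdot> z - y \<sqdot> z"
  unfolding form_def by (rule minus_scalar_prod_distrib[of _ n]) auto

lemma form_add_right [simp]:
  "x \<in> carrier_vec n \<Longrightarrow> y \<in> carrier_vec n \<Longrightarrow> z \<in> carrier_vec n
    \<Longrightarrow> z \<sqdot> (x + y) = z \<sqdot> x + z \<sqdot> y"
  by (simp add: form_sym[of z])

lemma form_smult_right [simp]:
  "x \<in> carrier_vec n \<Longrightarrow> z \<in> carrier_vec n \<Longrightarrow> z \<sqdot> (c \<cdot>\<^sub>v x) = c * (z \<sqdot> x)"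
  by (simp add: form_sym[of z])

lemma form_minus_right [simp]:
  "x \<in> carrier_vec n \<Longrightarrow> y \<in> carrier_vec n \<Longrightarrow> z \<in> carrier_vec n
    \<Longrightarrow> z \<sqdot> (x - y) = z \<sqdot> x - z \<sqdot> y"
  by (simp add: form_sym[of z])

lemma form_zero [simp]: "x \<in> carrier_vec n \<Longrightarrow> 0\<^sub>v n \<sqdot> x = 0" "x \<in> carrier_vec n \<Longrightarrow> x \<sqdot> 0\<^sub>v n = 0"
proof -
  assume x: "x \<in> carrier_vec n"
  have "0\<^sub>v n = 0 \<cdot>\<^sub>v (0\<^sub>v n :: 'a vec)"
    by (intro eq_vecI) auto
  then show "0\<^sub>v n \<sqdot> x = 0" "x \<sqdot> 0\<^sub>v n = 0"
    using x form_smult_left[of "0\<^sub>v n" x 0] form_smult_right[of "0\<^sub>v n" x 0] by simp_all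
qed

lemma form_unit_left: "i < n \<Longrightarrow> y \<in> carrier_vec n \<Longrightarrow> unit_vec n i \<sqdot> y = (B *\<^sub>v y) $ i"
  unfolding form_def by (rule scalar_prod_left_unit) auto

lemma form_unit: "i < n \<Longrightarrow> j < n \<Longrightarrow> unit_vec n i \<sqdot> unit_vec n j = B $$ (i, j)"
  by (simp add: form_unit_left)

section \<open>Reflections as linear isometries\<close>

lemma reflection_closed [simp]:
  "a \<in> carrier_vec n \<Longrightarrow> x \<in> carrier_vec n \<Longrightarrow> reflection B a x \<in> carrier_vec n"
  by (simp add: reflection_def)

lemma reflection_add:
  assumes "a \<in> carrier_vec n" "x \<in> carrier_vec n" "y \<in> carrier_vec n"
  shows "reflection B a (x + y) = reflection B a x + reflection B a y"
  using assms by (intro eq_vecI) (auto simp: reflection_def add_divide_distrib algebra_simps)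

lemma reflection_smult:
  assumes "a \<in> carrier_vec n" "x \<in> carrier_vec n"
  shows "reflection B a (c \<cdot>\<^sub>v x) = c \<cdot>\<^sub>v reflection B a x"
  using assms by (intro eq_vecI) (auto simp: reflection_def algebra_simps)

lemma reflection_fix:
  "a \<in> carrier_vec n \<Longrightarrow> x \<in> carrier_vec n \<Longrightarrow> x \<sqdot> a = 0 \<Longrightarrow> reflection B a x = x"
  by (intro eq_vecI) (auto simp: reflection_def)

lemma form_reflection:
  assumes "a \<in> carrier_vec n" "x \<in> carrier_vec n" "y \<in> carrier_vec n" "a \<sqdot> a \<noteq> 0"
  shows "reflection B a x \<sqdot> reflection B a y = x \<sqdot> y"
proof -
  have "reflection B a x \<sqdot> reflection B a y = x \<sqdot> y - 2 * ((y \<sqdot> a) / (a \<sqdot> a)) * (x \<sqdot> a)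
      - 2 * ((x \<sqdot> a) / (a \<sqdot> a)) * ((y \<sqdot> a) - 2 * ((y \<sqdot> a) / (a \<sqdot> a)) * (a \<sqdot> a))"
    using assms by (simp add: reflection_def form_sym[of a y])
  also have "\<dots> = x \<sqdot> y"
    using assms(4) by (simp add: field_simps)
  finally show ?thesis .
qed

lemma reflection_reflection [simp]:
  assumes "a \<in> carrier_vec n" "x \<in> carrier_vec n" "a \<sqdot> a \<noteq> 0"
  shows "reflection B a (reflection B a x) = x"
  using assms by (intro eq_vecI) (auto simp: reflection_def field_simps)

lemma reflection_scaled_root:
  assumes "a \<in> carrier_vec n" "x \<in> carrier_vec n" "c \<noteq> 0"
  shows "reflection B (c \<cdot>\<^sub>v a) x = reflection B a x"
  using assms by (intro eq_vecI) (auto simp: reflection_def)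

lemma reflection_minus:
  assumes "a \<in> carrier_vec n" "x \<in> carrier_vec n" "y \<in> carrier_vec n"
  shows "reflection B a (x - y) = reflection B a x - reflection B a y"
  using assms by (intro eq_vecI) (auto simp: reflection_def diff_divide_distrib algebra_simps)

lemma reflection_of_root:
  assumes "a \<in> carrier_vec n" "a \<sqdot> a \<noteq> 0"
  shows "reflection B a a = - a"
  using assms by (intro eq_vecI) (auto simp: reflection_def)

lemma reflection_difference:
  assumes "x \<in> carrier_vec n" "y \<in> carrier_vec n" "x \<sqdot> x = y \<sqdot> y" "(x - y) \<sqdot> (x - y) \<noteq> 0"
  shows "reflection B (x - y) x = y"
proof -
  have "(x - y) \<sqdot> (x - y) = 2 * (x \<sqdot> (x - y))"
    using assms by (simp add: form_sym[of y x] algebra_simps)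
  then have "2 * (x \<sqdot> (x - y) / ((x - y) \<sqdot> (x - y))) = 1"
    using assms(4) by simp
  then show ?thesis
    using assms(1,2) by (intro eq_vecI) (auto simp: reflection_def)
qed

section \<open>Subspaces as finite sets of vectors\<close>

definition subsp :: "'a vec set \<Rightarrow> bool" where
  "subsp W \<longleftrightarrow> W \<subseteq> carrier_vec n \<and> 0\<^sub>v n \<in> W
    \<and> (\<forall>x\<in>W. \<forall>y\<in>W. x + y \<in> W) \<and> (\<forall>c. \<forall>x\<in>W. c \<cdot>\<^sub>v x \<in> W)"

lemma subsp_carrier: "subsp W \<Longrightarrow> x \<in> W \<Longrightarrow> x \<in> carrier_vec n"
  and subsp_zero: "subsp W \<Longrightarrow> 0\<^sub>v n \<in> W"
  and subsp_add: "subsp W \<Longrightarrow> x \<in> W \<Longrightarrow> y \<in> W \<Longrightarrow> x + y \<in> W"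
  and subsp_smult: "subsp W \<Longrightarrow> x \<in> W \<Longrightarrow> c \<cdot>\<^sub>v x \<in> W"
  by (auto simp: subsp_def)

lemma subsp_uminus:
  assumes "subsp W" "x \<in> W" shows "- x \<in> W"
proof -
  have "- x = (- 1) \<cdot>\<^sub>v x"
    by (intro eq_vecI) auto
  then show ?thesis
    using assms by (simp add: subsp_smult)
qed

lemma subsp_minus:
  assumes "subsp W" "x \<in> W" "y \<in> W" shows "x - y \<in> W"
proof -
  have "x - y = x + - y"
    using assms by (intro eq_vecI) (auto dest: subsp_carrier)
  then show ?thesis
    using assms by (simp add: subsp_add subsp_uminus)
qed

lemma subsp_minus_cancel:
  assumes "subsp W" "y \<in> W" "x - y \<in> W" "x \<in> carrier_vec n" shows "x \<in> W"
proof -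
  have "x = (x - y) + y"
    using assms by (intro eq_vecI) (auto dest: subsp_carrier)
  then show ?thesis
    using assms by (metis subsp_add)
qed

lemma subsp_finite: "subsp W \<Longrightarrow> finite W"
proof -
  assume "subsp W"
  then have "W \<subseteq> carrier_vec n"
    by (auto simp: subsp_def)
  moreover have "carrier_vec n \<subseteq> vec_of_list ` {xs :: 'a list. set xs \<subseteq> UNIV \<and> length xs = n}"
  proof
    fix x :: "'a vec" assume "x \<in> carrier_vec n"
    then show "x \<in> vec_of_list ` {xs. set xs \<subseteq> UNIV \<and> length xs = n}"
      by (intro image_eqI[of _ _ "list_of_vec x"]) (auto simp: vec_list)
  qed
  moreover have "finite (vec_of_list ` {xs :: 'a list. set xs \<subseteq> UNIV \<and> length xs = n})"
    by (intro finite_imageI finite_lists_length_eq) simp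
  ultimately show ?thesis
    by (meson finite_subset)
qed

lemma subsp_carrier_vec: "subsp (carrier_vec n)"
  by (auto simp: subsp_def)

lemma reflection_in: "subsp W \<Longrightarrow> a \<in> W \<Longrightarrow> x \<in> W \<Longrightarrow> reflection B a x \<in> W"
  unfolding reflection_def by (intro subsp_minus subsp_smult)

lemma radD: "x \<in> rad B W \<Longrightarrow> y \<in> W \<Longrightarrow> x \<sqdot> y = 0"
  by (auto simp: rad_def perp_def)

text \<open>Division by zero turns the reflection in an isotropic vector into the identity, yet such
  a letter would count as non-square. Words are therefore confined to anisotropic letters.\<close>

definition aniso :: "'a vec set \<Rightarrow> 'a vec set" where
  "aniso W = {a \<in> W. a \<sqdot> a \<noteq> 0}"

definition square_roots :: "'a vec set \<Rightarrow> 'a vec set" where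
  "square_roots W = {a \<in> W. nonzero_square (a \<sqdot> a)}"

lemma square_roots_aniso: "square_roots W \<subseteq> aniso W"
  by (auto simp: square_roots_def aniso_def nonzero_square_def)

lemma aniso_mono: "W \<subseteq> W' \<Longrightarrow> aniso W \<subseteq> aniso W'"
  and square_roots_mono: "W \<subseteq> W' \<Longrightarrow> square_roots W \<subseteq> square_roots W'"
  by (auto simp: aniso_def square_roots_def)

section \<open>Action of words on vectors\<close>

lemma refls_closed [simp]:
  "set as \<subseteq> aniso (carrier_vec n) \<Longrightarrow> x \<in> carrier_vec n \<Longrightarrow> refls B as x \<in> carrier_vec n"
  by (induction as) (auto simp: aniso_def)

lemma refls_in:
  "subsp W \<Longrightarrow> set as \<subseteq> aniso W \<Longrightarrow> x \<in> W \<Longrightarrow> refls B as x \<in> W"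
  by (induction as) (auto simp: aniso_def intro: reflection_in)

lemma refls_add:
  "set as \<subseteq> aniso (carrier_vec n) \<Longrightarrow> x \<in> carrier_vec n \<Longrightarrow> y \<in> carrier_vec n
    \<Longrightarrow> refls B as (x + y) = refls B as x + refls B as y"
  by (induction as) (auto simp: aniso_def intro!: reflection_add refls_closed)

lemma refls_smult:
  "set as \<subseteq> aniso (carrier_vec n) \<Longrightarrow> x \<in> carrier_vec n
    \<Longrightarrow> refls B as (c \<cdot>\<^sub>v x) = c \<cdot>\<^sub>v refls B as x"
  by (induction as) (auto simp: aniso_def intro!: reflection_smult refls_closed)

lemma form_refls:
  "set as \<subseteq> aniso (carrier_vec n) \<Longrightarrow> x \<in> carrier_vec n \<Longrightarrow> y \<in> carrier_vec n
    \<Longrightarrow> refls B as x \<sqdot> refls B as y = x \<sqdot> y"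
  by (induction as) (auto simp: aniso_def form_reflection)

lemma refls_fix:
  "set as \<subseteq> aniso (carrier_vec n) \<Longrightarrow> x \<in> carrier_vec n \<Longrightarrow> \<forall>a\<in>set as. x \<sqdot> a = 0 \<Longrightarrow> refls B as x = x"
  by (induction as) (auto simp: aniso_def reflection_fix)

lemma refls_rev [simp]:
  "set as \<subseteq> aniso (carrier_vec n) \<Longrightarrow> x \<in> carrier_vec n \<Longrightarrow> refls B (rev as) (refls B as x) = x"
  by (induction as) (auto simp: aniso_def)

lemma refls_rev' [simp]:
  "set as \<subseteq> aniso (carrier_vec n) \<Longrightarrow> x \<in> carrier_vec n \<Longrightarrow> refls B as (refls B (rev as) x) = x"
  using refls_rev[of "rev as" x] by simp

text \<open>Each letter changes a vector by a multiple of itself. This is the source of the fact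
  that elements of a parabolic subgroup move vectors only inside the span of its roots.\<close>

lemma refls_moves:
  assumes "subsp W" "set as \<subseteq> aniso W" "x \<in> carrier_vec n"
  shows "refls B as x - x \<in> W"
  using assms(2)
proof (induction as)
  case Nil
  then show ?case
    using assms by (simp add: subsp_zero)
next
  case (Cons a as)
  have c: "set as \<subseteq> aniso (carrier_vec n)" "a \<in> carrier_vec n" "a \<in> W"
    using Cons.prems assms(1) by (auto simp: aniso_def dest: subsp_carrier)
  then have y: "refls B as x \<in> carrier_vec n"
    using assms by simp
  have "refls B (a # as) x - x
      = (refls B as x - x) - (2 * (refls B as x \<sqdot> a / (a \<sqdot> a))) \<cdot>\<^sub>v a"
    using c y assms(3) by (intro eq_vecI) (auto simp: reflection_def)
  then show ?case
    using Cons c assms(1) by (auto intro!: subsp_minus subsp_smult)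
qed


section \<open>Spinor norms as signs of permutations\<close>

text \<open>Extended by the identity, because \<open>sign\<close> refers to permutations of the
  whole type.\<close>

definition perm_on :: "'a vec set \<Rightarrow> ('a vec \<Rightarrow> 'a vec) \<Rightarrow> 'a vec \<Rightarrow> 'a vec" where
  "perm_on X f x = (if x \<in> X then f x else x)"

definition sphere :: "'a vec set \<Rightarrow> 'a \<Rightarrow> 'a vec set" where
  "sphere W t = {x \<in> W. x \<sqdot> x = t}"

lemma uminus_eq_smult: "- x = (- 1) \<cdot>\<^sub>v (x :: 'a vec)"
  by (intro eq_vecI) auto

lemma vec_neq_uminus:
  assumes "x \<in> carrier_vec n" "x \<sqdot> x \<noteq> 0"
  shows "- x \<noteq> x"
proof
  assume "- x = x"
  then have "x \<sqdot> x = - (x \<sqdot> x)"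
    using form_smult_left[of x x "- 1"] assms(1) by (simp flip: uminus_eq_smult)
  then have "2 * (x \<sqdot> x) = 0"
    by (metis add.right_inverse mult_2)
  then show False
    using two assms(2) by simp
qed

lemma sphere_reflection:
  "subsp W \<Longrightarrow> a \<in> aniso W \<Longrightarrow> x \<in> sphere W t \<Longrightarrow> reflection B a x \<in> sphere W t"
  using form_reflection[of a x x]
  by (auto simp: sphere_def aniso_def dest: subsp_carrier intro: reflection_in)

lemma sphere_uminus:
  "subsp W \<Longrightarrow> x \<in> sphere W t \<Longrightarrow> - x \<in> sphere W t"
  by (auto simp: sphere_def subsp_uminus)
    (simp add: uminus_eq_smult subsp_carrier)

text \<open>The Klein group generated by \<open>-1\<close> and \<open>r\<^sub>a\<close> acts on the points of the sphere moved by
  \<open>r\<^sub>a\<close>, freely except on multiples of \<open>a\<close>. Hence, up to an even number of transpositions,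
  \<open>r\<^sub>a\<close> only swaps the two multiples of \<open>a\<close> on the sphere, if there are any.\<close>

lemma sign_reflection:
  assumes W: "subsp W" and a: "a \<in> aniso W" and \<nu>: "\<nu> \<noteq> 0"
  shows "permutation (perm_on (sphere W \<nu>) (reflection B a))
    \<and> sign (perm_on (sphere W \<nu>) (reflection B a)) = (if nonzero_square (\<nu> * (a \<sqdot> a)) then - 1 else 1)"
proof -
  let ?X = "sphere W \<nu>" and ?r = "reflection B a"
  let ?f = "perm_on ?X ?r"
  have ac: "a \<in> carrier_vec n" "a \<in> W" "a \<sqdot> a \<noteq> 0"
    using W a by (auto simp: aniso_def dest: subsp_carrier)
  have Xc: "x \<in> carrier_vec n" "x \<sqdot> x = \<nu>" "x \<in> W" if "x \<in> ?X" for x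
    using that W by (auto simp: sphere_def dest: subsp_carrier)
  have finX: "finite ?X"
    using subsp_finite[OF W] by (rule finite_subset[rotated]) (auto simp: sphere_def)
  have moved: "?r x \<noteq> x \<longleftrightarrow> x \<sqdot> a \<noteq> 0" if "x \<in> ?X" for x
  proof -
    have x: "x \<in> carrier_vec n"
      using Xc that by simp
    have "?r x \<sqdot> a - x \<sqdot> a = - 2 * (x \<sqdot> a)"
      using x ac by (simp add: reflection_def)
    then show ?thesis
      using two reflection_fix[OF ac(1) x] by auto
  qed
  let ?M = "{x. ?f x \<noteq> x}"
  let ?L = "{x \<in> ?X. \<exists>c. x = c \<cdot>\<^sub>v a}"
  have M: "?M = {x \<in> ?X. x \<sqdot> a \<noteq> 0}"
    using moved by (auto simp: perm_on_def)
  have LM: "?L \<subseteq> ?M"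
    unfolding M using ac \<nu> by (auto simp: sphere_def)
  have finM: "finite ?M"
    using finX by (simp add: M)
  have invol: "?f (?f x) = x" for x
    using sphere_reflection[OF W a] Xc ac by (auto simp: perm_on_def)
  have four: "4 dvd card (?M - ?L)"
  proof (rule four_dvd_card_klein[of _ ?r uminus])
    fix x assume x: "x \<in> ?M - ?L"
    then have xX: "x \<in> ?X" and xa: "x \<sqdot> a \<noteq> 0" and nl: "\<nexists>c. x = c \<cdot>\<^sub>v a"
      by (auto simp: M)
    have xc: "x \<in> carrier_vec n"
      using Xc xX by simp
    have rX: "?r x \<in> ?X" and uX: "- x \<in> ?X"
      using sphere_reflection[OF W a xX] sphere_uminus[OF W xX] by auto
    have "?r x \<sqdot> a = - (x \<sqdot> a)"
      using xc ac by (simp add: reflection_def)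
    moreover have "\<nexists>c. ?r x = c \<cdot>\<^sub>v a"
    proof
      assume "\<exists>c. ?r x = c \<cdot>\<^sub>v a"
      then obtain c where "?r x = c \<cdot>\<^sub>v a" ..
      then have "x = ?r (c \<cdot>\<^sub>v a)"
        using xc ac by (metis reflection_reflection)
      also have "\<dots> = (- c) \<cdot>\<^sub>v a"
        using ac by (intro eq_vecI) (auto simp: reflection_def)
      finally show False
        using nl by blast
    qed
    moreover have "(- x) \<sqdot> a = - (x \<sqdot> a)"
      using xc ac by (simp add: uminus_eq_smult)
    moreover have "\<nexists>c. - x = c \<cdot>\<^sub>v a"
    proof
      assume "\<exists>c. - x = c \<cdot>\<^sub>v a"
      then obtain c where "- x = c \<cdot>\<^sub>v a" ..
      then have "x = - (c \<cdot>\<^sub>v a)"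
        by (metis uminus_uminus_vec)
      then have "x = (- c) \<cdot>\<^sub>v a"
        using ac xc by (intro eq_vecI) auto
      then show False
        using nl by blast
    qed
    moreover have "?r (- x) = - ?r x"
      using xc ac by (simp add: uminus_eq_smult reflection_smult)
    ultimately show "?r x \<in> ?M - ?L \<and> - x \<in> ?M - ?L \<and> ?r (?r x) = x \<and> - (- x) = x \<and> ?r (- x) = - ?r x"
      using rX uX xa xc ac by (auto simp: M)
    have "?r x \<noteq> - x"
    proof
      assume e: "?r x = - x"
      have "x = ((x \<sqdot> a) / (a \<sqdot> a)) \<cdot>\<^sub>v a"
      proof (rule eq_vecI)
        fix i assume "i < dim_vec (((x \<sqdot> a) / (a \<sqdot> a)) \<cdot>\<^sub>v a)"
        then have i: "i < n"
          using ac by simp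
        have "?r x $ i = (- x) $ i"
          using e by simp
        then have "2 * (x $ i) = 2 * (((x \<sqdot> a) / (a \<sqdot> a)) * a $ i)"
          using i xc ac by (simp add: reflection_def algebra_simps)
        then have "x $ i = ((x \<sqdot> a) / (a \<sqdot> a)) * a $ i"
          using two by (metis mult_left_cancel)
        then show "x $ i = (((x \<sqdot> a) / (a \<sqdot> a)) \<cdot>\<^sub>v a) $ i"
          using i ac by simp
      qed (use xc ac in simp)
      then show False
        using nl by blast
    qed
    moreover have "- x \<noteq> x"
      using vec_neq_uminus[of x] Xc[OF xX] \<nu> by simp
    ultimately show "?r x \<noteq> x \<and> - x \<noteq> x \<and> ?r x \<noteq> - x"
      using moved[OF xX] xa by simp
  qed (use finM in simp)
  have L: "card ?L = (if nonzero_square (\<nu> * (a \<sqdot> a)) then 2 else 0)"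
  proof (cases "nonzero_square (\<nu> * (a \<sqdot> a))")
    case False
    have "?L = {}"
    proof (rule ccontr)
      assume "?L \<noteq> {}"
      then obtain c where "c \<cdot>\<^sub>v a \<in> ?X"
        by blast
      then have "\<nu> * (a \<sqdot> a) = (c * (a \<sqdot> a)) ^ 2"
        using ac by (simp add: sphere_def power2_eq_square mult_ac)
      moreover from this have "c * (a \<sqdot> a) \<noteq> 0"
        using \<nu> ac(3) by auto
      ultimately have "nonzero_square (\<nu> * (a \<sqdot> a))"
        unfolding nonzero_square_def by blast
      then show False
        using False by simp
    qed
    then have "card ?L = 0"
      by (simp only: card.empty)
    then show ?thesis
      using False by simp
  next
    case True
    then obtain s where s: "s \<noteq> 0" "\<nu> * (a \<sqdot> a) = s ^ 2"
      by (auto simp: nonzero_square_def)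
    \<comment> \<open>\<open>c \<cdot>\<^sub>v a\<close> has norm
      \<open>s^2 / (a \<sqdot> a) = \<nu>\<close>, so it and its negative are the points of the
      sphere on the line of \<open>a\<close>.\<close>
    define c where "c = s / (a \<sqdot> a)"
    have c: "c ^ 2 * (a \<sqdot> a) = \<nu>"
      using s(2) ac(3) by (simp add: c_def power_divide) (simp add: power2_eq_square field_simps)
    have "x \<in> ?L \<longleftrightarrow> x = c \<cdot>\<^sub>v a \<or> x = - (c \<cdot>\<^sub>v a)" for x
    proof
      assume "x \<in> ?L"
      then obtain d where d: "x = d \<cdot>\<^sub>v a" "d ^ 2 * (a \<sqdot> a) = \<nu>"
        using ac by (auto simp: sphere_def power2_eq_square mult.assoc)
      then have "d ^ 2 = c ^ 2"
        using c ac(3) by (metis mult_right_cancel)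
      then show "x = c \<cdot>\<^sub>v a \<or> x = - (c \<cdot>\<^sub>v a)"
        using ac d(1) by (auto simp: power2_eq_iff)
    next
      assume "x = c \<cdot>\<^sub>v a \<or> x = - (c \<cdot>\<^sub>v a)"
      moreover have "c \<cdot>\<^sub>v a \<in> ?X"
        using c ac W by (simp add: sphere_def power2_eq_square mult.assoc subsp_smult)
      moreover have "- (c \<cdot>\<^sub>v a) = (- c) \<cdot>\<^sub>v a"
        using ac by (intro eq_vecI) auto
      ultimately show "x \<in> ?L"
        using sphere_uminus[OF W, of "c \<cdot>\<^sub>v a" \<nu>] by auto
    qed
    then have "?L = {c \<cdot>\<^sub>v a, - (c \<cdot>\<^sub>v a)}"
      by blast
    moreover have "- (c \<cdot>\<^sub>v a) \<noteq> c \<cdot>\<^sub>v a"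
      using vec_neq_uminus[of "c \<cdot>\<^sub>v a"] ac c \<nu> by (auto simp: power2_eq_square mult.assoc)
    ultimately show ?thesis
      using True by simp
  qed
  have "card ?M = card (?M - ?L) + card ?L"
    using card_Diff_subset[OF finite_subset[OF LM finM] LM] card_mono[OF finM LM] by linarith
  moreover obtain k where "card (?M - ?L) = 4 * k"
    using four by blast
  \<comment> \<open>Half the number of moved points is the number of transpositions; the free orbits
    contribute the even summand \<open>2 * k\<close>.\<close>
  ultimately have "card ?M div 2 = 2 * k + (if nonzero_square (\<nu> * (a \<sqdot> a)) then 1 else 0)"
    using L by auto
  then show ?thesis
    using sign_involution[of ?f] finM invol by (auto simp: power_add power_mult)
qed

lemma sign_refls:
  assumes W: "subsp W" and as: "set as \<subseteq> aniso W" and \<nu>: "\<nu> \<noteq> 0"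
  shows "permutation (perm_on (sphere W \<nu>) (refls B as))
    \<and> sign (perm_on (sphere W \<nu>) (refls B as))
      = (- 1) ^ length (filter (\<lambda>a. nonzero_square (\<nu> * (a \<sqdot> a))) as)"
  using as
proof (induction as)
  case Nil
  have id: "perm_on (sphere W \<nu>) (refls B []) = id"
    by (auto simp: perm_on_def)
  show ?case
    unfolding id by (simp add: permutation_id)
next
  case (Cons a as)
  let ?X = "sphere W \<nu>"
  have a: "a \<in> aniso W"
    using Cons.prems by simp
  have inX: "refls B as x \<in> ?X" if "x \<in> ?X" for x
    using Cons.prems that by (induction as) (auto intro: sphere_reflection[OF W])
  have eq: "perm_on ?X (refls B (a # as)) = perm_on ?X (reflection B a) \<circ> perm_on ?X (refls B as)"
    using inX by (auto simp: perm_on_def)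
  have p: "permutation (perm_on ?X (reflection B a))" "permutation (perm_on ?X (refls B as))"
    using Cons sign_reflection[OF W a \<nu>] by auto
  have "permutation (perm_on ?X (refls B (a # as)))"
    using permutation_compose[OF p] by (simp only: eq)
  moreover have "sign (perm_on ?X (refls B (a # as)))
      = sign (perm_on ?X (reflection B a)) * sign (perm_on ?X (refls B as))"
    using sign_compose[OF p] by (simp only: eq)
  ultimately show ?case
    using Cons sign_reflection[OF W a \<nu>] by (simp only:) auto
qed

text \<open>Both parities are read off the sign of the same permutation. The sphere lies in
  \<open>W\<close>, so agreement on \<open>W\<close> suffices.\<close>

lemma refls_sign_parity:
  assumes "subsp W" "set as \<subseteq> aniso W" "set bs \<subseteq> aniso W" and \<nu>: "\<nu> \<noteq> 0"
    and "\<And>x. x \<in> W \<Longrightarrow> refls B as x = refls B bs x"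
  shows "even (length (filter (\<lambda>a. nonzero_square (\<nu> * (a \<sqdot> a))) as))
    \<longleftrightarrow> even (length (filter (\<lambda>a. nonzero_square (\<nu> * (a \<sqdot> a))) bs))"
proof -
  have "perm_on (sphere W \<nu>) (refls B as) = perm_on (sphere W \<nu>) (refls B bs)"
    using assms(5) by (auto simp: perm_on_def sphere_def)
  then have "(- 1 :: int) ^ length (filter (\<lambda>a. nonzero_square (\<nu> * (a \<sqdot> a))) as)
      = (- 1) ^ length (filter (\<lambda>a. nonzero_square (\<nu> * (a \<sqdot> a))) bs)"
    using sign_refls[OF assms(1,2) \<nu>] sign_refls[OF assms(1,3) \<nu>] by metis
  then show ?thesis
    by (simp add: minus_one_power_iff split: if_splits)
qed

text \<open>The sphere of a non-square radius detects the letters of non-square norm, the sphere of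
  radius 1 those of square norm.\<close>

theorem refls_spinor_norm:
  assumes "subsp W" "set as \<subseteq> aniso W" "set bs \<subseteq> aniso W"
    and "\<And>x. x \<in> W \<Longrightarrow> refls B as x = refls B bs x"
  shows "even (length (filter (\<lambda>a. \<not> nonzero_square (a \<sqdot> a)) as))
      \<longleftrightarrow> even (length (filter (\<lambda>a. \<not> nonzero_square (a \<sqdot> a)) bs))"
    and "even (length (filter (\<lambda>a. nonzero_square (a \<sqdot> a)) as))
      \<longleftrightarrow> even (length (filter (\<lambda>a. nonzero_square (a \<sqdot> a)) bs))"
proof -
  obtain \<nu> :: 'a where \<nu>: "\<nu> \<noteq> 0" "\<not> nonzero_square \<nu>"
    using exists_nonsquare[OF two] by blast
  have "nonzero_square (\<nu> * (a \<sqdot> a)) \<longleftrightarrow> \<not> nonzero_square (a \<sqdot> a)" if "a \<in> aniso W" for a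
    using nonsquare_mult[OF two \<nu>, of "a \<sqdot> a"] nonzero_square_mult_iff[of "a \<sqdot> a" \<nu>] \<nu>(2) that
    by (auto simp: aniso_def mult.commute)
  then have "filter (\<lambda>a. nonzero_square (\<nu> * (a \<sqdot> a))) cs = filter (\<lambda>a. \<not> nonzero_square (a \<sqdot> a)) cs"
    if "set cs \<subseteq> aniso W" for cs
    using that by (intro filter_cong) auto
  then show "even (length (filter (\<lambda>a. \<not> nonzero_square (a \<sqdot> a)) as))
      \<longleftrightarrow> even (length (filter (\<lambda>a. \<not> nonzero_square (a \<sqdot> a)) bs))"
    using refls_sign_parity[OF assms(1-3) \<nu>(1) assms(4)] assms(2,3) by simp
  show "even (length (filter (\<lambda>a. nonzero_square (a \<sqdot> a)) as))
      \<longleftrightarrow> even (length (filter (\<lambda>a. nonzero_square (a \<sqdot> a)) bs))"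
    using refls_sign_parity[OF assms(1-3), of 1] assms(4) by simp
qed


section \<open>Generation by reflections\<close>

lemma isotropic_subspace_rad:
  assumes W: "subsp W" and iso: "\<And>x. x \<in> W \<Longrightarrow> x \<sqdot> x = 0"
  shows "rad B W = W"
proof -
  have "x \<sqdot> y = 0" if xy: "x \<in> W" "y \<in> W" for x y
  proof -
    have c: "x \<in> carrier_vec n" "y \<in> carrier_vec n"
      using W xy by (auto dest: subsp_carrier)
    have "(x + y) \<sqdot> (x + y) = 2 * (x \<sqdot> y)"
      using c iso[OF xy(1)] iso[OF xy(2)] by (simp add: form_sym[OF c(2,1)])
    then show ?thesis
      using iso[OF subsp_add[OF W xy]] two by simp
  qed
  then show ?thesis
    using W by (auto simp: rad_def perp_def dest: subsp_carrier)
qed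

text \<open>The norms of \<open>w - v\<close> and \<open>w + v\<close> add up to
  \<open>4 * (v \<sqdot> v)\<close>, so one of these vectors is anisotropic. The reflection in the
  first takes \<open>w\<close> to \<open>v\<close>; the one in the second takes \<open>w\<close> to
  \<open>- v\<close>, which the reflection in \<open>v\<close> corrects.\<close>

lemma isometry_fixing_vector_by_refls:
  assumes W: "subsp W" and v: "v \<in> W" "v \<sqdot> v \<noteq> 0" and w: "w \<in> W" "w \<sqdot> w = v \<sqdot> v"
  shows "\<exists>as. set as \<subseteq> aniso W \<and> refls B as w = v"
proof -
  have c: "v \<in> carrier_vec n" "w \<in> carrier_vec n"
    using assms by (auto dest: subsp_carrier)
  have m: "w - v \<in> W" "w + v \<in> W"
    using assms by (auto intro: subsp_minus subsp_add)
  show ?thesis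
  proof (cases "(w - v) \<sqdot> (w - v) = 0")
    case False
    then have "w - v \<in> aniso W" "reflection B (w - v) w = v"
      unfolding aniso_def using m c w reflection_difference[of w v] by blast+
    then show ?thesis
      by (intro exI[of _ "[w - v]"]) simp
  next
    case True
    have e: "w - (- v) = w + v"
      using c by (intro eq_vecI) auto
    have uv: "(- v) \<sqdot> (- v) = v \<sqdot> v"
      using c by (simp add: uminus_eq_smult)
    have "(w - v) \<sqdot> (w - v) + (w + v) \<sqdot> (w + v) = 4 * (v \<sqdot> v)"
      using c w by (simp add: form_sym[of w v])
    moreover have "(4::'a) = 2 * 2"
      by simp
    ultimately have ne: "(w + v) \<sqdot> (w + v) \<noteq> 0"
      using True two v(2) by (metis add_0 mult_eq_0_iff)
    then have "reflection B (w + v) w = - v"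
      using reflection_difference[of w "- v"] c w uv e by simp
    moreover have "reflection B v (- v) = v"
      using reflection_reflection[OF c(1,1) v(2)] reflection_of_root[OF c(1) v(2)] by simp
    moreover have "v \<in> aniso W" "w + v \<in> aniso W"
      unfolding aniso_def using m ne v by blast+
    ultimately show ?thesis
      by (intro exI[of _ "[v, w + v]"]) simp
  qed
qed

text \<open>Weak Cartan--Dieudonne theorem. The proof splits off an anisotropic vector; this does not
  change the radical, so \<open>W\<close> may be singular.\<close>

theorem isometry_by_refls:
  assumes "subsp W"
    and "\<And>x. x \<in> W \<Longrightarrow> f x \<in> W"
    and "\<And>x y. x \<in> W \<Longrightarrow> y \<in> W \<Longrightarrow> f (x + y) = f x + f y"
    and "\<And>c x. x \<in> W \<Longrightarrow> f (c \<cdot>\<^sub>v x) = c \<cdot>\<^sub>v f x"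
    and "\<And>x y. x \<in> W \<Longrightarrow> y \<in> W \<Longrightarrow> f x \<sqdot> f y = x \<sqdot> y"
    and "\<And>x. x \<in> rad B W \<Longrightarrow> f x = x"
  shows "\<exists>as. set as \<subseteq> aniso W \<and> (\<forall>x\<in>W. f x = refls B as x)"
  using assms
proof (induction "card W" arbitrary: W f rule: less_induct)
  case less
  note W = less.prems(1)
  have Wc: "x \<in> carrier_vec n" if "x \<in> W" for x
    using W that by (rule subsp_carrier)
  show ?case
  proof (cases "\<forall>x\<in>W. x \<sqdot> x = 0")
    case True
    then have "rad B W = W"
      using isotropic_subspace_rad[OF W] by blast
    then show ?thesis
      using less.prems(6) by (intro exI[of _ "[]"]) auto
  next
    case False
    then obtain v where v: "v \<in> W" "v \<sqdot> v \<noteq> 0"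
      by blast
    obtain bs where bs: "set bs \<subseteq> aniso W" "refls B bs (f v) = v"
      using isometry_fixing_vector_by_refls[OF W v, of "f v"] less.prems(2,5) v(1) by metis
    have bsc: "set bs \<subseteq> aniso (carrier_vec n)"
      using bs(1) Wc by (auto simp: aniso_def)
    define g where "g x = refls B bs (f x)" for x
    define U where "U = {x \<in> W. x \<sqdot> v = 0}"
    have UW: "U \<subseteq> W"
      by (auto simp: U_def)
    have U: "subsp U"
      using W Wc v(1) by (auto simp: U_def subsp_def)
    have g: "g x \<in> W" if "x \<in> W" for x
      using less.prems(2) that bs(1) W by (simp add: g_def refls_in)
    have gadd: "g (x + y) = g x + g y" if "x \<in> W" "y \<in> W" for x y
      using less.prems(2,3) that bsc Wc by (simp add: g_def refls_add)
    have gsmult: "g (c \<cdot>\<^sub>v x) = c \<cdot>\<^sub>v g x" if "x \<in> W" for c x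
      using less.prems(2,4) that bsc Wc by (simp add: g_def refls_smult)
    have gform: "g x \<sqdot> g y = x \<sqdot> y" if "x \<in> W" "y \<in> W" for x y
      using less.prems(2,5) that bsc Wc by (simp add: g_def form_refls)
    have gv: "g v = v"
      by (simp add: g_def bs(2))
    have gU: "g x \<in> U" if "x \<in> U" for x
      using that g gform[of x v] gv v(1) by (simp add: U_def)
    have decomp: "\<exists>c u. u \<in> U \<and> x = c \<cdot>\<^sub>v v + u" if x: "x \<in> W" for x
    proof (intro exI conjI)
      show "x - (x \<sqdot> v / (v \<sqdot> v)) \<cdot>\<^sub>v v \<in> U"
        using x v Wc W by (auto simp: U_def intro: subsp_minus subsp_smult)
      show "x = (x \<sqdot> v / (v \<sqdot> v)) \<cdot>\<^sub>v v + (x - (x \<sqdot> v / (v \<sqdot> v)) \<cdot>\<^sub>v v)"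
        using Wc[OF x] Wc[OF v(1)] by (intro eq_vecI) auto
    qed
    \<comment> \<open>A vector of \<open>rad B U\<close> is orthogonal to \<open>U\<close> and,
      being in \<open>U\<close>, also to \<open>v\<close>, hence to all of \<open>W\<close>. So
      \<open>f\<close> fixes it by assumption, and the letters of \<open>bs\<close> fix it because
      they lie in \<open>W\<close>.\<close>
    have grad: "g x = x" if x: "x \<in> rad B U" for x
    proof -
      have xU: "x \<in> U" and xW: "x \<in> W"
        using x UW by (auto simp: rad_def)
      have "x \<sqdot> y = 0" if y: "y \<in> W" for y
      proof -
        obtain c u where u: "u \<in> U" "y = c \<cdot>\<^sub>v v + u"
          using decomp[OF y] by blast
        then show ?thesis
          using radD[OF x u(1)] xU v(1) Wc UW xW by (auto simp: U_def)
      qed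
      then have xr: "x \<in> rad B W"
        using xW Wc by (auto simp: rad_def perp_def)
      then have "\<forall>a\<in>set bs. x \<sqdot> a = 0"
        using bs(1) radD[OF xr] by (auto simp: aniso_def)
      then show ?thesis
        using less.prems(6)[OF xr] refls_fix[OF bsc Wc[OF xW]] by (simp add: g_def)
    qed
    have "U \<subset> W"
      using UW v by (auto simp: U_def)
    then have "card U < card W"
      using subsp_finite[OF W] by (rule psubset_card_mono[rotated])
    from less.hyps[OF this U gU _ _ _ grad] obtain as
      where as: "set as \<subseteq> aniso U" "\<forall>x\<in>U. g x = refls B as x"
      using gadd gsmult gform UW by (metis subsetD)
    have asW: "set as \<subseteq> aniso W"
      using as(1) aniso_mono[OF UW] by blast
    have asc: "set as \<subseteq> aniso (carrier_vec n)"
      using asW Wc by (auto simp: aniso_def)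
    have asv: "refls B as v = v"
      using as(1) Wc v(1) UW
      by (intro refls_fix[OF asc]) (auto simp: aniso_def U_def form_sym[of v])
    have "f x = refls B (rev bs @ as) x" if x: "x \<in> W" for x
    proof -
      obtain c u where u: "u \<in> U" "x = c \<cdot>\<^sub>v v + u"
        using decomp[OF x] by blast
      have uW: "u \<in> W"
        using u(1) UW by blast
      have "g x = c \<cdot>\<^sub>v v + refls B as u"
        using u(2) uW v(1) W as(2) u(1) gv by (simp add: gadd gsmult subsp_smult)
      also have "\<dots> = refls B as x"
        using u(2) Wc[OF uW] Wc[OF v(1)] asv by (simp add: refls_add[OF asc] refls_smult[OF asc])
      finally have "refls B as x = refls B bs (f x)"
        by (simp add: g_def)
      then show ?thesis
        using refls_rev[OF bsc] Wc less.prems(2)[OF x] by simp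
    qed
    then show ?thesis
      using bs(1) asW by (intro exI[of _ "rev bs @ as"]) auto
  qed
qed


section \<open>The kernel of the spinor norm\<close>

text \<open>In the Clifford algebra of the plane spanned by \<open>a\<close>, \<open>b\<close> the vector \<open>d\<close> below is the
  product \<open>e a b\<close>.\<close>

lemma reflection_product_plane:
  assumes a: "a \<in> carrier_vec n" "a \<sqdot> a \<noteq> 0" and b: "b \<in> carrier_vec n" "b \<sqdot> b \<noteq> 0"
    and e_def: "e = x \<cdot>\<^sub>v a + y \<cdot>\<^sub>v b" and e: "e \<sqdot> e \<noteq> 0"
    and d_def: "d = (x * (a \<sqdot> a) + 2 * y * (a \<sqdot> b)) \<cdot>\<^sub>v b - (y * (b \<sqdot> b)) \<cdot>\<^sub>v a"
  shows "d \<sqdot> d = (a \<sqdot> a) * (b \<sqdot> b) * (e \<sqdot> e)"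
    and "u \<in> carrier_vec n \<Longrightarrow> reflection B a (reflection B b u) = reflection B e (reflection B d u)"
proof -
  define A C D E where "A = a \<sqdot> a" and "C = a \<sqdot> b" and "D = b \<sqdot> b" and "E = e \<sqdot> e"
  have ne: "A \<noteq> 0" "D \<noteq> 0" "E \<noteq> 0"
    using a b e by (auto simp: A_def D_def E_def)
  have ba: "b \<sqdot> a = C"
    using a b by (simp add: C_def form_sym[of b a])
  have ec: "e \<in> carrier_vec n" and dc: "d \<in> carrier_vec n"
    using a b by (auto simp: e_def d_def)
  have E: "E = x * x * A + 2 * x * y * C + y * y * D"
    using a b ba by (simp add: E_def e_def flip: A_def C_def D_def) (simp add: algebra_simps)
  have "d \<sqdot> d = (x * A + 2 * y * C) * ((x * A + 2 * y * C) * D - y * D * C)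
      - y * D * ((x * A + 2 * y * C) * C - y * D * A)"
    using a b ba by (simp add: d_def flip: A_def C_def D_def)
  also have "\<dots> = A * D * E"
    by (simp add: E algebra_simps)
  finally have dd: "d \<sqdot> d = A * D * E" .
  then show "d \<sqdot> d = (a \<sqdot> a) * (b \<sqdot> b) * (e \<sqdot> e)"
    by (simp add: A_def D_def E_def)
  have "d \<sqdot> e = (x * A + 2 * y * C) * (x * C + y * D) - y * D * (x * A + y * C)"
    using a b ba by (simp add: d_def e_def flip: A_def C_def D_def) (simp add: algebra_simps)
  also have "\<dots> = C * E"
    by (simp add: E algebra_simps)
  finally have de: "d \<sqdot> e = C * E" .
  assume u: "u \<in> carrier_vec n"
  define s t ud ue where "s = u \<sqdot> a" and "t = u \<sqdot> b" and "ud = u \<sqdot> d" and "ue = u \<sqdot> e"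
  have ud: "ud = (x * A + 2 * y * C) * t - y * D * s"
    using a b u by (simp add: ud_def d_def s_def t_def A_def C_def D_def)
  have ue: "ue = x * s + y * t"
    using a b u by (simp add: ue_def e_def s_def t_def)
  \<comment> \<open>Comparison of the coefficients of \<open>a\<close>, cleared of the denominator
    \<open>A * D * E\<close> to become a polynomial identity.\<close>
  have "ud * (y * D) - (ue * (A * D) - 2 * ud * C) * x = (2 * t * C - s * D) * E"
    unfolding ud ue E by (simp add: algebra_simps)
  then have "2 / (A * D * E) * (ud * (y * D) - (ue * (A * D) - 2 * ud * C) * x)
      = 2 / (A * D * E) * ((2 * t * C - s * D) * E)"
    by (rule arg_cong)
  moreover have "2 * (ud / (A * D * E)) * (y * D) - 2 * (ue / E - 2 * (ud / (A * D * E)) * C) * x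
      = 2 / (A * D * E) * (ud * (y * D) - (ue * (A * D) - 2 * ud * C) * x)"
    using ne by (simp add: field_simps)
  moreover have "2 / (A * D * E) * ((2 * t * C - s * D) * E) = - 2 * (s / A - 2 * (t / D) * C / A)"
    using ne by (simp add: field_simps)
  ultimately have ca: "2 * (ud / (A * D * E)) * (y * D)
      - 2 * (ue / E - 2 * (ud / (A * D * E)) * C) * x = - 2 * (s / A - 2 * (t / D) * C / A)"
    by simp
  \<comment> \<open>The same for the coefficients of \<open>b\<close>.\<close>
  have "ud * (x * A + 2 * y * C) + (ue * (A * D) - 2 * ud * C) * y = t * A * E"
    unfolding ud ue E by (simp add: algebra_simps)
  then have "2 / (A * D * E) * (ud * (x * A + 2 * y * C) + (ue * (A * D) - 2 * ud * C) * y)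
      = 2 / (A * D * E) * (t * A * E)"
    by (rule arg_cong)
  moreover have "2 * (ud / (A * D * E)) * (x * A + 2 * y * C)
      + 2 * (ue / E - 2 * (ud / (A * D * E)) * C) * y
      = 2 / (A * D * E) * (ud * (x * A + 2 * y * C) + (ue * (A * D) - 2 * ud * C) * y)"
    using ne by (simp add: field_simps)
  moreover have "2 / (A * D * E) * (t * A * E) = 2 * (t / D)"
    using ne by (simp add: field_simps)
  ultimately have cb: "2 * (ud / (A * D * E)) * (x * A + 2 * y * C)
      + 2 * (ue / E - 2 * (ud / (A * D * E)) * C) * y = 2 * (t / D)"
    by simp
  have "reflection B e (reflection B d u)
      = u - (2 * (ud / (A * D * E))) \<cdot>\<^sub>v d - (2 * (ue / E - 2 * (ud / (A * D * E)) * C)) \<cdot>\<^sub>v e"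
    using ne u ec dc
    by (simp add: reflection_def dd de diff_divide_distrib flip: ud_def ue_def E_def)
  moreover have "reflection B a (reflection B b u)
      = u - (2 * (t / D)) \<cdot>\<^sub>v b - (2 * (s / A - 2 * (t / D) * C / A)) \<cdot>\<^sub>v a"
    using ne u a b
    by (simp add: reflection_def ba diff_divide_distrib flip: s_def t_def A_def D_def)
  moreover have "u - (2 * (ud / (A * D * E))) \<cdot>\<^sub>v d - (2 * (ue / E - 2 * (ud / (A * D * E)) * C)) \<cdot>\<^sub>v e
      = u - (2 * (t / D)) \<cdot>\<^sub>v b - (2 * (s / A - 2 * (t / D) * C / A)) \<cdot>\<^sub>v a" (is "?l = ?r")
  proof (rule eq_vecI)
    fix i assume "i < dim_vec ?r"
    then have i: "i < n"
      using a by simp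
    have gen: "(u - k \<cdot>\<^sub>v d - l \<cdot>\<^sub>v e) $ i
        = u $ i - (k * (x * A + 2 * y * C) + l * y) * b $ i + (k * (y * D) - l * x) * a $ i" for k l
      using i u a b
      by (simp add: d_def e_def flip: A_def C_def D_def) (simp add: algebra_simps)
    have "?l $ i = u $ i - 2 * (t / D) * b $ i + - 2 * (s / A - 2 * (t / D) * C / A) * a $ i"
      by (simp only: gen ca cb)
    also have "\<dots> = ?r $ i"
      using i u a b by (simp add: algebra_simps)
    finally show "?l $ i = ?r $ i" .
  qed (use a ec in simp)
  ultimately show "reflection B a (reflection B b u) = reflection B e (reflection B d u)"
    by simp
qed

text \<open>A predicate on functions, so that products of reflections can be regrouped without
  naming their words.\<close>

definition square_word :: "'a vec set \<Rightarrow> ('a vec \<Rightarrow> 'a vec) \<Rightarrow> bool" where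
  "square_word W f \<longleftrightarrow> (\<exists>cs. set cs \<subseteq> square_roots W \<and> (\<forall>u\<in>carrier_vec n. f u = refls B cs u))"

lemma square_word_comp:
  assumes "subsp W" "square_word W f" "square_word W g"
  shows "square_word W (\<lambda>u. f (g u))"
proof -
  obtain cs ds where c: "set cs \<subseteq> square_roots W" "\<forall>u\<in>carrier_vec n. f u = refls B cs u"
    and d: "set ds \<subseteq> square_roots W" "\<forall>u\<in>carrier_vec n. g u = refls B ds u"
    using assms unfolding square_word_def by blast
  have "set ds \<subseteq> aniso (carrier_vec n)"
    using d(1) square_roots_aniso assms(1) by (fastforce simp: aniso_def dest: subsp_carrier)
  then show ?thesis
    using c d unfolding square_word_def by (intro exI[of _ "cs @ ds"]) auto
qed

text \<open>A non-degenerate plane contains a vector \<open>e\<close> of norm 1. Rewriting the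
  product of the two reflections with \<open>e\<close> as first root makes the second root have norm
  \<open>(a \<sqdot> a) * (b \<sqdot> b)\<close>, a product of two non-squares and hence a
  square.\<close>

lemma nonsquare_pair_nonsingular:
  assumes W: "subsp W" and a: "a \<in> W" "a \<sqdot> a \<noteq> 0" "\<not> nonzero_square (a \<sqdot> a)"
    and b: "b \<in> W" "b \<sqdot> b \<noteq> 0" "\<not> nonzero_square (b \<sqdot> b)"
    and ns: "(a \<sqdot> b) ^ 2 \<noteq> (a \<sqdot> a) * (b \<sqdot> b)"
  shows "square_word W (\<lambda>u. reflection B a (reflection B b u))"
proof -
  define A C D where "A = a \<sqdot> a" and "C = a \<sqdot> b" and "D = b \<sqdot> b"
  have c: "a \<in> carrier_vec n" "b \<in> carrier_vec n"
    using W a b by (auto dest: subsp_carrier)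
  have ba: "b \<sqdot> a = C"
    using c by (simp add: C_def form_sym[of b a])
  have A0: "A \<noteq> 0"
    using a by (simp add: A_def)
  have D'0: "D - C ^ 2 / A \<noteq> 0"
    using ns A0 by (simp add: A_def C_def D_def field_simps)
  from binary_form_surj[OF two A0 D'0, of 1]
  obtain X Y where XY: "A * X ^ 2 + (D - C ^ 2 / A) * Y ^ 2 = 1"
    by blast
  \<comment> \<open>Completing the square: \<open>x \<cdot>\<^sub>v a + Y \<cdot>\<^sub>v b\<close>
    has norm \<open>A * X^2 + (D - C^2 / A) * Y^2\<close>, which is 1.\<close>
  define x where "x = X - Y * C / A"
  define e where "e = x \<cdot>\<^sub>v a + Y \<cdot>\<^sub>v b"
  define d where "d = (x * (a \<sqdot> a) + 2 * Y * (a \<sqdot> b)) \<cdot>\<^sub>v b - (Y * (b \<sqdot> b)) \<cdot>\<^sub>v a"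
  have "e \<sqdot> e = x * x * A + 2 * x * Y * C + Y * Y * D"
    using c ba by (simp add: e_def flip: A_def C_def D_def) (simp add: algebra_simps)
  also have "\<dots> = A * X ^ 2 + (D - C ^ 2 / A) * Y ^ 2"
    using A0 by (simp add: x_def field_simps power2_eq_square)
  finally have ee: "e \<sqdot> e = 1"
    using XY by simp
  have e0: "e \<sqdot> e \<noteq> 0"
    using ee by simp
  note plane = reflection_product_plane[OF c(1) a(2) c(2) b(2) e_def e0 d_def]
  have "nonzero_square (d \<sqdot> d)"
    using nonsquare_mult[OF two a(2,3) b(2,3)] by (simp add: plane(1) ee)
  moreover have "nonzero_square (e \<sqdot> e)"
    by (auto simp: ee nonzero_square_def intro: exI[of _ 1])
  moreover have "e \<in> W" "d \<in> W"
    using W a(1) b(1) by (auto simp: e_def d_def intro!: subsp_add subsp_minus subsp_smult)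
  ultimately show ?thesis
    using plane(2) unfolding square_word_def square_roots_def by (intro exI[of _ "[e, d]"]) simp
qed

text \<open>Serves the case that \<open>a\<close> and the second root, rescaled to
  \<open>a + r\<close>, span a degenerate plane: the vector \<open>e\<close> of the same norm spans
  a non-degenerate plane with each of them, so the pair can be replaced by two good pairs.\<close>

lemma connecting_vector:
  assumes W: "subsp W" and three: "(3::'a) \<noteq> 0" and q: "q \<in> W" "nonzero_square (q \<sqdot> q)"
    and a: "a \<in> W" "a \<sqdot> a \<noteq> 0" "\<not> nonzero_square (a \<sqdot> a)"
    and r: "r \<in> W" "r \<sqdot> r = 0" "a \<sqdot> r = 0"
  shows "\<exists>e\<in>W. e \<sqdot> e = a \<sqdot> a \<and> (a \<sqdot> e) ^ 2 \<noteq> (a \<sqdot> a) ^ 2 \<and> ((a + r) \<sqdot> e) ^ 2 \<noteq> (a \<sqdot> a) ^ 2"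
proof -
  define A where "A = a \<sqdot> a"
  have A0: "A \<noteq> 0"
    using a by (simp add: A_def)
  have c: "a \<in> carrier_vec n" "r \<in> carrier_vec n" "q \<in> carrier_vec n"
    using W a q r by (auto dest: subsp_carrier)
  have ra: "r \<sqdot> a = 0"
    using r c by (simp add: form_sym[of r a])
  show ?thesis
  proof (cases "\<exists>w\<in>W. w \<sqdot> r \<noteq> 0")
    case True
    then obtain w where w: "w \<in> W" "w \<sqdot> r \<noteq> 0" ..
    have wc: "w \<in> carrier_vec n"
      using W w by (auto dest: subsp_carrier)
    \<comment> \<open>\<open>v\<close> is orthogonal to \<open>a\<close> and pairs to 1 with
      \<open>r\<close>. Subtracting a multiple of \<open>r\<close> makes it isotropic:
      \<open>s\<close> is a hyperbolic partner of \<open>r\<close> in the complement of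
      \<open>a\<close>.\<close>
    define v where "v = (1 / (w \<sqdot> r)) \<cdot>\<^sub>v (w - (w \<sqdot> a / A) \<cdot>\<^sub>v a)"
    have v: "v \<in> W" "v \<in> carrier_vec n" "v \<sqdot> r = 1" "v \<sqdot> a = 0"
      using W w a c wc r(3) A0 by (auto simp: v_def A_def intro!: subsp_smult subsp_minus)
    define s where "s = v - (v \<sqdot> v / 2) \<cdot>\<^sub>v r"
    have sc: "s \<in> carrier_vec n" "s \<in> W"
      using W v r c by (auto simp: s_def intro!: subsp_minus subsp_smult)
    have "r \<sqdot> v = 1"
      using v c by (simp add: form_sym[of r v])
    then have s: "s \<sqdot> s = 0" "s \<sqdot> r = 1" "s \<sqdot> a = 0"
      using v c r(2) ra two by (simp_all add: s_def)
    have s': "r \<sqdot> s = 1" "a \<sqdot> s = 0"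
      using s c sc by (simp_all add: form_sym[of r s] form_sym[of a s])
    \<comment> \<open>The norm is \<open>2 * (1/4) * (2 * A) = A\<close>, and the products with
      \<open>a\<close> and \<open>a + r\<close> are 0 and \<open>2 * A\<close>. The factor 2 is
      chosen because \<open>(2 * A)^2\<close> differs from \<open>A^2\<close> when
      \<open>3 \<noteq> 0\<close>.\<close>
    define e where "e = (1 / 4) \<cdot>\<^sub>v r + (2 * A) \<cdot>\<^sub>v s"
    have four: "(4::'a) = 2 * 2"
      by simp
    have four0: "(4::'a) \<noteq> 0"
      unfolding four using two by (metis mult_eq_0_iff)
    have "e \<sqdot> e = A"
      using c sc s s' r(2) two four0 by (simp add: e_def)
    moreover have "a \<sqdot> e = 0"
      using c sc s' r(3) by (simp add: e_def)
    moreover have "(a + r) \<sqdot> e = 2 * A"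
      using c sc s' r by (simp add: e_def)
    moreover have "(2 * A) ^ 2 \<noteq> A ^ 2"
    proof
      assume "(2 * A) ^ 2 = A ^ 2"
      moreover have "(2 * A) ^ 2 - A ^ 2 = 3 * A ^ 2"
        by (simp add: power2_eq_square algebra_simps)
      ultimately have "3 * A ^ 2 = 0"
        by (metis diff_self)
      then show False
        using three A0 by (metis mult_eq_0_iff power_eq_0_iff)
    qed
    moreover have "e \<in> W"
      using W r sc by (simp add: e_def subsp_add subsp_smult)
    ultimately show ?thesis
      using A0 by (intro bexI[of _ e]) (auto simp flip: A_def)
  next
    case False
    \<comment> \<open>Now \<open>r\<close> is orthogonal to \<open>W\<close>, so the two
      inequalities coincide. The component \<open>q0\<close> of \<open>q\<close> orthogonal to
      \<open>a\<close> is anisotropic: otherwise \<open>(q \<sqdot> q) * A\<close> would be a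
      nonzero square, although \<open>q \<sqdot> q\<close> is one and \<open>A\<close> is
      not.\<close>
    define q0 where "q0 = q - (q \<sqdot> a / A) \<cdot>\<^sub>v a"
    have q0: "q0 \<in> W" "q0 \<in> carrier_vec n" "q0 \<sqdot> a = 0"
      using W q a c A0 by (auto simp: q0_def A_def intro!: subsp_minus subsp_smult)
    have aq0: "a \<sqdot> q0 = 0"
      using q0 c by (simp add: form_sym[of a q0])
    define \<phi> where "\<phi> = q0 \<sqdot> q0 / A"
    have "q0 \<sqdot> q0 \<noteq> 0"
    proof
      assume "q0 \<sqdot> q0 = 0"
      moreover have "q0 \<sqdot> q0 = q \<sqdot> q - (q \<sqdot> a) ^ 2 / A"
        using c A0 by (simp add: q0_def form_sym[of a q] flip: A_def)
          (simp add: field_simps power2_eq_square)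
      ultimately have e: "(q \<sqdot> q) * A = (q \<sqdot> a) ^ 2"
        using A0 by (simp add: field_simps)
      then have "nonzero_square ((q \<sqdot> q) * A)"
        using A0 q(2) unfolding nonzero_square_def by (metis mult_eq_0_iff power_zero_numeral zero_power2)
      then show False
        using a(3) nonzero_square_mult_iff[OF q(2)] by (simp add: A_def)
    qed
    then have \<phi>0: "\<phi> \<noteq> 0"
      using A0 by (simp add: \<phi>_def)
    \<comment> \<open>\<open>t\<close> is the slope of a line through \<open>(-1, 0)\<close> in the
      usual parametrisation of the conic \<open>x^2 + \<phi> * y^2 = 1\<close>; a nonzero slope
      avoids the point \<open>(1, 0)\<close>. The slope 1 works unless \<open>\<phi> = -1\<close>,
      and then 2 does, as \<open>1 + 4 * \<phi> = -3\<close>.\<close>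
    obtain t where t: "t \<noteq> 0" "1 + \<phi> * t ^ 2 \<noteq> 0"
    proof (cases "1 + \<phi> = 0")
      case True
      then have "\<phi> = - 1"
        by (metis add.commute eq_neg_iff_add_eq_0)
      then have "1 + \<phi> * 2 ^ 2 = - 3"
        by simp
      then have "1 + \<phi> * 2 ^ 2 \<noteq> 0"
        using three by (metis neg_equal_0_iff_equal)
      then show ?thesis
        using that two by blast
    next
      case False
      then show ?thesis
        using that[of 1] by simp
    qed
    define x y where "x = (1 - \<phi> * t ^ 2) / (1 + \<phi> * t ^ 2)" and "y = 2 * t / (1 + \<phi> * t ^ 2)"
    have conic: "x ^ 2 + \<phi> * y ^ 2 = 1"
    proof -
      define k where "k = 1 + \<phi> * t ^ 2"
      have "x ^ 2 + \<phi> * y ^ 2 = ((2 - k) ^ 2 + 4 * (k - 1)) / k ^ 2"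
        by (simp add: x_def y_def k_def power_divide add_divide_distrib power_mult_distrib)
      also have "(2 - k) ^ 2 + 4 * (k - 1) = k ^ 2"
        by (simp add: power2_eq_square algebra_simps)
      finally show ?thesis
        using t(2) by (simp add: k_def)
    qed
    have "y \<noteq> 0"
      using t two by (simp add: y_def)
    then have x1: "x ^ 2 \<noteq> 1"
      using conic \<phi>0 by auto
    define e where "e = x \<cdot>\<^sub>v a + y \<cdot>\<^sub>v q0"
    have eW: "e \<in> W"
      using W a q0 by (simp add: e_def subsp_add subsp_smult)
    have "e \<sqdot> e = A * (x ^ 2 + \<phi> * y ^ 2)"
      using c q0 aq0 A0
      by (simp add: e_def \<phi>_def flip: A_def) (simp add: field_simps power2_eq_square)
    then have ee: "e \<sqdot> e = A"
      using conic by simp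
    have ae: "a \<sqdot> e = x * A"
      using c q0 aq0 by (simp add: e_def A_def)
    have "e \<sqdot> r = 0"
      using False eW by blast
    then have "(a + r) \<sqdot> e = x * A"
      using W c eW ae by (simp add: form_sym[of r e] subsp_carrier)
    moreover have "(x * A) ^ 2 \<noteq> A ^ 2"
      using x1 A0 by (simp add: power_mult_distrib)
    ultimately show ?thesis
      using ee ae eW by (intro bexI[of _ e]) (auto simp flip: A_def)
  qed
qed

text \<open>In the degenerate case a connecting root \<open>e\<close> is inserted twice between the
  two reflections, which changes nothing but splits the product into two pairs spanning
  non-degenerate planes.\<close>

lemma nonsquare_pair:
  assumes W: "subsp W" and three: "(3::'a) \<noteq> 0" and q: "square_roots W \<noteq> {}"
    and a: "a \<in> W" "a \<sqdot> a \<noteq> 0" "\<not> nonzero_square (a \<sqdot> a)"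
    and b: "b \<in> W" "b \<sqdot> b \<noteq> 0" "\<not> nonzero_square (b \<sqdot> b)"
  shows "square_word W (\<lambda>u. reflection B a (reflection B b u))"
proof (cases "(a \<sqdot> b) ^ 2 = (a \<sqdot> a) * (b \<sqdot> b)")
  case False
  then show ?thesis
    using nonsquare_pair_nonsingular[OF W a b] by blast
next
  case True
  define A C D where "A = a \<sqdot> a" and "C = a \<sqdot> b" and "D = b \<sqdot> b"
  have c: "a \<in> carrier_vec n" "b \<in> carrier_vec n"
    using W a b by (auto dest: subsp_carrier)
  have CAD: "C ^ 2 = A * D"
    using True by (simp add: A_def C_def D_def)
  have ne: "A \<noteq> 0" "D \<noteq> 0" "C \<noteq> 0"
    using a b CAD by (auto simp: A_def D_def)
  have ba: "b \<sqdot> a = C"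
    using c by (simp add: C_def form_sym[of b a])
  \<comment> \<open>Scaled so that its product with \<open>a\<close> is \<open>A\<close>. As
    \<open>C^2 = A * D\<close>, its norm is also \<open>A\<close>, so \<open>b' - a\<close> is
    isotropic and orthogonal to \<open>a\<close>.\<close>
  define b' where "b' = (A / C) \<cdot>\<^sub>v b"
  define r where "r = b' - a"
  have b': "b' \<in> W" "b' \<in> carrier_vec n" "a \<sqdot> b' = A" "b' \<sqdot> a = A"
    using W b c ne ba by (auto simp: b'_def C_def[symmetric] intro: subsp_smult)
  have "b' \<sqdot> b' = (A / C) * ((A / C) * D)"
    using c by (simp add: b'_def D_def)
  also have "\<dots> = A * (A * D) / C ^ 2"
    by (simp add: power2_eq_square)
  finally have b'b': "b' \<sqdot> b' = A"
    using ne CAD by simp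
  have r: "r \<in> W" "r \<sqdot> r = 0" "a \<sqdot> r = 0"
    using W a(1) b' b'b' c by (auto simp: r_def A_def intro: subsp_minus)
  have ar: "a + r = b'"
    using c b' by (intro eq_vecI) (auto simp: r_def)
  obtain q where q: "q \<in> W" "nonzero_square (q \<sqdot> q)"
    using q by (auto simp: square_roots_def)
  obtain e where e: "e \<in> W" "e \<sqdot> e = A" "(a \<sqdot> e) ^ 2 \<noteq> A ^ 2" "(b' \<sqdot> e) ^ 2 \<noteq> A ^ 2"
    using connecting_vector[OF W three q a r] unfolding ar A_def by blast
  have ec: "e \<in> carrier_vec n"
    using W e by (auto dest: subsp_carrier)
  have e': "e \<sqdot> e \<noteq> 0" "\<not> nonzero_square (e \<sqdot> e)" "b' \<sqdot> b' \<noteq> 0" "\<not> nonzero_square (b' \<sqdot> b')"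
    using a e(2) b'b' by (simp_all add: A_def)
  have "square_word W (\<lambda>u. reflection B a (reflection B e u))"
    using nonsquare_pair_nonsingular[OF W a e(1) e'(1,2)] e(2,3) by (simp add: A_def power2_eq_square)
  moreover have "square_word W (\<lambda>u. reflection B e (reflection B b' u))"
    using nonsquare_pair_nonsingular[OF W e(1) e'(1,2) b'(1) e'(3,4)] e(2,4) b'b' form_sym[OF ec b'(2)]
    by (simp add: power2_eq_square)
  ultimately have "square_word W (\<lambda>u. reflection B a (reflection B e (reflection B e (reflection B b' u))))"
    using square_word_comp[OF W] by blast
  moreover have "reflection B a (reflection B e (reflection B e (reflection B b' u)))
      = reflection B a (reflection B b u)" if "u \<in> carrier_vec n" for u
    using that ec e'(1) b'(2) c ne by (simp add: b'_def reflection_scaled_root)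
  ultimately show ?thesis
    unfolding square_word_def by simp
qed

text \<open>Conjugation by the reflection in \<open>c\<close> turns the reflection in
  \<open>a\<close> into the one in the image of \<open>a\<close>, which has the same norm. Letters
  can thus be exchanged without affecting their square classes.\<close>

lemma reflection_commute:
  assumes "a \<in> carrier_vec n" "c \<in> carrier_vec n" "x \<in> carrier_vec n" "c \<sqdot> c \<noteq> 0"
  shows "reflection B a (reflection B c x) = reflection B c (reflection B (reflection B c a) x)"
proof -
  let ?a = "reflection B c a"
  have f: "x \<sqdot> ?a = reflection B c x \<sqdot> a" "?a \<sqdot> ?a = a \<sqdot> a"
    using form_reflection[of c "reflection B c x" a] form_reflection[of c a a] assms by simp_all
  have "reflection B c (reflection B ?a x)
      = reflection B c x - (2 * (x \<sqdot> ?a / (?a \<sqdot> ?a))) \<cdot>\<^sub>v reflection B c ?a"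
    unfolding reflection_def[of B ?a] using assms by (simp add: reflection_minus reflection_smult)
  also have "\<dots> = reflection B a (reflection B c x)"
    unfolding f using assms by (simp add: reflection_def[of B a])
  finally show ?thesis ..
qed

text \<open>At most one non-square letter is kept, at the front. A new square letter is conjugated
  past it; a new non-square letter merges with it into a square word.\<close>

lemma word_normal_form:
  assumes W: "subsp W" and three: "(3::'a) \<noteq> 0" and q: "square_roots W \<noteq> {}"
    and as: "set as \<subseteq> aniso W"
  shows "if even (length (filter (\<lambda>a. \<not> nonzero_square (a \<sqdot> a)) as)) then square_word W (refls B as)
    else \<exists>c\<in>aniso W. \<not> nonzero_square (c \<sqdot> c) \<and>
      (\<exists>f. square_word W f \<and> (\<forall>u\<in>carrier_vec n. refls B as u = reflection B c (f u)))"
  using as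
proof (induction as)
  case Nil
  then show ?case
    by (auto simp: square_word_def intro: exI[of _ "[]"])
next
  case (Cons a as)
  have a: "a \<in> W" "a \<sqdot> a \<noteq> 0" "a \<in> carrier_vec n"
    using Cons.prems W by (auto simp: aniso_def dest: subsp_carrier)
  let ?even = "even (length (filter (\<lambda>a. \<not> nonzero_square (a \<sqdot> a)) as))"
  have asW: "set as \<subseteq> aniso W"
    using Cons.prems by simp
  note IH = Cons.IH[OF asW]
  have single: "square_word W (reflection B b)" if "b \<in> W" "nonzero_square (b \<sqdot> b)" for b
    using that by (auto simp: square_word_def square_roots_def intro: exI[of _ "[b]"])
  have closed: "f u \<in> carrier_vec n" if f: "square_word W f" and u: "u \<in> carrier_vec n" for f u
  proof -
    obtain cs where "set cs \<subseteq> square_roots W" "f u = refls B cs u"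
      using f u unfolding square_word_def by blast
    moreover have "square_roots W \<subseteq> aniso (carrier_vec n)"
      using square_roots_aniso W by (fastforce simp: aniso_def dest: subsp_carrier)
    ultimately show ?thesis
      using u by auto
  qed
  show ?case
  proof (cases ?even)
    case True
    then have sw: "square_word W (refls B as)"
      using IH by simp
    show ?thesis
    proof (cases "nonzero_square (a \<sqdot> a)")
      case sq: True
      have "refls B (a # as) = (\<lambda>u. reflection B a (refls B as u))"
        by auto
      then show ?thesis
        using True sq square_word_comp[OF W single[OF a(1) sq] sw] by simp
    next
      case False
      then show ?thesis
        using True sw Cons.prems by auto
    qed
  next
    case False
    then obtain c f where c: "c \<in> W" "c \<sqdot> c \<noteq> 0" "\<not> nonzero_square (c \<sqdot> c)" and f: "square_word W f"
      "\<forall>u\<in>carrier_vec n. refls B as u = reflection B c (f u)"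
      using IH by (auto simp: aniso_def)
    have cc: "c \<in> carrier_vec n"
      using W c by (auto dest: subsp_carrier)
    show ?thesis
    proof (cases "nonzero_square (a \<sqdot> a)")
      case True
      let ?a = "reflection B c a"
      have "?a \<in> W" "nonzero_square (?a \<sqdot> ?a)"
        using W a c cc True by (auto intro: reflection_in simp: form_reflection)
      then have "square_word W (\<lambda>u. reflection B ?a (f u))"
        using square_word_comp[OF W single f(1)] by blast
      moreover have "\<forall>u\<in>carrier_vec n. refls B (a # as) u = reflection B c (reflection B ?a (f u))"
        using f closed a cc c by (simp add: reflection_commute)
      ultimately show ?thesis
        using False True c by (auto simp: aniso_def)
    next
      case nsq: False
      have "square_word W (\<lambda>u. reflection B a (reflection B c (f u)))"
        using square_word_comp[OF W nonsquare_pair[OF W three q a(1,2) nsq c] f(1)] .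
      then have "square_word W (refls B (a # as))"
        using f(2) by (auto simp: square_word_def)
      then show ?thesis
        using False nsq by simp
    qed
  qed
qed

theorem even_word_square_roots:
  assumes "subsp W" "(3::'a) \<noteq> 0" "square_roots W \<noteq> {}" "set as \<subseteq> aniso W"
    and "even (length (filter (\<lambda>a. \<not> nonzero_square (a \<sqdot> a)) as))"
  shows "\<exists>bs. set bs \<subseteq> square_roots W \<and> (\<forall>u\<in>carrier_vec n. refls B as u = refls B bs u)"
  using word_normal_form[OF assms(1-4)] assms(5) by (simp add: square_word_def)

end


section \<open>Strings of involutions satisfying braid relations\<close>

text \<open>The analogue for \<open>A\<^sub>k\<close>-like strings of the double coset decomposition
  \<open>S\<^sub>k\<^sub>+\<^sub>1 = S\<^sub>k \<union> S\<^sub>k s\<^sub>k S\<^sub>k\<close>; two words are identified if they have the same value under \<open>ev\<close>.\<close>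

lemma string_double_coset:
  fixes ev :: "nat list \<Rightarrow> 'b"
  assumes cong: "\<And>as xs ys bs. set (as @ xs @ ys @ bs) \<subseteq> {..m} \<Longrightarrow> ev xs = ev ys
      \<Longrightarrow> ev (as @ xs @ bs) = ev (as @ ys @ bs)"
    and invol: "\<And>i. i \<le> m \<Longrightarrow> ev [i, i] = ev []"
    and comm: "\<And>i j. j \<le> m \<Longrightarrow> Suc i < j \<Longrightarrow> ev [j, i] = ev [i, j]"
    and braid: "\<And>i. Suc i \<le> m
      \<Longrightarrow> ev [Suc i, i, Suc i] = ev [i, Suc i, i] \<or> ev [Suc i, i] = ev [i, Suc i]"
    and "k \<le> m" "set ws \<subseteq> {..k}"
  shows "\<exists>us. set us \<subseteq> {..<k} \<and> (ev ws = ev us \<or> (\<exists>vs. set vs \<subseteq> {..<k} \<and> ev ws = ev (us @ k # vs)))"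
  using assms(5,6)
proof (induction k arbitrary: ws)
  case 0
  then show ?case
  proof (induction ws)
    case (Cons i ws)
    then have i: "i = 0" "set ws \<subseteq> {..m}"
      by auto
    from Cons consider "ev ws = ev []" | "ev ws = ev [0]"
      by auto
    then show ?case
    proof cases
      case 1
      then show ?thesis
        using cong[of "[0]" ws "[]" "[]"] i by auto
    next
      case 2
      then have "ev (i # ws) = ev [0, 0]"
        using cong[of "[0]" ws "[0]" "[]"] i by auto
      then show ?thesis
        using invol[of 0] by auto
    qed
  qed simp
next
  case (Suc k)
  have sub: "{..<Suc k} \<subseteq> {..m}" "{..<k} \<subseteq> {..m}" "{..<k} \<subseteq> {..<Suc k}"
    using Suc.prems by auto
  \<comment> \<open>The letter \<open>Suc k\<close> commutes with every letter below
    \<open>k\<close> and so passes through \<open>us\<close>.\<close>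
  have move: "ev (Suc k # us @ xs) = ev (us @ Suc k # xs)"
    if "set us \<subseteq> {..<k}" "set xs \<subseteq> {..m}" for us xs
    using that(1)
  proof (induction us)
    case (Cons i us)
    have "ev (Suc k # i # us @ xs) = ev (i # Suc k # us @ xs)"
      using cong[of "[]" "[Suc k, i]" "[i, Suc k]" "us @ xs"] comm[of "Suc k" i] Cons.prems that(2)
        sub Suc.prems by auto
    also have "\<dots> = ev (i # us @ Suc k # xs)"
      using cong[of "[i]" "Suc k # us @ xs" "us @ Suc k # xs" "[]"] Cons that(2) sub Suc.prems by auto
    finally show ?case
      by simp
  qed simp
  from Suc.prems(2) show ?case
  proof (induction ws)
    case (Cons i ws)
    then have ws: "set ws \<subseteq> {..m}" and i: "i \<le> Suc k" "i \<le> m"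
      using Suc.prems(1) by auto
    from Cons obtain us where us: "set us \<subseteq> {..<Suc k}"
      "ev ws = ev us \<or> (\<exists>vs. set vs \<subseteq> {..<Suc k} \<and> ev ws = ev (us @ Suc k # vs))"
      by auto
    have usm: "set us \<subseteq> {..m}"
      using us(1) sub by blast
    from us(2) consider "ev ws = ev us"
      | vs where "set vs \<subseteq> {..<Suc k}" "ev ws = ev (us @ Suc k # vs)"
      by blast
    then show ?case
    proof cases
      case 1
      then have e: "ev (i # ws) = ev (i # us)"
        using cong[of "[i]" ws us "[]"] ws usm i by auto
      show ?thesis
      proof (cases "i = Suc k")
        case True
        then show ?thesis
          using e us(1) by (intro exI[of _ "[]"]) auto
      next
        case False
        then show ?thesis
          using e us(1) i by (intro exI[of _ "i # us"]) auto
      qed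
    next
      case (2 vs)
      have vsm: "set vs \<subseteq> {..m}"
        using 2(1) sub by blast
      have e: "ev (i # ws) = ev (i # us @ Suc k # vs)"
        using cong[of "[i]" ws "us @ Suc k # vs" "[]"] 2(2) ws usm vsm i Suc.prems(1) by auto
      show ?thesis
      proof (cases "i = Suc k")
        case False
        then show ?thesis
          using e us(1) 2(1) i by (intro exI[of _ "i # us"]) auto
      next
        case True
        \<comment> \<open>Two letters \<open>Suc k\<close> enclose \<open>us\<close>; the induction
          hypothesis leaves at most one letter \<open>k\<close> between them.\<close>
        have "set us \<subseteq> {..k}"
          using us(1) by auto
        then obtain us' where us': "set us' \<subseteq> {..<k}"
          "ev us = ev us' \<or> (\<exists>vs'. set vs' \<subseteq> {..<k} \<and> ev us = ev (us' @ k # vs'))"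
          using Suc.IH[of us] Suc.prems(1) by auto
        have us'm: "set us' \<subseteq> {..m}"
          using us'(1) sub by blast
        from us'(2) consider "ev us = ev us'"
          | vs' where "set vs' \<subseteq> {..<k}" "ev us = ev (us' @ k # vs')"
          by blast
        then show ?thesis
        proof cases
          case 1
          have "ev (i # us @ Suc k # vs) = ev (Suc k # us' @ Suc k # vs)"
            using cong[of "[Suc k]" us us' "Suc k # vs"] 1 True usm us'm vsm Suc.prems(1) by simp
          also have "\<dots> = ev (us' @ Suc k # Suc k # vs)"
            using move[OF us'(1), of "Suc k # vs"] vsm Suc.prems(1) by simp
          also have "\<dots> = ev (us' @ vs)"
            using cong[of us' "[Suc k, Suc k]" "[]" vs] invol[of "Suc k"] us'm vsm Suc.prems(1) by simp
          finally show ?thesis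
            using e us'(1) 2(1) sub by (intro exI[of _ "us' @ vs"]) auto
        next
          case (2 vs')
          note vs = \<open>set vs \<subseteq> {..<Suc k}\<close>
          have vs'm: "set vs' \<subseteq> {..m}"
            using 2(1) sub by blast
          have "ev (i # us @ Suc k # vs) = ev (Suc k # (us' @ k # vs') @ Suc k # vs)"
            using cong[of "[Suc k]" us "us' @ k # vs'" "Suc k # vs"] 2(2) True usm us'm vs'm vsm Suc.prems(1)
            by simp
          also have "\<dots> = ev (us' @ Suc k # k # vs' @ Suc k # vs)"
            using move[OF us'(1), of "k # vs' @ Suc k # vs"] vs'm vsm Suc.prems(1) by simp
          also have "\<dots> = ev (us' @ Suc k # k # Suc k # vs' @ vs)"
            using cong[of "us' @ [Suc k, k]" "vs' @ Suc k # vs" "Suc k # vs' @ vs" "[]"]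
              move[OF 2(1), of vs] us'm vs'm vsm Suc.prems(1) by simp
          finally have e': "ev (i # ws) = ev (us' @ Suc k # k # Suc k # vs' @ vs)"
            using e by simp
          \<comment> \<open>A braid relation leaves one letter \<open>Suc k\<close>; if the letters
            commute instead, the two letters \<open>Suc k\<close> meet and cancel.\<close>
          from braid[OF Suc.prems(1)] show ?thesis
          proof
            assume "ev [Suc k, k, Suc k] = ev [k, Suc k, k]"
            then have "ev (i # ws) = ev ((us' @ [k]) @ Suc k # (k # vs' @ vs))"
              using cong[of us' "[Suc k, k, Suc k]" "[k, Suc k, k]" "vs' @ vs"] e' us'm vs'm vsm
                Suc.prems(1) by simp
            then show ?thesis
              using us'(1) 2(1) vs sub(3) by (intro exI[of _ "us' @ [k]"] conjI disjI2 exI[of _ "k # vs' @ vs"]) auto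
          next
            assume "ev [Suc k, k] = ev [k, Suc k]"
            then have "ev (i # ws) = ev (us' @ k # Suc k # Suc k # vs' @ vs)"
              using cong[of us' "[Suc k, k]" "[k, Suc k]" "Suc k # vs' @ vs"] e' us'm vs'm vsm
                Suc.prems(1) by simp
            also have "\<dots> = ev (us' @ k # vs' @ vs)"
              using cong[of "us' @ [k]" "[Suc k, Suc k]" "[]" "vs' @ vs"] invol[of "Suc k"] us'm vs'm vsm
                Suc.prems(1) by simp
            finally show ?thesis
              using us'(1) 2(1) vs sub(3) by (intro exI[of _ "us' @ k # vs' @ vs"]) auto
          qed
        qed
      qed
    qed
  qed (auto intro: exI[of _ "[]"])
qed


section \<open>Stabilisers in characteristic three\<close>

context symmetric_form
begin

text \<open>In characteristic 3 the coefficient \<open>- 2\<close> is 1.\<close>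

lemma reflection_char3:
  assumes three: "(3::'a) = 0" and a: "a \<in> carrier_vec n" "a \<sqdot> a = 1" and y: "y \<in> carrier_vec n"
  shows "reflection B a y = y + (y \<sqdot> a) \<cdot>\<^sub>v a"
proof -
  have "(y \<sqdot> a) * 3 = 0"
    using three by simp
  then have "- (2 * (y \<sqdot> a)) = y \<sqdot> a"
    by (simp add: eq_neg_iff_add_eq_0[symmetric] algebra_simps minus_equation_iff)
  then have "y $ i - 2 * (y \<sqdot> a) * a $ i = y $ i + (y \<sqdot> a) * a $ i" for i
    by (metis diff_conv_add_uminus mult_minus_left)
  then show ?thesis
    using a y by (intro eq_vecI) (auto simp: reflection_def)
qed

text \<open>The right-hand side is written symmetrically in \<open>a\<close> and \<open>b\<close>,
  so that the braid relation can be read off.\<close>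

lemma reflection_char3_conj:
  assumes three: "(3::'a) = 0" and a: "a \<in> carrier_vec n" "a \<sqdot> a = 1" and b: "b \<in> carrier_vec n" "b \<sqdot> b = 1"
    and ab: "(a \<sqdot> b) * (a \<sqdot> b) = 1" and x: "x \<in> carrier_vec n"
  shows "reflection B a (reflection B b (reflection B a x))
    = x + (x \<sqdot> a + (x \<sqdot> b) * (a \<sqdot> b)) \<cdot>\<^sub>v a + (x \<sqdot> b + (x \<sqdot> a) * (a \<sqdot> b)) \<cdot>\<^sub>v b"
proof -
  define c s t where "c = a \<sqdot> b" and "s = x \<sqdot> a" and "t = x \<sqdot> b"
  have ba: "b \<sqdot> a = c"
    using a b by (simp add: c_def form_sym)
  have 1: "reflection B a x = x + s \<cdot>\<^sub>v a"
    using reflection_char3[OF three a x] by (simp add: s_def)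
  have 2: "reflection B b (x + s \<cdot>\<^sub>v a) = x + s \<cdot>\<^sub>v a + (t + s * c) \<cdot>\<^sub>v b"
    using reflection_char3[OF three b, of "x + s \<cdot>\<^sub>v a"] a b x by (simp add: t_def c_def)
  have "s + s + (t + s * c) * c = s * 3 + (c * c - 1) * s + t * c"
    by (simp add: algebra_simps)
  then have "s + s + (t + s * c) * c = t * c"
    using three ab by (simp flip: c_def)
  then have 3: "(x + s \<cdot>\<^sub>v a + (t + s * c) \<cdot>\<^sub>v b) \<sqdot> a = t * c"
    using a b x ba by (simp flip: s_def)
  have "reflection B a (x + s \<cdot>\<^sub>v a + (t + s * c) \<cdot>\<^sub>v b)
      = x + s \<cdot>\<^sub>v a + (t + s * c) \<cdot>\<^sub>v b + (t * c) \<cdot>\<^sub>v a"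
    using reflection_char3[OF three a, of "x + s \<cdot>\<^sub>v a + (t + s * c) \<cdot>\<^sub>v b"] a b x
    unfolding 3 by simp
  also have "\<dots> = x + (s + t * c) \<cdot>\<^sub>v a + (t + s * c) \<cdot>\<^sub>v b"
    using a b x by (intro eq_vecI) (auto simp: algebra_simps)
  finally show ?thesis
    unfolding 1 2 by (simp add: c_def s_def t_def)
qed

lemma reflection_braid:
  assumes "(3::'a) = 0" and a: "a \<in> carrier_vec n" "a \<sqdot> a = 1" and b: "b \<in> carrier_vec n" "b \<sqdot> b = 1"
    and ab: "(a \<sqdot> b) * (a \<sqdot> b) = 1" and x: "x \<in> carrier_vec n"
  shows "reflection B a (reflection B b (reflection B a x))
    = reflection B b (reflection B a (reflection B b x))"
proof -
  have ba: "b \<sqdot> a = a \<sqdot> b"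
    using a b by (simp add: form_sym)
  show ?thesis
    unfolding reflection_char3_conj[OF assms] reflection_char3_conj[OF assms(1) b a, unfolded ba, OF ab x]
    using a b x by (intro eq_vecI) (auto simp: algebra_simps)
qed

lemma reflection_commute_orthogonal:
  assumes "a \<in> carrier_vec n" "b \<in> carrier_vec n" "b \<sqdot> b \<noteq> 0" "a \<sqdot> b = 0" "x \<in> carrier_vec n"
  shows "reflection B a (reflection B b x) = reflection B b (reflection B a x)"
  using reflection_commute[of a b x] reflection_fix[of b a] assms by simp

text \<open>If all roots have norm 1, all products of two of the reflections have order at most 3, so
  that a double coset decomposition applies; \<open>c\<close> is moved by all elements outside the subgroup
  because they change its coordinate belonging to the last root.\<close>

lemma string_stabiliser:
  assumes three_elements: "\<And>z::'a. z = 0 \<or> z * z = 1" and sn: "\<And>i. i \<le> m \<Longrightarrow> s i < n" and inj: "inj_on s {..m}"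
    and norm: "\<And>i. i \<le> m \<Longrightarrow> B $$ (s i, s i) = 1"
    and far: "\<And>i j. j \<le> m \<Longrightarrow> Suc i < j \<Longrightarrow> B $$ (s i, s j) = 0"
    and c: "c \<in> carrier_vec n" "\<And>i. i < m \<Longrightarrow> c \<sqdot> unit_vec n (s i) = 0" "c \<sqdot> unit_vec n (s m) \<noteq> 0"
    and ws: "set ws \<subseteq> {..m}" "refls B (map (\<lambda>i. unit_vec n (s i)) ws) c = c"
  shows "\<exists>us. set us \<subseteq> {..<m} \<and> (\<forall>x\<in>carrier_vec n.
    refls B (map (\<lambda>i. unit_vec n (s i)) ws) x = refls B (map (\<lambda>i. unit_vec n (s i)) us) x)"
proof -
  let ?e = "\<lambda>i. unit_vec n (s i) :: 'a vec"
  \<comment> \<open>Restricting to \<open>carrier_vec n\<close> turns equal action into equality of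
    values, as the double coset lemma demands.\<close>
  define ev where "ev = (\<lambda>ws. restrict (refls B (map ?e ws)) (carrier_vec n))"
  have ev_eq: "ev xs = ev ys \<longleftrightarrow> (\<forall>x\<in>carrier_vec n. refls B (map ?e xs) x = refls B (map ?e ys) x)" for xs ys
    by (auto simp: ev_def restrict_def fun_eq_iff)
  have norm': "?e i \<sqdot> ?e i = 1" if "i \<le> m" for i
    using norm sn that by (simp add: form_unit)
  have an: "set (map ?e xs) \<subseteq> aniso (carrier_vec n)" if "set xs \<subseteq> {..m}" for xs
    using that norm' by (auto simp: aniso_def)
  have cong: "ev (as @ xs @ bs) = ev (as @ ys @ bs)"
    if "set (as @ xs @ ys @ bs) \<subseteq> {..m}" "ev xs = ev ys" for as xs ys bs
    using that an[of bs] by (auto simp: ev_eq)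
  have invol: "ev [i, i] = ev []" if "i \<le> m" for i
    using that norm' sn by (simp add: ev_eq)
  have comm: "ev [j, i] = ev [i, j]" if "j \<le> m" "Suc i < j" for i j
  proof -
    have "?e j \<sqdot> ?e i = 0"
      using that far[OF that] sn[of i] sn[of j] B_sym[of "s j" "s i"] by (simp add: form_unit)
    then show ?thesis
      using that norm'[of i] by (simp add: ev_eq reflection_commute_orthogonal)
  qed
  \<comment> \<open>The hypothesis on the field, applied to 2, gives \<open>4 = 1\<close>, so the
    characteristic is 3.\<close>
  have "2 * 2 = (1::'a)"
    using three_elements[of 2] two by simp
  moreover have "(3::'a) = 2 * 2 - 1"
    by simp
  ultimately have three: "(3::'a) = 0"
    by (metis diff_self)
  have braid: "ev [Suc i, i, Suc i] = ev [i, Suc i, i] \<or> ev [Suc i, i] = ev [i, Suc i]" if "Suc i \<le> m" for i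
    using three_elements[of "?e (Suc i) \<sqdot> ?e i"]
  proof
    assume "?e (Suc i) \<sqdot> ?e i = 0"
    then show ?thesis
      using that norm'[of i] by (simp add: ev_eq reflection_commute_orthogonal)
  next
    assume "(?e (Suc i) \<sqdot> ?e i) * (?e (Suc i) \<sqdot> ?e i) = 1"
    then show ?thesis
      using that norm' three by (simp add: ev_eq reflection_braid)
  qed
  obtain us where us: "set us \<subseteq> {..<m}"
    "ev ws = ev us \<or> (\<exists>vs. set vs \<subseteq> {..<m} \<and> ev ws = ev (us @ m # vs))"
    using string_double_coset[of m ev m ws, OF cong invol comm braid le_refl ws(1)] by blast
  have fixes_c: "refls B (map ?e vs) c = c" if "set vs \<subseteq> {..<m}" for vs
    using that c(1,2) an[of vs] by (intro refls_fix) fastforce+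
  \<comment> \<open>The reflection in \<open>?e i\<close> changes only the coordinate
    \<open>s i\<close>.\<close>
  have coord: "refls B (map ?e vs) x $ s m = x $ s m" if "set vs \<subseteq> {..<m}" "x \<in> carrier_vec n" for vs x
    using that(1)
  proof (induction vs)
    case (Cons i vs)
    have "s i \<noteq> s m"
      using Cons.prems inj by (auto simp: inj_on_def)
    moreover have "set vs \<subseteq> {..m}"
      using Cons.prems by auto
    then have "refls B (map ?e vs) x \<in> carrier_vec n"
      using an that(2) by (intro refls_closed)
    ultimately show ?case
      using Cons sn[of i] sn[of m] by (simp add: reflection_def)
  qed simp
  \<comment> \<open>Otherwise \<open>vs\<close> fixes \<open>c\<close>, the letter \<open>m\<close>
    subtracts \<open>2 * (c \<sqdot> ?e m)\<close> from the coordinate \<open>s m\<close>, and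
    \<open>us\<close> cannot restore it.\<close>
  have "ev ws \<noteq> ev (us @ m # vs)" if vs: "set vs \<subseteq> {..<m}" for vs
  proof
    assume "ev ws = ev (us @ m # vs)"
    then have "c = refls B (map ?e us) (reflection B (?e m) c)"
      using c(1) ws(2) fixes_c[OF vs] by (simp add: ev_eq)
    then have "c $ s m = refls B (map ?e us) (reflection B (?e m) c) $ s m"
      by (rule arg_cong)
    also have "\<dots> = reflection B (?e m) c $ s m"
      using coord[OF us(1)] c(1) by simp
    also have "\<dots> = c $ s m - 2 * (c \<sqdot> ?e m)"
      using norm'[of m] sn[of m] c(1) by (simp add: reflection_def)
    finally show False
      using two c(3) by simp
  qed
  then have "ev ws = ev us"
    using us(2) by blast
  then show ?thesis
    using us(1) by (auto simp: ev_eq)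
qed

end


section \<open>Groups generated by reflections as sets of words\<close>

lemma list_over_image: "set ys \<subseteq> f ` A \<Longrightarrow> \<exists>xs. set xs \<subseteq> A \<and> ys = map f xs"
proof (induction ys)
  case (Cons y ys)
  then obtain x xs where "x \<in> A" "y = f x" "set xs \<subseteq> A" "ys = map f xs"
    by auto
  then show ?case
    by (intro exI[of _ "x # xs"]) simp
qed simp

text \<open>Generators are their own inverses, so products of generators already form a
  subgroup.\<close>

lemma (in group) generate_involutions:
  assumes S: "S \<subseteq> carrier G" and invol: "\<And>s. s \<in> S \<Longrightarrow> s \<otimes> s = \<one>"
  shows "generate G S = {foldr (\<otimes>) ss \<one> | ss. set ss \<subseteq> S}"
proof
  have fc: "foldr (\<otimes>) ss \<one> \<in> carrier G" if "set ss \<subseteq> S" for ss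
    using that S by (induction ss) auto
  have app: "foldr (\<otimes>) ss \<one> \<otimes> foldr (\<otimes>) ts \<one> = foldr (\<otimes>) (ss @ ts) \<one>"
    if "set ss \<subseteq> S" "set ts \<subseteq> S" for ss ts
    using that(1)
  proof (induction ss)
    case Nil
    then show ?case
      using fc[OF that(2)] by simp
  next
    case (Cons s ss)
    then have "s \<in> carrier G" "foldr (\<otimes>) ss \<one> \<in> carrier G"
      using S fc[of ss] by auto
    then show ?case
      using Cons fc[OF that(2)] m_assoc by simp
  qed
  show "generate G S \<subseteq> {foldr (\<otimes>) ss \<one> | ss. set ss \<subseteq> S}"
  proof
    fix g assume "g \<in> generate G S"
    then show "g \<in> {foldr (\<otimes>) ss \<one> | ss. set ss \<subseteq> S}"
    proof (induction rule: generate.induct)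
      case one
      show ?case
        by (auto intro: exI[of _ "[]"])
    next
      case (incl h)
      then show ?case
        using S by (auto intro!: exI[of _ "[h]"])
    next
      case (inv h)
      then have "inv h = h"
        using S invol by (intro inv_equality) auto
      then show ?case
        using S inv by (auto intro!: exI[of _ "[h]"])
    next
      case (eng h1 h2)
      then obtain ss ts where "set ss \<subseteq> S" "h1 = foldr (\<otimes>) ss \<one>" "set ts \<subseteq> S" "h2 = foldr (\<otimes>) ts \<one>"
        by blast
      then show ?case
        using app by (auto intro!: exI[of _ "ss @ ts"])
    qed
  qed
  show "{foldr (\<otimes>) ss \<one> | ss. set ss \<subseteq> S} \<subseteq> generate G S"
  proof safe
    fix ss assume "set ss \<subseteq> S"
    then show "foldr (\<otimes>) ss \<one> \<in> generate G S"
      by (induction ss) (auto intro: generate.intros)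
  qed
qed

context symmetric_form
begin

text \<open>The functions are \<open>undefined\<close> off \<open>W\<close>, in accordance with
  \<open>BijGroup\<close>.\<close>

definition words :: "'a vec set \<Rightarrow> 'a vec set \<Rightarrow> ('a vec \<Rightarrow> 'a vec) set" where
  "words W S = {restrict (refls B as) W | as. set as \<subseteq> S}"

lemma restrict_refls_Bij:
  assumes W: "subsp W" and as: "set as \<subseteq> aniso W"
  shows "restrict (refls B as) W \<in> Bij W"
proof -
  have c: "x \<in> carrier_vec n" if "x \<in> W" for x
    using W that by (rule subsp_carrier)
  have asc: "set as \<subseteq> aniso (carrier_vec n)"
    using as c by (auto simp: aniso_def)
  have "bij_betw (refls B as) W W"
    using W as asc c by (intro bij_betwI[of _ _ _ "refls B (rev as)"]) (auto simp: refls_in)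
  then show ?thesis
    by (simp add: Bij_def)
qed

lemma generate_reflections:
  assumes W: "subsp W" and S: "S \<subseteq> aniso W"
  shows "generate (BijGroup W) {restrict (reflection B a) W | a. a \<in> S} = words W S"
proof -
  interpret G: group "BijGroup W"
    by (rule group_BijGroup)
  let ?r = "\<lambda>a. restrict (reflection B a) W"
  have Sc: "a \<in> carrier_vec n" "a \<sqdot> a \<noteq> 0" "a \<in> W" if "a \<in> S" for a
    using S W that by (auto simp: aniso_def dest: subsp_carrier)
  have eq: "{restrict (reflection B a) W | a. a \<in> S} = ?r ` S"
    by auto
  have r: "?r a \<in> Bij W" if "a \<in> S" for a
    using restrict_refls_Bij[OF W, of "[a]"] S that by (auto simp: refls_def)
  have comp: "?r a \<otimes>\<^bsub>BijGroup W\<^esub> restrict (refls B as) W = restrict (refls B (a # as)) W"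
    if "a \<in> S" "set as \<subseteq> S" for a as
    using that r[OF that(1)] restrict_refls_Bij[OF W, of as] S refls_in[OF W, of as]
    by (auto simp: BijGroup_def compose_def restrict_def fun_eq_iff)
  have one: "\<one>\<^bsub>BijGroup W\<^esub> = restrict (refls B []) W"
    by (auto simp: BijGroup_def restrict_def fun_eq_iff)
  have fold: "foldr (\<otimes>\<^bsub>BijGroup W\<^esub>) (map ?r as) \<one>\<^bsub>BijGroup W\<^esub> = restrict (refls B as) W"
    if "set as \<subseteq> S" for as
    using that
  proof (induction as)
    case Nil
    then show ?case
      unfolding one by (simp add: restrict_def fun_eq_iff)
  next
    case (Cons a as)
    then have p: "a \<in> S" "set as \<subseteq> S"
      by auto
    show ?case
      unfolding list.map foldr_Cons o_apply Cons.IH[OF p(2)] by (rule comp[OF p])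
  qed
  have "generate (BijGroup W) (?r ` S)
      = {foldr (\<otimes>\<^bsub>BijGroup W\<^esub>) ss \<one>\<^bsub>BijGroup W\<^esub> | ss. set ss \<subseteq> ?r ` S}"
  proof (rule G.generate_involutions)
    show "?r ` S \<subseteq> carrier (BijGroup W)"
      using r by (auto simp: BijGroup_def)
    fix s assume "s \<in> ?r ` S"
    then obtain a where a: "a \<in> S" "s = ?r a"
      by blast
    have "?r a = restrict (refls B [a]) W"
      by (auto simp: restrict_def)
    then have "s \<otimes>\<^bsub>BijGroup W\<^esub> s = restrict (refls B [a, a]) W"
      using comp[of a "[a]"] a by simp
    also have "\<dots> = \<one>\<^bsub>BijGroup W\<^esub>"
      using Sc[OF a(1)] W by (auto simp: BijGroup_def restrict_def fun_eq_iff dest: subsp_carrier)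
    finally show "s \<otimes>\<^bsub>BijGroup W\<^esub> s = \<one>\<^bsub>BijGroup W\<^esub>" .
  qed
  also have "\<dots> = words W S"
  proof safe
    fix ss assume "set ss \<subseteq> ?r ` S"
    then obtain as where "set as \<subseteq> S" "ss = map ?r as"
      using list_over_image by blast
    then show "foldr (\<otimes>\<^bsub>BijGroup W\<^esub>) ss \<one>\<^bsub>BijGroup W\<^esub> \<in> words W S"
      using fold by (auto simp: words_def)
  next
    fix f assume "f \<in> words W S"
    then obtain as where as: "set as \<subseteq> S" "f = restrict (refls B as) W"
      by (auto simp: words_def)
    then show "\<exists>ss. f = foldr (\<otimes>\<^bsub>BijGroup W\<^esub>) ss \<one>\<^bsub>BijGroup W\<^esub> \<and> set ss \<subseteq> ?r ` S"
      using fold[OF as(1)] by (intro exI[of _ "map ?r as"]) auto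
  qed
  finally show ?thesis
    unfolding eq .
qed

lemma refl_subgroup_hat_words:
  assumes "subsp W"
  shows "refl_subgroup_hat B W = words W (square_roots W)"
  using generate_reflections[OF assms square_roots_aniso]
  by (simp add: refl_subgroup_hat_def square_roots_def)

lemma refl_subgroup_words:
  assumes "subsp W" "j \<noteq> 0"
  shows "refl_subgroup B j W = words W {a \<in> W. a \<sqdot> a = j}"
proof -
  have "{a \<in> W. a \<sqdot> a = j} \<subseteq> aniso W"
    using assms(2) by (auto simp: aniso_def)
  from generate_reflections[OF assms(1) this] show ?thesis
    by (simp add: refl_subgroup_def)
qed

text \<open>Scaling a root multiplies its norm by a nonzero square and leaves its reflection
  unchanged, so all square values of \<open>j\<close> give the same generators.\<close>

lemma refl_subgroup_square:
  assumes W: "subsp W" and j: "nonzero_square j"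
  shows "refl_subgroup B j W = refl_subgroup_hat B W"
proof -
  have j0: "j \<noteq> 0"
    using j by (auto simp: nonzero_square_def)
  have "restrict (reflection B a) W \<in> {restrict (reflection B a) W | a. a \<in> W \<and> a \<sqdot> a = j}"
    if a: "a \<in> W" "nonzero_square (a \<sqdot> a)" for a
  proof -
    have "nonzero_square (j * inverse (a \<sqdot> a))"
      using j a by (intro nonzero_square_mult nonzero_square_inverse)
    then obtain c where c: "c \<noteq> 0" "j * inverse (a \<sqdot> a) = c ^ 2"
      by (auto simp: nonzero_square_def)
    have ac: "a \<in> carrier_vec n" "a \<sqdot> a \<noteq> 0"
      using W a by (auto simp: nonzero_square_def dest: subsp_carrier)
    have "(c \<cdot>\<^sub>v a) \<sqdot> (c \<cdot>\<^sub>v a) = c ^ 2 * (a \<sqdot> a)"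
      using ac by (simp add: power2_eq_square)
    also have "\<dots> = j"
      using ac by (simp flip: c(2))
    finally have "(c \<cdot>\<^sub>v a) \<sqdot> (c \<cdot>\<^sub>v a) = j" .
    moreover have "c \<cdot>\<^sub>v a \<in> W"
      using W a by (simp add: subsp_smult)
    moreover have "restrict (reflection B a) W = restrict (reflection B (c \<cdot>\<^sub>v a)) W"
      using W ac c(1) by (auto simp: restrict_def fun_eq_iff reflection_scaled_root dest: subsp_carrier)
    ultimately show ?thesis
      by blast
  qed
  then have "{restrict (reflection B a) W | a. a \<in> W \<and> a \<sqdot> a = j}
      = {restrict (reflection B a) W | a. a \<in> W \<and> nonzero_square (a \<sqdot> a)}"
    using j by blast
  then show ?thesis
    by (simp add: refl_subgroup_def refl_subgroup_hat_def)
qed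

text \<open>One inclusion is the Cartan--Dieudonne theorem; for the other, letters from
  \<open>W\<close> are orthogonal to \<open>rad B W\<close> and so fix it.\<close>

lemma isometries_hat_words:
  assumes W: "subsp W"
  shows "isometries_hat B W = words W (aniso W)"
proof
  have c: "x \<in> carrier_vec n" if "x \<in> W" for x
    using W that by (rule subsp_carrier)
  show "isometries_hat B W \<subseteq> words W (aniso W)"
  proof
    fix f assume f: "f \<in> isometries_hat B W"
    have fb: "f \<in> extensional W" "bij_betw f W W"
      using f by (auto simp: isometries_hat_def isometries_def Bij_def)
    obtain as where as: "set as \<subseteq> aniso W" "\<forall>x\<in>W. f x = refls B as x"
    proof -
      have "\<exists>as. set as \<subseteq> aniso W \<and> (\<forall>x\<in>W. f x = refls B as x)"
        using f bij_betwE[OF fb(2)]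
        by (intro isometry_by_refls[OF W]) (auto simp: isometries_hat_def isometries_def)
      then show thesis
        using that by blast
    qed
    then have "f = restrict (refls B as) W"
      using fb(1) by (auto simp: restrict_def extensional_def fun_eq_iff)
    then show "f \<in> words W (aniso W)"
      using as(1) by (auto simp: words_def)
  qed
  show "words W (aniso W) \<subseteq> isometries_hat B W"
  proof
    fix f assume "f \<in> words W (aniso W)"
    then obtain as where as: "set as \<subseteq> aniso W" "f = restrict (refls B as) W"
      by (auto simp: words_def)
    have asc: "set as \<subseteq> aniso (carrier_vec n)"
      using as(1) c by (auto simp: aniso_def)
    have "\<forall>x\<in>rad B W. refls B as x = x"
      using as(1) asc c by (auto intro!: refls_fix simp: rad_def perp_def aniso_def subset_iff)
    moreover have "x \<in> W" if "x \<in> rad B W" for x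
      using that by (simp add: rad_def)
    ultimately show "f \<in> isometries_hat B W"
      using restrict_refls_Bij[OF W as(1)] as(2) c W asc
      by (auto simp: isometries_hat_def isometries_def refls_add refls_smult form_refls subsp_add subsp_smult)
  qed
qed

lemma isometries_nonsingular:
  assumes W: "subsp W" and ns: "nonsingular B W"
  shows "isometries B W = isometries_hat B W"
proof -
  have "f (0\<^sub>v n) = 0\<^sub>v n" if f: "f \<in> isometries B W" for f
  proof -
    have "f (0 \<cdot>\<^sub>v 0\<^sub>v n) = 0 \<cdot>\<^sub>v f (0\<^sub>v n)" "f (0\<^sub>v n) \<in> W"
      using f subsp_zero[OF W] by (auto simp: isometries_def Bij_def dest: bij_betwE)
    moreover have "0 \<cdot>\<^sub>v x = 0\<^sub>v n" if "x \<in> carrier_vec n" for x :: "'a vec"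
      using that by (intro eq_vecI) auto
    ultimately show ?thesis
      using W by (simp add: subsp_carrier)
  qed
  then show ?thesis
    using ns by (auto simp: isometries_hat_def nonsingular_def)
qed

section \<open>Reflection matrices and the groups they generate\<close>

lemma refl_matrix_carrier [simp]: "refl_matrix n B i \<in> carrier_mat n n"
  by (simp add: refl_matrix_def)

lemma refl_matrix_mult:
  assumes i: "i < n" and x: "x \<in> carrier_vec n"
  shows "refl_matrix n B i *\<^sub>v x = reflection B (unit_vec n i) x"
proof (rule eq_vecI)
  let ?e = "unit_vec n i :: 'a vec"
  fix k assume "k < dim_vec (reflection B ?e x)"
  then have k: "k < n"
    using x by (simp add: reflection_def)
  have entry: "refl_matrix n B i $$ (k, l)
      = (if k = l then 1 else 0) - 2 / (?e \<sqdot> ?e) * ?e $ k * (?e \<sqdot> unit_vec n l)" if "l < n" for l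
    using that k i by (simp add: refl_matrix_def reflection_def form_sym[of "unit_vec n l" ?e])
  have "(refl_matrix n B i *\<^sub>v x) $ k = (\<Sum>l<n. refl_matrix n B i $$ (k, l) * x $ l)"
    using k x by (simp add: scalar_prod_def refl_matrix_def atLeast0LessThan)
  also have "\<dots> = (\<Sum>l<n. (if k = l then x $ l else 0)
      - 2 / (?e \<sqdot> ?e) * ?e $ k * ((?e \<sqdot> unit_vec n l) * x $ l))"
    by (intro sum.cong) (auto simp: entry algebra_simps)
  also have "\<dots> = x $ k - 2 / (?e \<sqdot> ?e) * ?e $ k * (\<Sum>l<n. (?e \<sqdot> unit_vec n l) * x $ l)"
    using k by (simp add: sum_subtractf sum_distrib_left)
  also have "(\<Sum>l<n. (?e \<sqdot> unit_vec n l) * x $ l) = (\<Sum>l<n. B $$ (i, l) * x $ l)"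
    using i by (simp add: form_unit)
  also have "\<dots> = ?e \<sqdot> x"
    using i x by (simp add: form_unit_left scalar_prod_def atLeast0LessThan)
  also have "x $ k - 2 / (?e \<sqdot> ?e) * ?e $ k * (?e \<sqdot> x) = reflection B ?e x $ k"
    using k x by (simp add: reflection_def form_sym[of x ?e])
  finally show "(refl_matrix n B i *\<^sub>v x) $ k = reflection B ?e x $ k" .
qed (use x in \<open>simp add: refl_matrix_def reflection_def\<close>)

lemma mat_eq_by_action:
  assumes "g \<in> carrier_mat n n" "h \<in> carrier_mat n n"
    and "\<And>x. x \<in> carrier_vec n \<Longrightarrow> g *\<^sub>v x = h *\<^sub>v (x :: 'a vec)"
  shows "g = h"
proof (rule eq_matI)
  fix i j assume ij: "i < dim_row h" "j < dim_col h"
  then have "(g *\<^sub>v unit_vec n j) $ i = (h *\<^sub>v unit_vec n j) $ i"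
    using assms(3)[of "unit_vec n j"] by simp
  then show "g $$ (i, j) = h $$ (i, j)"
    using ij assms(1,2) by (simp add: scalar_prod_right_unit)
qed (use assms(1,2) in auto)

text \<open>The generators are formed from the form over the finite field, whereas
  \<open>reduced_group\<close> reduces real reflection matrices; \<open>reduced_group_eq\<close>
  identifies the two when no label vanishes.\<close>

definition matrix_group :: "nat set \<Rightarrow> 'a mat set" where
  "matrix_group J = generate (units_of (ring_mat TYPE('a) n ())) {refl_matrix n B j | j. j < n \<and> j \<notin> J}"

definition roots :: "nat set \<Rightarrow> 'a vec set" where
  "roots J = {unit_vec n j | j. j < n \<and> j \<notin> J}"

lemma roots_aniso:
  assumes "\<And>j. j < n \<Longrightarrow> B $$ (j, j) \<noteq> 0"
  shows "roots J \<subseteq> aniso (carrier_vec n)"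
  using assms by (auto simp: roots_def aniso_def form_unit)

lemma matrix_group_words:
  assumes diag: "\<And>j. j < n \<Longrightarrow> B $$ (j, j) \<noteq> 0"
  shows "g \<in> matrix_group J \<longleftrightarrow> g \<in> carrier_mat n n
    \<and> (\<exists>as. set as \<subseteq> roots J \<and> (\<forall>x\<in>carrier_vec n. g *\<^sub>v x = refls B as x))"
proof -
  let ?M = "ring_mat TYPE('a) n ()" and ?R = "refl_matrix n B"
  let ?S = "{?R j | j. j < n \<and> j \<notin> J}"
  interpret M: ring ?M
    by (rule ring_mat)
  interpret U: group "units_of ?M"
    by (rule M.units_group)
  have RR: "?R j * ?R j = 1\<^sub>m n" if "j < n" for j
  proof (rule mat_eq_by_action)
    fix x :: "'a vec" assume x: "x \<in> carrier_vec n"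
    then show "?R j * ?R j *\<^sub>v x = 1\<^sub>m n *\<^sub>v x"
      using that diag by (simp add: refl_matrix_mult form_unit assoc_mult_mat_vec[of _ n n _ n])
  qed (auto intro: mult_carrier_mat[of _ n n])
  have S: "?S \<subseteq> carrier (units_of ?M)"
  proof
    fix s assume "s \<in> ?S"
    then obtain j where "j < n" "s = ?R j"
      by blast
    then show "s \<in> carrier (units_of ?M)"
      using RR[of j] by (auto simp: units_of_carrier Units_def ring_mat_simps intro!: bexI[of _ "?R j"])
  qed
  have gen: "matrix_group J = {foldr (*) ss (1\<^sub>m n) | ss. set ss \<subseteq> ?S}"
    using U.generate_involutions[OF S] RR
    by (auto simp: matrix_group_def units_of_mult units_of_one ring_mat_simps)
  have fold: "foldr (*) (map ?R js) (1\<^sub>m n) \<in> carrier_mat n n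
      \<and> (\<forall>x\<in>carrier_vec n. foldr (*) (map ?R js) (1\<^sub>m n) *\<^sub>v x = refls B (map (unit_vec n) js) x)"
    if "set js \<subseteq> {..<n}" for js
    using that
  proof (induction js)
    case (Cons j js)
    then have c: "foldr (*) (map ?R js) (1\<^sub>m n) \<in> carrier_mat n n"
      by simp
    have "set (map (unit_vec n) js) \<subseteq> aniso (carrier_vec n)"
      using Cons.prems diag by (auto simp: aniso_def form_unit)
    then show ?case
      using Cons c
      by (auto intro!: mult_carrier_mat[of _ n n] refl_matrix_mult
          simp: assoc_mult_mat_vec[of _ n n _ n])
  qed simp
  show ?thesis
  proof
    assume "g \<in> matrix_group J"
    then obtain ss where ss: "set ss \<subseteq> ?S" "g = foldr (*) ss (1\<^sub>m n)"
      unfolding gen by blast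
    from ss(1) have "set ss \<subseteq> ?R ` ({..<n} - J)"
      by blast
    then obtain js where js: "set js \<subseteq> {..<n} - J" "ss = map ?R js"
      using list_over_image by blast
    then have "set (map (unit_vec n) js) \<subseteq> roots J"
      by (auto simp: roots_def)
    then show "g \<in> carrier_mat n n
        \<and> (\<exists>as. set as \<subseteq> roots J \<and> (\<forall>x\<in>carrier_vec n. g *\<^sub>v x = refls B as x))"
      using fold[of js] js ss(2) by blast
  next
    assume "g \<in> carrier_mat n n \<and> (\<exists>as. set as \<subseteq> roots J \<and> (\<forall>x\<in>carrier_vec n. g *\<^sub>v x = refls B as x))"
    then obtain as where g: "g \<in> carrier_mat n n" and as: "set as \<subseteq> roots J"
      "\<And>x. x \<in> carrier_vec n \<Longrightarrow> g *\<^sub>v x = refls B as x"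
      by blast
    from as(1) have "set as \<subseteq> unit_vec n ` ({..<n} - J)"
      by (auto simp: roots_def)
    then obtain js where js: "set js \<subseteq> {..<n} - J" "as = map (unit_vec n) js"
      using list_over_image by blast
    have "set js \<subseteq> {..<n}"
      using js(1) by auto
    from fold[OF this] have "g = foldr (*) (map ?R js) (1\<^sub>m n)"
      using g as(2) by (intro mat_eq_by_action) (auto simp: js(2))
    then show "g \<in> matrix_group J"
      using js(1) unfolding gen by force
  qed
qed

end

lemma coord_subspace_eq:
  "coord_subspace n J = {x \<in> carrier_vec n. \<forall>j<n. j \<in> J \<longrightarrow> x $ j = (0::'a::field)}" (is "_ = ?R")
proof -
  interpret V: vec_space "TYPE('a)" n .
  let ?S = "{unit_vec n j :: 'a vec | j. j < n \<and> j \<notin> J}"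
  have S: "?S \<subseteq> carrier_vec n"
    by auto
  have eq: "coord_subspace n J = V.span ?S"
    by (simp add: coord_subspace_def)
  show ?thesis
  proof
    have "submodule class_ring ?R (module_vec TYPE('a) n)"
      by unfold_locales (auto simp: class_ring_simps module_vec_simps)
    moreover have "?S \<subseteq> ?R"
      by auto
    ultimately show "coord_subspace n J \<subseteq> ?R"
      unfolding eq by (intro V.span_is_subset)
    show "?R \<subseteq> coord_subspace n J"
    proof
      fix x :: "'a vec" assume x: "x \<in> ?R"
      \<comment> \<open>\<open>x\<close> is assembled from its truncations to the first
        \<open>k\<close> coordinates.\<close>
      have "vec n (\<lambda>i. if i < k then x $ i else 0) \<in> V.span ?S" if "k \<le> n" for k
        using that
      proof (induction k)
        case 0
        have "vec n (\<lambda>i. if i < 0 then x $ i else 0) = 0\<^sub>v n"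
          by (intro eq_vecI) auto
        then show ?case
          using V.span_zero[of ?S] by (simp add: module_vec_simps)
      next
        case (Suc k)
        have "vec n (\<lambda>i. if i < Suc k then x $ i else 0)
            = vec n (\<lambda>i. if i < k then x $ i else 0) + x $ k \<cdot>\<^sub>v unit_vec n k"
          using Suc.prems by (intro eq_vecI) (auto simp: less_Suc_eq)
        moreover have "x $ k \<cdot>\<^sub>v unit_vec n k \<in> V.span ?S"
        proof (cases "k \<in> J")
          case True
          then have "x $ k \<cdot>\<^sub>v unit_vec n k = 0\<^sub>v n"
            using x Suc.prems by (intro eq_vecI) auto
          then show ?thesis
            using V.span_zero[of ?S] by (simp add: module_vec_simps)
        next
          case False
          then have "unit_vec n k \<in> V.span ?S"
            using V.in_own_span[of ?S] S Suc.prems by auto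
          then show ?thesis
            by (rule V.smult_in_span[OF S])
        qed
        ultimately show ?case
          using Suc V.span_add1[OF S] by (simp add: module_vec_simps)
      qed
      from this[of n] have "vec n (\<lambda>i. if i < n then x $ i else 0) \<in> V.span ?S"
        by simp
      moreover have "vec n (\<lambda>i. if i < n then x $ i else 0) = x"
        using x by (intro eq_vecI) auto
      ultimately show "x \<in> coord_subspace n J"
        unfolding eq by simp
    qed
  qed
qed


section \<open>Intersections of parabolic subgroups\<close>

context symmetric_form
begin

section \<open>Coordinate subspaces and dual vectors\<close>

lemma subsp_coord: "subsp (coord_subspace n J)"
  by (auto simp: subsp_def coord_subspace_eq)

lemma coord_subspace_Int: "coord_subspace n J \<inter> coord_subspace n K = (coord_subspace n (J \<union> K) :: 'a vec set)"
  by (auto simp: coord_subspace_eq)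

lemma coord_subspace_empty: "coord_subspace n {} = (carrier_vec n :: 'a vec set)"
  by (auto simp: coord_subspace_eq)

lemma coord_subspace_antimono: "J \<subseteq> K \<Longrightarrow> coord_subspace n K \<subseteq> (coord_subspace n J :: 'a vec set)"
  by (auto simp: coord_subspace_eq)

lemma roots_coord: "roots J \<subseteq> coord_subspace n J"
  by (auto simp: roots_def coord_subspace_eq)

lemma orthogonal_coord:
  assumes x: "x \<in> carrier_vec n" and orth: "\<And>j. j < n \<Longrightarrow> j \<notin> J \<Longrightarrow> x \<sqdot> unit_vec n j = 0"
    and y: "y \<in> coord_subspace n J"
  shows "x \<sqdot> y = 0"
proof -
  have yc: "y \<in> carrier_vec n"
    using y by (simp add: coord_subspace_eq)
  have "y $ i * (B *\<^sub>v x) $ i = 0" if "i < n" for i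
    using that orth[of i] y x form_sym[of x "unit_vec n i"] by (auto simp: coord_subspace_eq form_unit_left)
  then have "y \<sqdot> x = 0"
    unfolding form_def scalar_prod_def using x by (intro sum.neutral) (simp del: index_mult_mat_vec)
  then show ?thesis
    using form_sym[OF x yc] by simp
qed

lemma nonsingularD:
  assumes "nonsingular B W" "subsp W" "x \<in> W" "\<And>y. y \<in> W \<Longrightarrow> x \<sqdot> y = 0"
  shows "x = 0\<^sub>v n"
proof -
  have "x \<in> rad B W"
    using assms by (auto simp: rad_def perp_def dest: subsp_carrier)
  then show ?thesis
    using assms(1) by (simp add: nonsingular_def)
qed

lemma vec_eqI_diff: "x \<in> carrier_vec n \<Longrightarrow> y \<in> carrier_vec n \<Longrightarrow> x - y = 0\<^sub>v n \<Longrightarrow> x = (y :: 'a vec)"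
proof -
  assume xy: "x \<in> carrier_vec n" "y \<in> carrier_vec n" "x - y = 0\<^sub>v n"
  have "x = (x - y) + y"
    using xy(1,2) by (intro eq_vecI) auto
  then show "x = y"
    using xy by simp
qed

text \<open>Taking products with the basis roots outside \<open>J\<close> is injective on a
  non-singular \<open>coord_subspace n J\<close>, hence onto by finiteness.\<close>

lemma dual_vector:
  assumes ns: "nonsingular B (coord_subspace n J)" and k: "k < n" "k \<notin> J"
  shows "\<exists>c \<in> coord_subspace n J. \<forall>j<n. j \<notin> J \<longrightarrow> c \<sqdot> unit_vec n j = (if j = k then 1 else 0)"
proof -
  let ?V = "coord_subspace n J :: 'a vec set"
  \<comment> \<open>The entries in \<open>J\<close> are set to 0 so that the map stays inside the
    subspace and counting applies.\<close>
  define \<phi> where "\<phi> x = vec n (\<lambda>i. if i \<in> J then 0 else (B *\<^sub>v x) $ i)" for x :: "'a vec"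
  have Vc: "x \<in> carrier_vec n" if "x \<in> ?V" for x
    using that by (simp add: coord_subspace_eq)
  have \<phi>: "\<phi> x $ j = x \<sqdot> unit_vec n j" if "x \<in> carrier_vec n" "j < n" "j \<notin> J" for x j
    using that form_sym[of x "unit_vec n j"] by (simp add: \<phi>_def form_unit_left)
  have "inj_on \<phi> ?V"
  proof (rule inj_onI)
    fix x y assume xy: "x \<in> ?V" "y \<in> ?V" "\<phi> x = \<phi> y"
    have c: "x \<in> carrier_vec n" "y \<in> carrier_vec n"
      using xy Vc by simp_all
    have eq: "x \<sqdot> unit_vec n j = y \<sqdot> unit_vec n j" if "j < n" "j \<notin> J" for j
      using \<phi>[OF c(1) that] \<phi>[OF c(2) that] xy(3) by simp
    have "(x - y) \<sqdot> w = 0" if "w \<in> ?V" for w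
      by (rule orthogonal_coord[OF _ _ that]) (use c eq in simp_all)
    then have "x - y = 0\<^sub>v n"
      using subsp_minus[OF subsp_coord xy(1,2)] by (intro nonsingularD[OF ns subsp_coord])
    then show "x = y"
      using c by (rule vec_eqI_diff[rotated 2])
  qed
  moreover have "\<phi> ` ?V \<subseteq> ?V"
    by (auto simp: coord_subspace_eq \<phi>_def)
  ultimately have "\<phi> ` ?V = ?V"
    using subsp_finite[OF subsp_coord] by (intro endo_inj_surj) auto
  moreover have "unit_vec n k \<in> ?V"
    using k by (auto simp: coord_subspace_eq)
  ultimately obtain c where "c \<in> ?V" "\<phi> c = unit_vec n k"
    by (metis imageE)
  then have "\<forall>j<n. j \<notin> J \<longrightarrow> c \<sqdot> unit_vec n j = (if j = k then 1 else 0)"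
    using \<phi>[of c] Vc[of c] k(1) by (metis index_unit_vec(1))
  then show ?thesis
    using \<open>c \<in> ?V\<close> by blast
qed

text \<open>The property that elements of the intersection inherit from both groups: all
  displacements lie in \<open>W\<close>, although the letters need not.\<close>

definition mover :: "'a vec set \<Rightarrow> 'a vec list \<Rightarrow> bool" where
  "mover W as \<longleftrightarrow> set as \<subseteq> aniso (carrier_vec n) \<and> (\<forall>x\<in>carrier_vec n. refls B as x - x \<in> W)"

lemma subsp_aniso_carrier: "subsp W \<Longrightarrow> set as \<subseteq> aniso W \<Longrightarrow> set as \<subseteq> aniso (carrier_vec n)"
  by (auto simp: aniso_def dest: subsp_carrier)

lemma mover_refls: "subsp W \<Longrightarrow> set as \<subseteq> aniso W \<Longrightarrow> mover W as"
  by (simp add: mover_def refls_moves subsp_aniso_carrier)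

text \<open>A vector of \<open>W\<close> stays in \<open>W\<close> because its displacement does;
  for the inverse, \<open>y\<close> is \<open>x\<close> minus the displacement of
  \<open>y\<close>.\<close>

lemma mover_in:
  assumes W: "subsp W" and as: "mover W as" and x: "x \<in> W"
  shows "refls B as x \<in> W" and "refls B (rev as) x \<in> W"
proof -
  have xc: "x \<in> carrier_vec n"
    using W x by (rule subsp_carrier)
  have an: "set as \<subseteq> aniso (carrier_vec n)"
    using as by (simp add: mover_def)
  show "refls B as x \<in> W"
    using as xc x W an subsp_minus_cancel[of W x "refls B as x"] by (simp add: mover_def)
  let ?y = "refls B (rev as) x"
  have yc: "?y \<in> carrier_vec n"
    using an xc by simp
  have "refls B as ?y - ?y \<in> W"
    using as yc by (simp add: mover_def)
  then have "x - ?y \<in> W"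
    using an xc by simp
  then have "x - (x - ?y) \<in> W"
    using W x by (simp add: subsp_minus)
  moreover have "x - (x - ?y) = ?y"
    using xc yc by (intro eq_vecI) auto
  ultimately show "?y \<in> W"
    by simp
qed

text \<open>An isometry that preserves \<open>W\<close> also preserves its complement, so the
  displacement of a vector of the complement lies both there and in \<open>W\<close>.\<close>

lemma mover_perp:
  assumes W: "subsp W" and as: "mover W as" and x: "x \<in> perp B W"
  shows "refls B as x - x \<in> rad B W"
proof -
  have an: "set as \<subseteq> aniso (carrier_vec n)"
    using as by (simp add: mover_def)
  have xc: "x \<in> carrier_vec n" and xW: "\<And>w. w \<in> W \<Longrightarrow> x \<sqdot> w = 0"
    using x by (auto simp: perp_def)
  have "(refls B as x - x) \<sqdot> w = 0" if w: "w \<in> W" for w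
  proof -
    have wc: "w \<in> carrier_vec n"
      using W w by (rule subsp_carrier)
    have "refls B as x \<sqdot> w = refls B as x \<sqdot> refls B as (refls B (rev as) w)"
      using an wc by simp
    also have "\<dots> = x \<sqdot> refls B (rev as) w"
      using an xc wc by (intro form_refls) auto
    also have "\<dots> = 0"
      using xW mover_in(2)[OF W as w] by simp
    finally show ?thesis
      using xc wc an xW[OF w] by simp
  qed
  moreover have "refls B as x - x \<in> W"
    using as xc by (simp add: mover_def)
  ultimately show ?thesis
    using W by (auto simp: rad_def perp_def dest: subsp_carrier)
qed

text \<open>Both isometries send the same \<open>y\<close> of \<open>W\<close> to a given
  \<open>w\<close>, so the images of \<open>x\<close> have the same product
  \<open>x \<sqdot> y\<close> with \<open>w\<close>.\<close>

lemma movers_agreeing_difference: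
  assumes W: "subsp W" and as: "mover W as" and bs: "mover W bs"
    and agree: "\<And>w. w \<in> W \<Longrightarrow> refls B as w = refls B bs w" and x: "x \<in> carrier_vec n"
  shows "refls B as x - refls B bs x \<in> rad B W"
proof -
  have an: "set as \<subseteq> aniso (carrier_vec n)" "set bs \<subseteq> aniso (carrier_vec n)"
    using as bs by (simp_all add: mover_def)
  have "(refls B as x - refls B bs x) \<sqdot> w = 0" if w: "w \<in> W" for w
  proof -
    have wc: "w \<in> carrier_vec n"
      using W w by (rule subsp_carrier)
    define y where "y = refls B (rev as) w"
    have y: "y \<in> W" "y \<in> carrier_vec n" "refls B as y = w"
      using mover_in(2)[OF W as w] an wc W by (auto simp: y_def)
    then have "refls B bs y = w"
      using agree by simp
    then have "refls B as x \<sqdot> w = x \<sqdot> y" "refls B bs x \<sqdot> w = x \<sqdot> y"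
      using form_refls[OF an(1) x y(2)] form_refls[OF an(2) x y(2)] y(3) by simp_all
    then show ?thesis
      using an x wc by simp
  qed
  moreover have "refls B as x \<in> carrier_vec n" "refls B bs x \<in> carrier_vec n"
    using an x by simp_all
  then have "refls B as x - refls B bs x = (refls B as x - x) - (refls B bs x - x)"
    using x by (intro eq_vecI) auto
  then have "refls B as x - refls B bs x \<in> W"
    using as bs x W by (simp add: mover_def subsp_minus)
  ultimately show ?thesis
    using W by (auto simp: rad_def perp_def dest: subsp_carrier)
qed

lemma movers_agree_nonsingular:
  assumes "subsp W" "nonsingular B W" "mover W as" "mover W bs"
    and "\<And>w. w \<in> W \<Longrightarrow> refls B as w = refls B bs w" and x: "x \<in> carrier_vec n"
  shows "refls B as x = refls B bs x"
proof (rule vec_eqI_diff)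
  show "refls B as x \<in> carrier_vec n" "refls B bs x \<in> carrier_vec n"
    using assms(3,4) x by (simp_all add: mover_def)
  show "refls B as x - refls B bs x = 0\<^sub>v n"
    using movers_agreeing_difference[OF assms(1,3-6)] assms(2) by (simp add: nonsingular_def)
qed

text \<open>Covers both shapes of \<open>W\<close>: no radical at all, or a radical of dimension at
  most one inside a non-singular space.\<close>

definition thin_rad :: "'a vec set \<Rightarrow> bool" where
  "thin_rad W \<longleftrightarrow> nonsingular B W \<or> nonsingular B (carrier_vec n)
    \<and> (\<forall>d\<in>rad B W. d \<noteq> 0\<^sub>v n \<longrightarrow> (\<forall>d'\<in>rad B W. \<exists>c. d' = c \<cdot>\<^sub>v d))"

text \<open>If the radical of \<open>W\<close> is spanned by \<open>d\<close>, the difference of two isometries that agree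
  on \<open>W\<close> and \<open>W\<^sup>\<bottom>\<close> is \<open>x \<mapsto> \<mu>(x) d\<close>, and polarisation makes \<open>\<mu>(x) (d \<cdot> y)\<close> alternating.\<close>

lemma movers_agree_thin:
  assumes W: "subsp W" and thin: "thin_rad W" and as: "mover W as" and bs: "mover W bs"
    and agree: "\<And>w. w \<in> W \<Longrightarrow> refls B as w = refls B bs w"
    and fix_bs: "\<And>w. w \<in> perp B W \<Longrightarrow> refls B bs w = w"
    and x: "x \<in> carrier_vec n"
  shows "refls B as x = refls B bs x"
proof (cases "nonsingular B W")
  case True
  then show ?thesis
    using movers_agree_nonsingular[OF W _ as bs agree x] by blast
next
  case False
  then have ns: "nonsingular B (carrier_vec n)"
    and line: "\<And>d d'. d \<in> rad B W \<Longrightarrow> d \<noteq> 0\<^sub>v n \<Longrightarrow> d' \<in> rad B W \<Longrightarrow> \<exists>c. d' = c \<cdot>\<^sub>v d"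
    using thin by (auto simp: thin_rad_def)
  have an: "set as \<subseteq> aniso (carrier_vec n)" "set bs \<subseteq> aniso (carrier_vec n)"
    using as bs by (simp_all add: mover_def)
  define D where "D y = refls B as y - refls B bs y" for y
  have D: "D y \<in> rad B W" if "y \<in> carrier_vec n" for y
    using movers_agreeing_difference[OF W as bs agree that] by (simp add: D_def)
  have Dc: "D y \<in> carrier_vec n" if "y \<in> carrier_vec n" for y
    using an that by (simp add: D_def)
  have asD: "refls B as y = refls B bs y + D y" if "y \<in> carrier_vec n" for y
  proof -
    have "refls B as y \<in> carrier_vec n" "refls B bs y \<in> carrier_vec n"
      using an that by simp_all
    then show ?thesis
      by (intro eq_vecI) (auto simp: D_def)
  qed
  have bsD: "refls B bs y \<sqdot> D z = y \<sqdot> D z" if yz: "y \<in> carrier_vec n" "z \<in> carrier_vec n" for y z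
  proof -
    have "D z \<in> perp B W"
      using D[OF yz(2)] by (simp add: rad_def)
    then have "refls B bs y \<sqdot> D z = refls B bs y \<sqdot> refls B bs (D z)"
      by (simp add: fix_bs)
    then show ?thesis
      using form_refls[OF an(2) yz(1) Dc[OF yz(2)]] by simp
  qed
  have DD: "D y \<sqdot> D z = 0" if "y \<in> carrier_vec n" "z \<in> carrier_vec n" for y z
    using D[OF that(1)] D[OF that(2)] radD[of "D y" W "D z"] by (simp add: rad_def)
  \<comment> \<open>Both words preserve the form, values of \<open>D\<close> are mutually
    orthogonal, and \<open>bs\<close> fixes them; expanding with \<open>asD\<close> leaves only the
    two cross terms.\<close>
  have alt: "y \<sqdot> D z + z \<sqdot> D y = 0" if yz: "y \<in> carrier_vec n" "z \<in> carrier_vec n" for y z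
  proof -
    have "refls B as y \<sqdot> refls B as z = refls B bs y \<sqdot> refls B bs z"
      using form_refls[OF an(1) yz] form_refls[OF an(2) yz] by simp
    moreover have "refls B as y \<sqdot> refls B as z
        = refls B bs y \<sqdot> refls B bs z + refls B bs y \<sqdot> D z + (D y \<sqdot> refls B bs z + D y \<sqdot> D z)"
      using yz Dc an by (simp add: asD)
    ultimately have "refls B bs y \<sqdot> D z + D y \<sqdot> refls B bs z = 0"
      using DD[OF yz] by (simp add: add.assoc)
    then show ?thesis
      using bsD[OF yz] bsD[OF yz(2,1)] form_sym[of "D y" "refls B bs z"] Dc[OF yz(1)] yz(2) an(2) by simp
  qed
  have "D x = 0\<^sub>v n"
  proof (rule ccontr)
    assume D0: "D x \<noteq> 0\<^sub>v n"
    \<comment> \<open>Some \<open>y\<close> pairs with \<open>D x\<close>, and \<open>D y\<close> is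
      a multiple of \<open>D x\<close>. Polarisation at \<open>x, x\<close> gives
      \<open>x \<sqdot> D x = 0\<close>, so \<open>x \<sqdot> D y = 0\<close>, and at
      \<open>y, x\<close> it then gives \<open>y \<sqdot> D x = 0\<close>, a contradiction.\<close>
    have "\<exists>y\<in>carrier_vec n. D x \<sqdot> y \<noteq> 0"
      using nonsingularD[OF ns subsp_carrier_vec Dc[OF x]] D0 by blast
    then obtain y where y: "y \<in> carrier_vec n" "D x \<sqdot> y \<noteq> 0"
      by blast
    obtain c where c: "D y = c \<cdot>\<^sub>v D x"
      using line[OF D[OF x] D0 D[OF y(1)]] by blast
    have "2 * (x \<sqdot> D x) = 0"
      using alt[OF x x] by (simp only: mult_2)
    then have "x \<sqdot> D x = 0"
      using two by (metis mult_eq_0_iff)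
    then have "x \<sqdot> D y = 0"
      using x Dc[OF x] by (simp add: c)
    then have "y \<sqdot> D x = 0"
      using alt[OF y(1) x] by simp
    then show False
      using y form_sym[OF y(1) Dc[OF x]] by simp
  qed
  then show ?thesis
    using an x by (simp add: D_def vec_eqI_diff)
qed

lemma refls_fix_perp:
  assumes "subsp W" "set as \<subseteq> aniso W" "x \<in> perp B W"
  shows "refls B as x = x"
  using assms by (intro refls_fix subsp_aniso_carrier[of W]) (auto simp: perp_def aniso_def subset_iff)

text \<open>The Cartan--Dieudonne theorem gives a word in roots of \<open>W\<close> with the same
  restriction to \<open>W\<close>; the thin radical carries the agreement over to the whole
  space.\<close>

lemma mover_is_word:
  assumes W: "subsp W" and thin: "thin_rad W" and as: "mover W as"
    and perp: "\<And>x. x \<in> perp B W \<Longrightarrow> refls B as x = x"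
  shows "\<exists>bs. set bs \<subseteq> aniso W \<and> (\<forall>x\<in>carrier_vec n. refls B as x = refls B bs x)"
proof -
  have an: "set as \<subseteq> aniso (carrier_vec n)"
    using as by (simp add: mover_def)
  have Wc: "x \<in> carrier_vec n" if "x \<in> W" for x
    using W that by (rule subsp_carrier)
  have "\<exists>bs. set bs \<subseteq> aniso W \<and> (\<forall>x\<in>W. refls B as x = refls B bs x)"
    using mover_in(1)[OF W as] an Wc perp
    by (intro isometry_by_refls[OF W]) (auto simp: refls_add refls_smult form_refls rad_def)
  then obtain bs where bs: "set bs \<subseteq> aniso W" "\<forall>x\<in>W. refls B as x = refls B bs x"
    by blast
  have "refls B as x = refls B bs x" if "x \<in> carrier_vec n" for x
    using bs(2) by (intro movers_agree_thin[OF W thin as mover_refls[OF W bs(1)] _ refls_fix_perp[OF W bs(1)] that]) auto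
  then show ?thesis
    using bs(1) by blast
qed

text \<open>As \<open>2 \<noteq> 0\<close>, the last condition says that the field has order 3 or characteristic at least 5.\<close>

definition string_basis :: bool where
  "string_basis \<longleftrightarrow> 3 \<le> n \<and> (\<forall>j<n. B $$ (j, j) \<noteq> 0)
    \<and> (\<forall>i<n. \<forall>j<n. Suc i < j \<longrightarrow> B $$ (i, j) = 0)
    \<and> (\<exists>i\<in>{1..n - 2}. nonzero_square (B $$ (i, i)))
    \<and> ((3::'a) \<noteq> 0 \<or> (\<forall>z::'a. z = 0 \<or> z * z = 1))"

section \<open>Parabolic subgroups as words in basis roots\<close>

lemma roots_aniso_coord: "string_basis \<Longrightarrow> roots J \<subseteq> aniso (coord_subspace n J)"
  using roots_coord[of J] by (auto simp: string_basis_def roots_def aniso_def form_unit)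

lemma matrix_group_iff:
  assumes "string_basis"
  shows "g \<in> matrix_group J \<longleftrightarrow> g \<in> carrier_mat n n
    \<and> (\<exists>as. set as \<subseteq> roots J \<and> (\<forall>x\<in>carrier_vec n. g *\<^sub>v x = refls B as x))"
  using assms by (intro matrix_group_words) (simp add: string_basis_def)

lemma matrix_group_word:
  assumes "string_basis" "g \<in> matrix_group J"
  obtains as where "set as \<subseteq> roots J" "\<And>x. x \<in> carrier_vec n \<Longrightarrow> g *\<^sub>v x = refls B as x"
  using assms by (auto simp: matrix_group_iff)

lemma matrix_of_word:
  assumes sb: "string_basis" and as: "set as \<subseteq> roots J"
  obtains g where "g \<in> matrix_group J" "\<And>x. x \<in> carrier_vec n \<Longrightarrow> g *\<^sub>v x = refls B as x"
proof -
  have "\<exists>g. g \<in> carrier_mat n n \<and> (\<forall>x\<in>carrier_vec n. g *\<^sub>v x = refls B as x)"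
    using as
  proof (induction as)
    case Nil
    then show ?case
      by (intro exI[of _ "1\<^sub>m n"]) simp
  next
    case (Cons a as)
    then obtain g j where g: "g \<in> carrier_mat n n" "\<forall>x\<in>carrier_vec n. g *\<^sub>v x = refls B as x"
      and j: "j < n" "a = unit_vec n j"
      by (auto simp: roots_def)
    have c: "refls B as x \<in> carrier_vec n" if "x \<in> carrier_vec n" for x
      using mult_mat_vec_carrier[OF g(1) that] g(2) that by simp
    have "refl_matrix n B j * g *\<^sub>v x = refls B (a # as) x" if "x \<in> carrier_vec n" for x
      using g c[OF that] j that
        assoc_mult_mat_vec[of "refl_matrix n B j" n n g n x] refl_matrix_mult[OF j(1) c[OF that]]
      by simp
    then show ?case
      using g(1) by (intro exI[of _ "refl_matrix n B j * g"]) (auto intro: mult_carrier_mat[of _ n n])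
  qed
  then obtain g where g: "g \<in> carrier_mat n n" "\<forall>x\<in>carrier_vec n. g *\<^sub>v x = refls B as x"
    by blast
  then have "g \<in> matrix_group J"
    unfolding matrix_group_iff[OF sb] using as by blast
  then show thesis
    using that g(2) by blast
qed

lemma matrix_group_carrier: "string_basis \<Longrightarrow> g \<in> matrix_group J \<Longrightarrow> g \<in> carrier_mat n n"
  by (simp add: matrix_group_iff)

lemma matrix_group_antimono:
  assumes "string_basis" "J \<subseteq> K"
  shows "matrix_group K \<subseteq> matrix_group J"
proof
  fix g assume "g \<in> matrix_group K"
  moreover have "roots K \<subseteq> roots J"
    using assms(2) by (auto simp: roots_def)
  ultimately show "g \<in> matrix_group J"
    unfolding matrix_group_iff[OF assms(1)] by (meson order_trans)
qed

lemma restr_eq: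
  "W \<subseteq> carrier_vec n \<Longrightarrow> (\<And>x. x \<in> carrier_vec n \<Longrightarrow> g *\<^sub>v x = f x) \<Longrightarrow> restr W g = restrict f W"
  by (auto simp: restr_def restrict_def fun_eq_iff)

text \<open>Only the full group and the group of square roots survive: the inner node with square
  label lies outside \<open>J\<close>, and its reflection is a word with one square letter, whereas
  words in roots of non-square norm \<open>j\<close> have none.\<close>

lemma orthogonal_type_words:
  assumes sb: string_basis and J: "J \<subseteq> {0, n - 1}" and ns: "nonsingular B (coord_subspace n J)"
    and ot: "orthogonal_type B (coord_subspace n J) (matrix_group J)"
  shows "restr (coord_subspace n J) ` matrix_group J = words (coord_subspace n J) (aniso (coord_subspace n J))
    \<or> restr (coord_subspace n J) ` matrix_group J
      = words (coord_subspace n J) (square_roots (coord_subspace n J))"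
proof -
  let ?V = "coord_subspace n J :: 'a vec set" and ?G = "matrix_group J"
  have V: "subsp ?V"
    by (rule subsp_coord)
  from ot consider "restr ?V ` ?G = isometries B ?V"
    | j where "j \<noteq> 0" "restr ?V ` ?G = refl_subgroup B j ?V"
    by (auto simp: orthogonal_type_def)
  then show ?thesis
  proof cases
    case 1
    then show ?thesis
      using isometries_nonsingular[OF V ns] isometries_hat_words[OF V] by simp
  next
    case (2 j)
    have "nonzero_square j"
    proof (rule ccontr)
      assume nsq: "\<not> nonzero_square j"
      obtain i where i: "i \<in> {1..n - 2}" "nonzero_square (B $$ (i, i))"
        using sb by (auto simp: string_basis_def)
      have i': "i < n" "i \<notin> J"
        using i(1) J sb by (auto simp: string_basis_def)
      let ?e = "unit_vec n i :: 'a vec"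
      have e: "set [?e] \<subseteq> roots J"
        using i' by (auto simp: roots_def)
      obtain g where g: "g \<in> ?G" "\<And>x. x \<in> carrier_vec n \<Longrightarrow> g *\<^sub>v x = refls B [?e] x"
        using matrix_of_word[OF sb e] by blast
      have "restr ?V g \<in> words ?V {a \<in> ?V. a \<sqdot> a = j}"
        using 2 g(1) refl_subgroup_words[OF V 2(1)] by blast
      then obtain as where as: "set as \<subseteq> {a \<in> ?V. a \<sqdot> a = j}" "restr ?V g = restrict (refls B as) ?V"
        by (auto simp: words_def)
      have agree: "refls B [?e] x = refls B as x" if "x \<in> ?V" for x
        using fun_cong[OF as(2), of x] g(2)[of x] that V by (simp add: restr_def subsp_carrier)
      have "set as \<subseteq> aniso ?V"
        using as(1) 2(1) by (auto simp: aniso_def)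
      from refls_spinor_norm(2)[OF V _ this agree] have
        "even (length (filter (\<lambda>a. nonzero_square (a \<sqdot> a)) [?e]))
          \<longleftrightarrow> even (length (filter (\<lambda>a. nonzero_square (a \<sqdot> a)) as))"
        using e roots_aniso_coord[OF sb] by blast
      moreover have "filter (\<lambda>a. nonzero_square (a \<sqdot> a)) as = []"
        using as(1) nsq by (auto simp: filter_empty_conv)
      ultimately show False
        using i(2) i'(1) by (simp add: form_unit)
    qed
    then show ?thesis
      using 2(2) refl_subgroup_square[OF V] refl_subgroup_hat_words[OF V] by simp
  qed
qed

lemma square_type_agrees:
  assumes V: "subsp V" and G: "restr V ` H = words V (square_roots V)" and g: "g \<in> H"
    and as: "set as \<subseteq> aniso V" "\<And>x. x \<in> carrier_vec n \<Longrightarrow> g *\<^sub>v x = refls B as x"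
  shows "even (length (filter (\<lambda>a. \<not> nonzero_square (a \<sqdot> a)) as))"
proof -
  have "restr V g \<in> words V (square_roots V)"
    using G g by blast
  then obtain es where es: "set es \<subseteq> square_roots V" "restr V g = restrict (refls B es) V"
    by (auto simp: words_def)
  have "refls B as x = refls B es x" if "x \<in> V" for x
    using fun_cong[OF es(2), of x] as(2)[of x] that V by (simp add: restr_def subsp_carrier)
  moreover have "set es \<subseteq> aniso V"
    using es(1) square_roots_aniso by blast
  moreover have "filter (\<lambda>a. \<not> nonzero_square (a \<sqdot> a)) es = []"
    using es(1) by (auto simp: filter_empty_conv square_roots_def)
  ultimately show ?thesis
    using refls_spinor_norm(1)[OF V as(1), of es] by simp
qed

text \<open>The reflection of node \<open>j\<close> is a one-letter word, and its number of
  non-square letters must be even.\<close>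

lemma square_type_labels:
  assumes sb: string_basis
    and G: "restr (coord_subspace n J) ` matrix_group J
      = words (coord_subspace n J) (square_roots (coord_subspace n J))"
    and j: "j < n" "j \<notin> J"
  shows "nonzero_square (B $$ (j, j))"
proof (rule ccontr)
  let ?e = "unit_vec n j :: 'a vec"
  assume nsq: "\<not> ?thesis"
  have e: "set [?e] \<subseteq> roots J"
    using j by (auto simp: roots_def)
  obtain g where g: "g \<in> matrix_group J" "\<And>x. x \<in> carrier_vec n \<Longrightarrow> g *\<^sub>v x = refls B [?e] x"
    using matrix_of_word[OF sb e] by blast
  have "set [?e] \<subseteq> aniso (coord_subspace n J)"
    using e roots_aniso_coord[OF sb] by blast
  from square_type_agrees[OF subsp_coord G g(1) this g(2)] show False
    using nsq j(1) by (simp add: form_unit)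
qed

section \<open>Elements common to the two end groups\<close>

lemma intersection_mover:
  assumes sb: string_basis and g: "g \<in> matrix_group {0} \<inter> matrix_group {n - 1}"
    and as: "set as \<subseteq> roots {0}" "\<And>x. x \<in> carrier_vec n \<Longrightarrow> g *\<^sub>v x = refls B as x"
  shows "mover (coord_subspace n {0, n - 1}) as"
proof -
  obtain bs where bs: "set bs \<subseteq> roots {n - 1}" "\<And>x. x \<in> carrier_vec n \<Longrightarrow> g *\<^sub>v x = refls B bs x"
    using matrix_group_word[OF sb, of g "{n - 1}"] g by blast
  have "set as \<subseteq> aniso (coord_subspace n {0})" "set bs \<subseteq> aniso (coord_subspace n {n - 1})"
    using as(1) bs(1) roots_aniso_coord[OF sb] by blast+
  then have m: "mover (coord_subspace n {0}) as" "mover (coord_subspace n {n - 1}) bs"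
    using mover_refls[OF subsp_coord] by blast+
  have "refls B as x - x \<in> coord_subspace n {0} \<inter> coord_subspace n {n - 1}" if "x \<in> carrier_vec n" for x
    using m as(2) bs(2) that by (auto simp: mover_def)
  then show ?thesis
    using m(1) unfolding coord_subspace_Int mover_def by (simp add: insert_commute)
qed

text \<open>The last basis root completes \<open>V\<^sub>0\<^sub>,\<^sub>n\<^sub>-\<^sub>1\<close>
  to \<open>V\<^sub>0\<close>. A radical vector orthogonal to this root too would lie in the radical
  of \<open>V\<^sub>0\<close>; hence the product with it is injective on the radical.\<close>

lemma thin_intersection:
  assumes n: "3 \<le> n"
    and ns: "nonsingular B (coord_subspace n {0, n - 1})
      \<or> nonsingular B (coord_subspace n {}) \<and> nonsingular B (coord_subspace n {0})"
  shows "thin_rad (coord_subspace n {0, n - 1})"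
proof (cases "nonsingular B (coord_subspace n {0, n - 1})")
  case False
  let ?W = "coord_subspace n {0, n - 1} :: 'a vec set" and ?V = "coord_subspace n {0} :: 'a vec set"
  let ?e = "unit_vec n (n - 1) :: 'a vec"
  have ns: "nonsingular B (coord_subspace n {})" "nonsingular B ?V"
    using ns False by auto
  have WV: "?W \<subseteq> ?V"
    by (rule coord_subspace_antimono) simp
  have zero: "d = 0\<^sub>v n" if d: "d \<in> rad B ?W" "d \<sqdot> ?e = 0" for d
  proof (rule nonsingularD[OF ns(2) subsp_coord])
    show "d \<in> ?V"
      using d(1) WV by (auto simp: rad_def)
    fix y assume y: "y \<in> ?V"
    have dc: "d \<in> carrier_vec n"
      using d(1) by (auto simp: rad_def perp_def)
    show "d \<sqdot> y = 0"
    proof (rule orthogonal_coord[OF dc _ y])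
      fix j assume j: "j < n" "j \<notin> {0}"
      show "d \<sqdot> unit_vec n j = 0"
      proof (cases "j = n - 1")
        case True
        then show ?thesis
          using d(2) by simp
      next
        case False
        then have "unit_vec n j \<in> ?W"
          using j by (auto simp: coord_subspace_eq)
        then show ?thesis
          using radD[OF d(1)] by blast
      qed
    qed
  qed
  have "\<exists>c. d' = c \<cdot>\<^sub>v d" if d: "d \<in> rad B ?W" "d \<noteq> 0\<^sub>v n" and d': "d' \<in> rad B ?W" for d d'
  proof -
    have dc: "d \<in> carrier_vec n" "d' \<in> carrier_vec n" and dW: "d \<in> ?W" "d' \<in> ?W"
      using d(1) d' by (auto simp: rad_def perp_def)
    \<comment> \<open>Chosen so that \<open>d' - c \<cdot>\<^sub>v d\<close> is orthogonal to the
      last root.\<close>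
    define c where "c = (d' \<sqdot> ?e) / (d \<sqdot> ?e)"
    have "d \<sqdot> ?e \<noteq> 0"
      using zero[OF d(1)] d(2) by blast
    then have "(d' - c \<cdot>\<^sub>v d) \<sqdot> ?e = 0"
      using dc by (simp add: c_def)
    moreover have "(d' - c \<cdot>\<^sub>v d) \<sqdot> y = 0" if y: "y \<in> ?W" for y
      using dc radD[OF d(1) y] radD[OF d' y] subsp_carrier[OF subsp_coord y] by simp
    moreover have "d' - c \<cdot>\<^sub>v d \<in> ?W"
      using dW subsp_coord by (blast intro: subsp_minus subsp_smult)
    ultimately have "d' - c \<cdot>\<^sub>v d \<in> rad B ?W"
      using dc by (auto simp: rad_def perp_def)
    then have "d' - c \<cdot>\<^sub>v d = 0\<^sub>v n"
      using zero \<open>(d' - c \<cdot>\<^sub>v d) \<sqdot> ?e = 0\<close> by blast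
    then show ?thesis
      using dc vec_eqI_diff[of d' "c \<cdot>\<^sub>v d"] by auto
  qed
  then show ?thesis
    using ns(1) unfolding thin_rad_def coord_subspace_empty by blast
qed (simp add: thin_rad_def)

text \<open>If \<open>V\<close> is non-singular, \<open>V\<^sub>0\<^sub>,\<^sub>n\<^sub>-\<^sub>1\<^sup>\<bottom>\<close> is spanned by two vectors of the dual basis, each
  fixed by one of the two groups.\<close>

lemma intersection_fixes_perp:
  assumes sb: string_basis
    and ns: "nonsingular B (coord_subspace n {0, n - 1}) \<or> nonsingular B (coord_subspace n {})"
    and g: "g \<in> matrix_group {0} \<inter> matrix_group {n - 1}"
    and x: "x \<in> perp B (coord_subspace n {0, n - 1})"
  shows "g *\<^sub>v x = x"
proof -
  let ?W = "coord_subspace n {0, n - 1} :: 'a vec set"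
  have n: "3 \<le> n"
    using sb by (simp add: string_basis_def)
  obtain as where as: "set as \<subseteq> roots {0}" "\<And>x. x \<in> carrier_vec n \<Longrightarrow> g *\<^sub>v x = refls B as x"
    using matrix_group_word[OF sb, of g "{0}"] g by blast
  obtain bs where bs: "set bs \<subseteq> roots {n - 1}" "\<And>x. x \<in> carrier_vec n \<Longrightarrow> g *\<^sub>v x = refls B bs x"
    using matrix_group_word[OF sb, of g "{n - 1}"] g by blast
  have anr: "roots J \<subseteq> aniso (carrier_vec n)" for J
    using sb by (intro roots_aniso) (simp add: string_basis_def)
  have an: "set as \<subseteq> aniso (carrier_vec n)" "set bs \<subseteq> aniso (carrier_vec n)"
    using as(1) bs(1) anr by blast+
  have xc: "x \<in> carrier_vec n"
    using x by (simp add: perp_def)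
  show ?thesis
  proof (cases "nonsingular B ?W")
    case True
    have "refls B as x - x \<in> rad B ?W"
      using mover_perp[OF subsp_coord intersection_mover[OF sb g as] x] .
    then have "refls B as x = x"
      using True an xc by (simp add: nonsingular_def vec_eqI_diff)
    then show ?thesis
      using as(2) xc by simp
  next
    case False
    then have nsV: "nonsingular B (coord_subspace n {})"
      using ns by blast
    obtain u where u: "u \<in> carrier_vec n" "\<And>j. j < n \<Longrightarrow> u \<sqdot> unit_vec n j = (if j = 0 then 1 else 0)"
      using dual_vector[OF nsV, of 0] n by (auto simp: coord_subspace_empty)
    obtain v where v: "v \<in> carrier_vec n" "\<And>j. j < n \<Longrightarrow> v \<sqdot> unit_vec n j = (if j = n - 1 then 1 else 0)"
      using dual_vector[OF nsV, of "n - 1"] n by (auto simp: coord_subspace_empty)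
    have "u \<sqdot> a = 0" if a: "a \<in> set as" for a
    proof -
      obtain j where "j < n" "j \<noteq> 0" "a = unit_vec n j"
        using as(1) a by (auto simp: roots_def)
      then show ?thesis
        using u(2)[of j] by simp
    qed
    moreover have "v \<sqdot> a = 0" if a: "a \<in> set bs" for a
    proof -
      obtain j where "j < n" "j \<noteq> n - 1" "a = unit_vec n j"
        using bs(1) a by (auto simp: roots_def)
      then show ?thesis
        using v(2)[of j] by simp
    qed
    ultimately have gu: "g *\<^sub>v u = u" and gv: "g *\<^sub>v v = v"
      using as(2)[OF u(1)] bs(2)[OF v(1)] refls_fix[OF an(1) u(1)] refls_fix[OF an(2) v(1)] by simp_all
    \<comment> \<open>By duality \<open>y\<close> has the same products as \<open>x\<close> with the
      two end roots, and both are orthogonal to the inner ones.\<close>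
    define y where "y = (x \<sqdot> unit_vec n 0) \<cdot>\<^sub>v u + (x \<sqdot> unit_vec n (n - 1)) \<cdot>\<^sub>v v"
    have yc: "y \<in> carrier_vec n"
      using u(1) v(1) by (simp add: y_def)
    have "(x - y) \<sqdot> unit_vec n j = 0" if j: "j < n" for j
    proof (cases "j \<in> {0, n - 1}")
      case True
      then show ?thesis
        using xc u v n by (auto simp: y_def)
    next
      case False
      then have "unit_vec n j \<in> ?W"
        using j by (auto simp: coord_subspace_eq)
      then have "x \<sqdot> unit_vec n j = 0"
        using x by (simp add: perp_def)
      then show ?thesis
        using xc u v j False by (simp add: y_def)
    qed
    then have "x - y = 0\<^sub>v n"
      using xc yc nonsingularD[OF nsV subsp_coord, of "x - y"] orthogonal_coord[of "x - y" "{}"]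
      by (simp add: coord_subspace_empty)
    then have "x = y"
      using xc yc by (rule vec_eqI_diff[rotated 2])
    moreover have "g *\<^sub>v y = y"
    proof -
      have "refls B as u = u" "refls B as v = v"
        using gu gv as(2) u(1) v(1) by simp_all
      then have "refls B as y = y"
        using an(1) u(1) v(1) by (simp add: y_def refls_add refls_smult)
      then show ?thesis
        using as(2) yc by simp
    qed
    ultimately show ?thesis
      by simp
  qed
qed

lemma intersection_word:
  assumes sb: string_basis
    and ns: "nonsingular B (coord_subspace n {0, n - 1})
      \<or> nonsingular B (coord_subspace n {}) \<and> nonsingular B (coord_subspace n {0})"
    and g: "g \<in> matrix_group {0} \<inter> matrix_group {n - 1}"
  obtains as where "set as \<subseteq> aniso (coord_subspace n {0, n - 1})"
    "\<And>x. x \<in> carrier_vec n \<Longrightarrow> g *\<^sub>v x = refls B as x"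
proof -
  let ?W = "coord_subspace n {0, n - 1} :: 'a vec set"
  obtain bs where bs: "set bs \<subseteq> roots {0}" "\<And>x. x \<in> carrier_vec n \<Longrightarrow> g *\<^sub>v x = refls B bs x"
    using matrix_group_word[OF sb, of g "{0}"] g by blast
  have "thin_rad ?W"
    using thin_intersection ns sb by (simp add: string_basis_def)
  moreover have "refls B bs x = x" if "x \<in> perp B ?W" for x
    using intersection_fixes_perp[OF sb _ g that] ns bs(2)[of x] that by (auto simp: perp_def)
  ultimately obtain as where "set as \<subseteq> aniso ?W" "\<forall>x\<in>carrier_vec n. refls B bs x = refls B as x"
    using mover_is_word[OF subsp_coord _ intersection_mover[OF sb g bs]] by blast
  then show thesis
    using that bs(2) by simp
qed

text \<open>Lifts a word from its restriction to an element of the group: on a non-singular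
  \<open>coord_subspace n J\<close> the restriction determines the action on the whole
  space.\<close>

lemma words_in_group:
  assumes sb: string_basis and ns: "nonsingular B (coord_subspace n J)"
    and S: "S \<subseteq> aniso (coord_subspace n J)"
    and sub: "words (coord_subspace n J) S \<subseteq> restr (coord_subspace n J) ` matrix_group J"
    and as: "set as \<subseteq> S"
  obtains g where "g \<in> matrix_group J" "\<And>x. x \<in> carrier_vec n \<Longrightarrow> g *\<^sub>v x = refls B as x"
proof -
  let ?V = "coord_subspace n J :: 'a vec set"
  have "restrict (refls B as) ?V \<in> words ?V S"
    using as by (auto simp: words_def)
  then obtain g where g: "g \<in> matrix_group J" "restr ?V g = restrict (refls B as) ?V"
    using sub by force
  obtain bs where bs: "set bs \<subseteq> roots J" "\<And>x. x \<in> carrier_vec n \<Longrightarrow> g *\<^sub>v x = refls B bs x"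
    using matrix_group_word[OF sb g(1)] by blast
  have Vc: "x \<in> carrier_vec n" if "x \<in> ?V" for x
    using subsp_coord that by (rule subsp_carrier)
  have m: "mover ?V bs" "mover ?V as"
    using bs(1) roots_aniso_coord[OF sb] as S by (blast intro: mover_refls subsp_coord)+
  have "refls B bs x = refls B as x" if "x \<in> ?V" for x
    using fun_cong[OF g(2), of x] bs(2) Vc that by (simp add: restr_def)
  then have "refls B bs x = refls B as x" if "x \<in> carrier_vec n" for x
    using movers_agree_nonsingular[OF subsp_coord ns m _ that] by blast
  then show thesis
    using that[OF g(1)] bs(2) by simp
qed

text \<open>Here a nonzero square label equals 1, and \<open>c\<close> is orthogonal to every root
  of the group except that of the end node \<open>k\<close>; so the stabiliser of \<open>c\<close>
  omits this node.\<close>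

lemma char3_stabiliser:
  assumes sb: string_basis and three: "\<forall>z::'a. z = 0 \<or> z * z = 1"
    and J: "J = {0} \<and> k = n - 1 \<or> J = {n - 1} \<and> k = 0"
    and labels: "\<And>j. j < n \<Longrightarrow> j \<notin> J \<Longrightarrow> nonzero_square (B $$ (j, j))"
    and c: "c \<in> perp B (coord_subspace n {0, n - 1})" "c \<sqdot> unit_vec n k \<noteq> 0"
    and g: "g \<in> matrix_group J" "g *\<^sub>v c = c"
  obtains as where "set as \<subseteq> roots {0, n - 1}" "\<And>x. x \<in> carrier_vec n \<Longrightarrow> g *\<^sub>v x = refls B as x"
proof -
  have n: "3 \<le> n" and far: "\<And>i j. i < n \<Longrightarrow> j < n \<Longrightarrow> Suc i < j \<Longrightarrow> B $$ (i, j) = 0"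
    using sb by (auto simp: string_basis_def)
  have cc: "c \<in> carrier_vec n" and cW: "c \<sqdot> unit_vec n j = 0" if "j \<in> {1..n - 2}" for j
    using c(1) that n by (auto simp: perp_def coord_subspace_eq)
  have cc: "c \<in> carrier_vec n"
    using c(1) by (simp add: perp_def)
  define m where "m = n - 2"
  \<comment> \<open>Lists the \<open>n - 1\<close> nodes outside \<open>J\<close> with
    \<open>k\<close> last, at index \<open>m = n - 2\<close>: upwards from 1 or downwards from
    \<open>n - 2\<close>.\<close>
  define s where "s i = (if J = {0} then Suc i else m - i)" for i
  have J1: "J \<noteq> {0}" if "J = {n - 1}"
    using that n by auto
  have s: "s i < n" if "i \<le> m" for i
    using that n by (auto simp: s_def m_def)
  have inj: "inj_on s {..m}"
    by (auto simp: inj_on_def s_def)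
  have sm: "s m = k"
    using J J1 n by (auto simp: s_def m_def)
  have img: "s ` {..m} = {..<n} - J"
  proof -
    have "s ` {..m} \<subseteq> {..<n} - J"
      using J J1 n by (auto simp: s_def m_def)
    moreover have "card (s ` {..m}) = card ({..<n} - J)"
      using J n card_image[OF inj] by (auto simp: m_def card_Diff_singleton)
    ultimately show ?thesis
      by (intro card_subset_eq) auto
  qed
  have img': "s i \<in> {1..n - 2}" if "i < m" for i
    using that n by (auto simp: s_def m_def)
  have norm: "B $$ (s i, s i) = 1" if "i \<le> m" for i
  proof -
    have "s i < n" "s i \<notin> J"
      using img that by auto
    then obtain t where "t \<noteq> 0" "B $$ (s i, s i) = t * t"
      using labels by (auto simp: nonzero_square_def power2_eq_square)
    then show ?thesis
      using three[rule_format, of t] by simp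
  qed
  have far': "B $$ (s i, s j) = 0" if "j \<le> m" "Suc i < j" for i j
  proof (cases "J = {0}")
    case True
    then show ?thesis
      using that far[of "s i" "s j"] s by (simp add: s_def)
  next
    case False
    then show ?thesis
      using that far[of "s j" "s i"] s[of i] s[of j] B_sym[of "s i" "s j"] by (simp add: s_def)
  qed
  obtain bs where bs: "set bs \<subseteq> roots J" "\<And>x. x \<in> carrier_vec n \<Longrightarrow> g *\<^sub>v x = refls B bs x"
    using matrix_group_word[OF sb g(1)] by blast
  have "roots J = (\<lambda>i. unit_vec n (s i)) ` {..m}"
  proof -
    have "roots J = unit_vec n ` ({..<n} - J)"
      by (auto simp: roots_def)
    then show ?thesis
      by (simp only: img[symmetric] image_image)
  qed
  then obtain ws where ws: "set ws \<subseteq> {..m}" "bs = map (\<lambda>i. unit_vec n (s i)) ws"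
    using list_over_image bs(1) by metis
  have fix_c: "refls B (map (\<lambda>i. unit_vec n (s i)) ws) c = c"
    using g(2) bs(2)[OF cc] by (simp add: ws(2))
  have c0: "c \<sqdot> unit_vec n (s i) = 0" if "i < m" for i
    using cW img' that by blast
  have cm: "c \<sqdot> unit_vec n (s m) \<noteq> 0"
    using c(2) sm by simp
  obtain us where us: "set us \<subseteq> {..<m}" "\<forall>x\<in>carrier_vec n.
      refls B (map (\<lambda>i. unit_vec n (s i)) ws) x = refls B (map (\<lambda>i. unit_vec n (s i)) us) x"
    using string_stabiliser[of m s c ws, OF _ s inj norm far' cc c0 cm ws(1) fix_c] three by blast
  have "unit_vec n (s i) \<in> roots {0, n - 1}" if "i < m" for i
    using img'[OF that] n by (auto simp: roots_def)
  then have "set (map (\<lambda>i. unit_vec n (s i)) us) \<subseteq> roots {0, n - 1}"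
    using us(1) by auto
  then show thesis
    using that[of "map (\<lambda>i. unit_vec n (s i)) us"] us(2) bs(2) by (simp add: ws(2))
qed

lemma intersection_inj:
  assumes sb: string_basis
    and ns: "nonsingular B (coord_subspace n {0, n - 1})
      \<or> nonsingular B (coord_subspace n {}) \<and> nonsingular B (coord_subspace n {0})"
  shows "inj_on (restr (coord_subspace n {0, n - 1})) (matrix_group {0} \<inter> matrix_group {n - 1})"
proof (rule inj_onI)
  let ?W = "coord_subspace n {0, n - 1} :: 'a vec set"
  fix g h assume g: "g \<in> matrix_group {0} \<inter> matrix_group {n - 1}"
    and h: "h \<in> matrix_group {0} \<inter> matrix_group {n - 1}" and eq: "restr ?W g = restr ?W h"
  obtain as where as: "set as \<subseteq> aniso ?W" "\<And>x. x \<in> carrier_vec n \<Longrightarrow> g *\<^sub>v x = refls B as x"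
    using intersection_word[OF sb ns g] by blast
  obtain bs where bs: "set bs \<subseteq> aniso ?W" "\<And>x. x \<in> carrier_vec n \<Longrightarrow> h *\<^sub>v x = refls B bs x"
    using intersection_word[OF sb ns h] by blast
  have thin: "thin_rad ?W"
    using thin_intersection ns sb by (simp add: string_basis_def)
  have agree: "refls B as w = refls B bs w" if "w \<in> ?W" for w
    using fun_cong[OF eq, of w] as(2)[of w] bs(2)[of w] that subsp_carrier[OF subsp_coord that]
    by (simp add: restr_def)
  have "refls B as x = refls B bs x" if "x \<in> carrier_vec n" for x
    by (rule movers_agree_thin[OF subsp_coord thin mover_refls[OF subsp_coord as(1)]
          mover_refls[OF subsp_coord bs(1)] agree refls_fix_perp[OF subsp_coord bs(1)] that])
  then show "g = h"
    using g h as(2) bs(2) matrix_group_carrier[OF sb] by (intro mat_eq_by_action) auto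
qed

text \<open>The same word is realised in both groups; the two matrices act alike and are therefore
  equal. \<open>S\<close> stands for either \<open>aniso\<close> or
  \<open>square_roots\<close>.\<close>

lemma intersection_contains_words:
  assumes sb: string_basis
    and ns: "nonsingular B (coord_subspace n {0})" "nonsingular B (coord_subspace n {n - 1})"
    and S: "\<And>J. S J \<subseteq> aniso (coord_subspace n J)" "S {0, n - 1} \<subseteq> S {0}" "S {0, n - 1} \<subseteq> S {n - 1}"
    and sub: "words (coord_subspace n {0}) (S {0}) \<subseteq> restr (coord_subspace n {0}) ` matrix_group {0}"
      "words (coord_subspace n {n - 1}) (S {n - 1})
        \<subseteq> restr (coord_subspace n {n - 1}) ` matrix_group {n - 1}"
  shows "words (coord_subspace n {0, n - 1}) (S {0, n - 1})
    \<subseteq> restr (coord_subspace n {0, n - 1}) ` (matrix_group {0} \<inter> matrix_group {n - 1})"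
proof
  let ?W = "coord_subspace n {0, n - 1} :: 'a vec set"
  fix f assume "f \<in> words ?W (S {0, n - 1})"
  then obtain as where as: "set as \<subseteq> S {0, n - 1}" "f = restrict (refls B as) ?W"
    by (auto simp: words_def)
  have "set as \<subseteq> S {0}" "set as \<subseteq> S {n - 1}"
    using as(1) S(2,3) by auto
  then obtain g h where g: "g \<in> matrix_group {0}" "\<And>x. x \<in> carrier_vec n \<Longrightarrow> g *\<^sub>v x = refls B as x"
    and h: "h \<in> matrix_group {n - 1}" "\<And>x. x \<in> carrier_vec n \<Longrightarrow> h *\<^sub>v x = refls B as x"
    using words_in_group[OF sb ns(1) S(1) sub(1)] words_in_group[OF sb ns(2) S(1) sub(2)] by metis
  have "g = h"
    using g h matrix_group_carrier[OF sb] by (intro mat_eq_by_action) auto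
  moreover have "f = restr ?W g"
    using g(2) as(2) restr_eq[of ?W g "refls B as"] by (auto simp: coord_subspace_eq)
  ultimately show "f \<in> restr ?W ` (matrix_group {0} \<inter> matrix_group {n - 1})"
    using g(1) h(1) by blast
qed

text \<open>In characteristic at least 5 the kernel of the spinor norm is generated by reflections in
  roots of square norm; over a field of order 3 this may fail (for instance for the sum of three
  squares), and the stabiliser of a vector in a group of type \<open>A\<close> is used instead.\<close>

lemma square_type_intersection:
  assumes sb: string_basis and J: "J = {0} \<or> J = {n - 1} \<or> J = {}"
    and nsJ: "nonsingular B (coord_subspace n J)"
    and ns: "nonsingular B (coord_subspace n {0, n - 1})
      \<or> nonsingular B (coord_subspace n {}) \<and> nonsingular B (coord_subspace n {0})"
    and G: "restr (coord_subspace n J) ` matrix_group J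
      = words (coord_subspace n J) (square_roots (coord_subspace n J))"
    and g: "g \<in> matrix_group {0} \<inter> matrix_group {n - 1}"
  shows "restr (coord_subspace n {0, n - 1}) g
    \<in> words (coord_subspace n {0, n - 1}) (square_roots (coord_subspace n {0, n - 1}))"
proof -
  let ?W = "coord_subspace n {0, n - 1} :: 'a vec set"
  have n: "3 \<le> n"
    using sb by (simp add: string_basis_def)
  have Wc: "?W \<subseteq> carrier_vec n"
    by (auto simp: coord_subspace_eq)
  obtain as where as: "set as \<subseteq> aniso ?W" "\<And>x. x \<in> carrier_vec n \<Longrightarrow> g *\<^sub>v x = refls B as x"
    using intersection_word[OF sb ns g] by blast
  have "\<exists>bs. set bs \<subseteq> square_roots ?W \<and> (\<forall>x\<in>carrier_vec n. g *\<^sub>v x = refls B bs x)"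
  proof (cases "(3::'a) = 0")
    case False
    \<comment> \<open>The inner node with square label provides the vector of square norm in
      \<open>?W\<close> needed for rewriting words.\<close>
    obtain i where i: "i \<in> {1..n - 2}" "nonzero_square (B $$ (i, i))"
      using sb by (auto simp: string_basis_def)
    then have "unit_vec n i \<in> square_roots ?W"
      using n by (auto simp: square_roots_def coord_subspace_eq form_unit)
    then have "square_roots ?W \<noteq> {}"
      by blast
    moreover have "even (length (filter (\<lambda>a. \<not> nonzero_square (a \<sqdot> a)) as))"
    proof (rule square_type_agrees[OF subsp_coord G _ _ as(2)])
      have "matrix_group {0} \<subseteq> matrix_group {}"
        using matrix_group_antimono[OF sb] by simp
      then show "g \<in> matrix_group J"
        using g J by blast
      have "?W \<subseteq> coord_subspace n J"
        using J by (intro coord_subspace_antimono) auto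
      then show "set as \<subseteq> aniso (coord_subspace n J)"
        using as(1) aniso_mono by blast
    qed
    ultimately obtain bs where "set bs \<subseteq> square_roots ?W" "\<forall>x\<in>carrier_vec n. refls B as x = refls B bs x"
      using even_word_square_roots[OF subsp_coord False _ as(1)] by blast
    then show ?thesis
      using as(2) by auto
  next
    case True
    then have three: "\<forall>z::'a. z = 0 \<or> z * z = 1"
      using sb by (simp add: string_basis_def)
    \<comment> \<open>For \<open>J = {}\<close> the element is regarded in the group of
      \<open>{0}\<close>. The node \<open>k\<close> is the end node that this group retains, and
      \<open>c\<close> below is dual to it in \<open>coord_subspace n J\<close>, hence orthogonal to
      \<open>?W\<close>.\<close>
    define J' k where "J' = (if J = {} then {0} else J)" and "k = (if J = {n - 1} then 0 else n - 1)"
    have J': "J' = {0} \<and> k = n - 1 \<or> J' = {n - 1} \<and> k = 0"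
      using J n by (auto simp: J'_def k_def)
    have kJ: "k \<notin> J" "k < n"
      using J n by (auto simp: k_def)
    obtain c where c: "c \<in> coord_subspace n J"
      "\<And>j. j < n \<Longrightarrow> j \<notin> J \<Longrightarrow> c \<sqdot> unit_vec n j = (if j = k then 1 else 0)"
      using dual_vector[OF nsJ kJ(2,1)] by blast
    have cc: "c \<in> carrier_vec n"
      using c(1) by (simp add: coord_subspace_eq)
    have "c \<sqdot> y = 0" if "y \<in> ?W" for y
    proof (rule orthogonal_coord[OF cc _ that])
      fix j assume "j < n" "j \<notin> {0, n - 1}"
      then show "c \<sqdot> unit_vec n j = 0"
        using J c(2)[of j] by (auto simp: k_def)
    qed
    then have cp: "c \<in> perp B ?W"
      using cc by (simp add: perp_def)
    have ck: "c \<sqdot> unit_vec n k \<noteq> 0"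
      using c(2)[OF kJ(2,1)] by simp
    have gc: "g *\<^sub>v c = c"
      using as(2)[OF cc] refls_fix_perp[OF subsp_coord as(1) cp] by simp
    have lab: "nonzero_square (B $$ (j, j))" if "j < n" "j \<notin> J" for j
      using square_type_labels[OF sb G that] .
    have lab': "nonzero_square (B $$ (j, j))" if "j < n" "j \<notin> J'" for j
      using lab[OF that(1)] that(2) by (auto simp: J'_def split: if_splits)
    have "g \<in> matrix_group J'"
      using g J' by blast
    then obtain bs where bs: "set bs \<subseteq> roots {0, n - 1}" "\<And>x. x \<in> carrier_vec n \<Longrightarrow> g *\<^sub>v x = refls B bs x"
      using char3_stabiliser[OF sb three J' lab' cp ck _ gc] by blast
    have "roots {0, n - 1} \<subseteq> square_roots ?W"
      using lab J by (auto simp: roots_def square_roots_def coord_subspace_eq form_unit)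
    then show ?thesis
      using bs by blast
  qed
  then obtain bs where bs: "set bs \<subseteq> square_roots ?W" "\<forall>x\<in>carrier_vec n. g *\<^sub>v x = refls B bs x"
    by blast
  then have "restr ?W g = restrict (refls B bs) ?W"
    using Wc by (intro restr_eq) auto
  then show ?thesis
    using bs(1) by (auto simp: words_def)
qed

text \<open>Formulated with the hatted groups to treat singular and non-singular \<open>W\<close>
  together; without radical they are the ordinary ones.\<close>

theorem intersection_orthogonal_type:
  assumes sb: string_basis
    and ns: "nonsingular B (coord_subspace n {0})" "nonsingular B (coord_subspace n {n - 1})"
    and nsW: "nonsingular B (coord_subspace n {0, n - 1}) \<or> nonsingular B (coord_subspace n {})"
    and ot: "orthogonal_type B (coord_subspace n {0}) (matrix_group {0})"
      "orthogonal_type B (coord_subspace n {n - 1}) (matrix_group {n - 1})"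
  defines "W \<equiv> coord_subspace n {0, n - 1}" and "T \<equiv> matrix_group {0} \<inter> matrix_group {n - 1}"
  shows "\<forall>g\<in>T. \<forall>x\<in>perp B W. g *\<^sub>v x = x"
    and "inj_on (restr W) T"
    and "refl_subgroup_hat B W \<subseteq> restr W ` T"
    and "restr W ` T \<subseteq> isometries_hat B W"
    and "restr (coord_subspace n {0}) ` matrix_group {0} = isometries B (coord_subspace n {0})
      \<Longrightarrow> restr (coord_subspace n {n - 1}) ` matrix_group {n - 1} = isometries B (coord_subspace n {n - 1})
      \<Longrightarrow> restr W ` T = isometries_hat B W"
    and "restr (coord_subspace n {0}) ` matrix_group {0} = refl_subgroup B 1 (coord_subspace n {0})
        \<or> restr (coord_subspace n {n - 1}) ` matrix_group {n - 1}
          = refl_subgroup B 1 (coord_subspace n {n - 1})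
      \<Longrightarrow> restr W ` T = refl_subgroup_hat B W"
proof -
  have W: "subsp W"
    unfolding W_def by (rule subsp_coord)
  have one: "nonzero_square (1::'a)"
    by (auto simp: nonzero_square_def intro: exI[of _ 1])
  have ns': "nonsingular B (coord_subspace n {0, n - 1})
      \<or> nonsingular B (coord_subspace n {}) \<and> nonsingular B (coord_subspace n {0})"
    using ns nsW by blast
  show "\<forall>g\<in>T. \<forall>x\<in>perp B W. g *\<^sub>v x = x"
    using intersection_fixes_perp[OF sb nsW] unfolding W_def T_def by blast
  show "inj_on (restr W) T"
    using intersection_inj[OF sb ns'] unfolding W_def T_def .
  have end0: "{0} \<subseteq> {0, n - 1}" and end1: "{n - 1} \<subseteq> {0, n - 1}"
    by auto
  have sq: "words (coord_subspace n J) (square_roots (coord_subspace n J))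
      \<subseteq> restr (coord_subspace n J) ` matrix_group J"
    if J: "J = {0} \<or> J = {n - 1}" for J
  proof -
    have "restr (coord_subspace n J) ` matrix_group J = words (coord_subspace n J) (aniso (coord_subspace n J))
        \<or> restr (coord_subspace n J) ` matrix_group J
          = words (coord_subspace n J) (square_roots (coord_subspace n J))"
      using J ns ot by (intro orthogonal_type_words[OF sb]) auto
    moreover have "words V (square_roots V) \<subseteq> words V (aniso V)" for V
      using square_roots_aniso by (fastforce simp: words_def)
    ultimately show ?thesis
      by blast
  qed
  have "words W (square_roots W) \<subseteq> restr W ` T"
    unfolding W_def T_def
    using sq square_roots_aniso square_roots_mono[OF coord_subspace_antimono[OF end0]]
      square_roots_mono[OF coord_subspace_antimono[OF end1]]
    by (intro intersection_contains_words[OF sb ns, where S = "\<lambda>J. square_roots (coord_subspace n J)"]) auto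
  then show lower: "refl_subgroup_hat B W \<subseteq> restr W ` T"
    by (simp add: refl_subgroup_hat_words[OF W])
  show upper: "restr W ` T \<subseteq> isometries_hat B W"
  proof
    fix f assume "f \<in> restr W ` T"
    then obtain g where g: "g \<in> T" "f = restr W g"
      by blast
    then obtain as where as: "set as \<subseteq> aniso W" "\<And>x. x \<in> carrier_vec n \<Longrightarrow> g *\<^sub>v x = refls B as x"
      using intersection_word[OF sb ns'] unfolding W_def T_def by blast
    have "f = restrict (refls B as) W"
      unfolding g(2) using as(2) W by (intro restr_eq) (auto dest: subsp_carrier)
    then show "f \<in> isometries_hat B W"
      unfolding isometries_hat_words[OF W] using as(1) by (auto simp: words_def)
  qed
  show "restr W ` T = isometries_hat B W"
    if full: "restr (coord_subspace n {0}) ` matrix_group {0} = isometries B (coord_subspace n {0})"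
      "restr (coord_subspace n {n - 1}) ` matrix_group {n - 1} = isometries B (coord_subspace n {n - 1})"
  proof (rule equalityI[OF upper])
    have "words (coord_subspace n J) (aniso (coord_subspace n J))
      = restr (coord_subspace n J) ` matrix_group J" if "J = {0} \<or> J = {n - 1}" for J
      using that full ns isometries_nonsingular[OF subsp_coord] isometries_hat_words[OF subsp_coord] by auto
    then show "isometries_hat B W \<subseteq> restr W ` T"
      unfolding isometries_hat_words[OF W] unfolding W_def T_def
      using aniso_mono[OF coord_subspace_antimono[OF end0]] aniso_mono[OF coord_subspace_antimono[OF end1]]
      by (intro intersection_contains_words[OF sb ns, where S = "\<lambda>J. aniso (coord_subspace n J)"]) auto
  qed
  show "restr W ` T = refl_subgroup_hat B W"
    if either: "restr (coord_subspace n {0}) ` matrix_group {0} = refl_subgroup B 1 (coord_subspace n {0})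
        \<or> restr (coord_subspace n {n - 1}) ` matrix_group {n - 1}
          = refl_subgroup B 1 (coord_subspace n {n - 1})"
  proof (rule equalityI[OF _ lower])
    \<comment> \<open>One end group of this type suffices, since every element of the intersection
      lies in it and so has trivial spinor norm.\<close>
    obtain J where J: "J = {0} \<or> J = {n - 1}"
      and "restr (coord_subspace n J) ` matrix_group J = refl_subgroup B 1 (coord_subspace n J)"
      using either by blast
    then have GJ: "restr (coord_subspace n J) ` matrix_group J
        = words (coord_subspace n J) (square_roots (coord_subspace n J))"
      by (simp only: refl_subgroup_square[OF subsp_coord one] refl_subgroup_hat_words[OF subsp_coord])
    have "restr W g \<in> words W (square_roots W)" if "g \<in> T" for g
      using J ns that unfolding W_def T_def by (intro square_type_intersection[OF sb _ _ ns' GJ]) auto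
    then show "restr W ` T \<subseteq> refl_subgroup_hat B W"
      unfolding refl_subgroup_hat_words[OF W] by blast
  qed
qed

text \<open>Restriction to the non-singular \<open>W\<close> is injective on the intersection, so it
  is enough that every restriction already occurs in the smaller group. If that group is not full,
  the spinor norm is controlled by the whole group, as the end subspaces may be singular.\<close>

theorem intersection_singular_ends:
  assumes sb: string_basis
    and nsV: "nonsingular B (coord_subspace n {})" and nsW: "nonsingular B (coord_subspace n {0, n - 1})"
    and ot: "orthogonal_type B (coord_subspace n {0, n - 1}) (matrix_group {0, n - 1})"
    and top: "restr (coord_subspace n {0, n - 1}) ` matrix_group {0, n - 1}
        = refl_subgroup B 1 (coord_subspace n {0, n - 1})
      \<Longrightarrow> restr (coord_subspace n {}) ` matrix_group {} = refl_subgroup B 1 (coord_subspace n {})"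
  shows "matrix_group {0} \<inter> matrix_group {n - 1} = matrix_group {0, n - 1}"
proof
  let ?W = "coord_subspace n {0, n - 1} :: 'a vec set"
  have W: "subsp ?W"
    by (rule subsp_coord)
  have one: "nonzero_square (1::'a)"
    by (auto simp: nonzero_square_def intro: exI[of _ 1])
  show sub: "matrix_group {0, n - 1} \<subseteq> matrix_group {0} \<inter> matrix_group {n - 1}"
    using matrix_group_antimono[OF sb] by simp
  note ns = disjI1[OF nsW]
  show "matrix_group {0} \<inter> matrix_group {n - 1} \<subseteq> matrix_group {0, n - 1}"
  proof
    fix g assume g: "g \<in> matrix_group {0} \<inter> matrix_group {n - 1}"
    have "restr ?W g \<in> restr ?W ` matrix_group {0, n - 1}"
    proof (cases "restr ?W ` matrix_group {0, n - 1} = words ?W (aniso ?W)")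
      case True
      obtain as where as: "set as \<subseteq> aniso ?W" "\<And>x. x \<in> carrier_vec n \<Longrightarrow> g *\<^sub>v x = refls B as x"
        using intersection_word[OF sb ns g] by blast
      have "restr ?W g = restrict (refls B as) ?W"
        using as(2) W by (intro restr_eq) (auto dest: subsp_carrier)
      then show ?thesis
        unfolding True using as(1) by (auto simp: words_def)
    next
      case False
      then have G: "restr ?W ` matrix_group {0, n - 1} = words ?W (square_roots ?W)"
        using orthogonal_type_words[OF sb _ nsW ot] by blast
      then have "restr ?W ` matrix_group {0, n - 1} = refl_subgroup B 1 ?W"
        by (simp only: refl_subgroup_square[OF W one] refl_subgroup_hat_words[OF W])
      from top[OF this] have "restr (coord_subspace n {}) ` matrix_group {}
          = words (coord_subspace n {}) (square_roots (coord_subspace n {}))"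
        by (simp only: refl_subgroup_square[OF subsp_coord one] refl_subgroup_hat_words[OF subsp_coord])
      then show ?thesis
        unfolding G using g by (intro square_type_intersection[OF sb _ nsV ns]) auto
    qed
    then obtain h where h: "h \<in> matrix_group {0, n - 1}" "restr ?W g = restr ?W h"
      by blast
    then have "g = h"
      using inj_onD[OF intersection_inj[OF sb ns]] g sub by blast
    then show "g \<in> matrix_group {0, n - 1}"
      using h(1) by simp
  qed
qed

end


section \<open>Reduction modulo p\<close>

lemma three_mod_ring_nonzero:
  assumes "CARD('p::prime_card) \<noteq> 3"
  shows "(3 :: 'p mod_ring) \<noteq> 0"
proof
  assume "(3 :: 'p mod_ring) = 0"
  then have "(of_int_mod_ring 3 :: 'p mod_ring) = 0"
    by (metis of_int_numeral of_int_of_int_mod_ring)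
  then have "3 mod int CARD('p) = 0"
    by (metis of_int_mod_ring.rep_eq to_int_mod_ring.rep_eq zero_mod_ring.rep_eq)
  then have "CARD('p) dvd 3"
    by presburger
  moreover have "prime (3::nat)"
    by simp
  ultimately have "CARD('p) = 1 \<or> CARD('p) = 3"
    by (metis prime_nat_iff)
  then show False
    using assms prime_card[where 'a='p] by auto
qed

text \<open>There are \<open>(3 - 1) / 2 = 1\<close> nonzero squares, and 1 is among them.\<close>

lemma square_eq_1_of_card_3:
  fixes z :: "'a::{field,finite}"
  assumes two: "(2::'a) \<noteq> 0" and card: "CARD('a) = 3"
  shows "z = 0 \<or> z * z = 1"
proof -
  have "card {x::'a. nonzero_square x} = 1"
    using card_nonzero_squares[OF two] card by simp
  then obtain y where y: "{x::'a. nonzero_square x} = {y}"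
    by (auto simp: card_1_singleton_iff)
  have "nonzero_square (1::'a)"
    by (auto simp: nonzero_square_def intro: exI[of _ 1])
  moreover have "nonzero_square (z * z)" if "z \<noteq> 0"
    using that by (auto simp: nonzero_square_def power2_eq_square)
  ultimately show ?thesis
    using y by (metis mem_Collect_eq singletonD)
qed

lemma dyadic_mod_of_int:
  assumes "odd CARD('p::prime_card)"
  shows "(dyadic_mod (of_int m) :: 'p mod_ring) = of_int m"
  using dyadic_mod_eq[OF assms, of m 0] by simp

lemma dyadic_mod_int_mult:
  assumes "odd CARD('p::prime_card)" and "dyadic x"
  shows "(dyadic_mod (of_int c * x) :: 'p mod_ring) = of_int c * dyadic_mod x"
proof -
  obtain m k where x: "x = of_int m / 2 ^ k"
    using assms(2) by (auto simp: dyadic_def)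
  then have "of_int c * x = of_int (c * m) / 2 ^ k"
    by simp
  then show ?thesis
    by (simp only: x dyadic_mod_eq[OF assms(1)]) simp
qed

lemma form_unit_vec:
  assumes "B \<in> carrier_mat n n" "i < n" "j < n"
  shows "form B (unit_vec n i) (unit_vec n j) = B $$ (i, j)"
  using assms by (simp add: form_def scalar_prod_left_unit[of _ n] scalar_prod_right_unit)

lemma refl_matrix_entry:
  assumes B: "B \<in> carrier_mat n n" and j: "j < n" "k < n" "l < n"
  shows "refl_matrix n B j $$ (k, l)
    = (if k = l then 1 else 0) - (if k = j then 2 * (B $$ (l, j) / B $$ (j, j)) else 0)"
  using j form_unit_vec[OF B j(3,1)] form_unit_vec[OF B j(1,1)]
  by (simp add: refl_matrix_def reflection_def)

context
  fixes n :: nat and ps :: "nat \<Rightarrow> enat" and B :: "real mat" and \<beta> :: "'p::prime_card mod_ring mat"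
  assumes cox: "crystallographic_coxeter n ps B" and p_odd: "odd CARD('p)"
    and \<beta>: "\<beta> = map_mat dyadic_mod B"
begin

lemma
  shows gram_carrier: "B \<in> carrier_mat n n"
    and gram_pos: "\<And>i. i < n \<Longrightarrow> 0 < B $$ (i, i)"
    and gram_entry: "\<And>i j. i < n \<Longrightarrow> j < n
      \<Longrightarrow> B $$ (i, j) = - cos_pi_div (coxeter_entry ps i j) * sqrt (B $$ (i, i)) * sqrt (B $$ (j, j))"
    and gram_dyadic: "\<And>i j. i < n \<Longrightarrow> j < n \<Longrightarrow> dyadic (B $$ (i, j))"
    and gram_integral: "\<And>i k l. i < n \<Longrightarrow> k < n \<Longrightarrow> l < n \<Longrightarrow> refl_matrix n B i $$ (k, l) \<in> \<int>"
  using cox unfolding crystallographic_coxeter_def by blast+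

lemma reduced_gram_carrier: "\<beta> \<in> carrier_mat n n"
  using gram_carrier by (simp add: \<beta>)

lemma reduced_gram_entry: "i < n \<Longrightarrow> j < n \<Longrightarrow> \<beta> $$ (i, j) = dyadic_mod (B $$ (i, j))"
  using gram_carrier by (simp add: \<beta>)

lemma reduced_gram_sym:
  assumes "i < n" "j < n"
  shows "\<beta> $$ (i, j) = \<beta> $$ (j, i)"
proof -
  have "coxeter_entry ps i j = coxeter_entry ps j i"
    by (auto simp: coxeter_entry_def)
  then have "B $$ (i, j) = B $$ (j, i)"
    using gram_entry[OF assms] gram_entry[OF assms(2,1)] by simp
  then show ?thesis
    using assms by (simp add: reduced_gram_entry)
qed

lemma symmetric_form_reduced: "symmetric_form n \<beta>"
  using reduced_gram_carrier reduced_gram_sym two_mod_ring_nonzero[OF p_odd]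
  by unfold_locales auto

lemma reduced_gram_far:
  assumes "i < n" "j < n" "Suc i < j"
  shows "\<beta> $$ (i, j) = 0"
proof -
  have "coxeter_entry ps i j = enat 2"
    using assms by (simp add: coxeter_entry_def numeral_eq_enat)
  then have "B $$ (i, j) = 0"
    using gram_entry[OF assms(1,2)] by simp
  then show ?thesis
    using assms dyadic_mod_of_int[OF p_odd, of 0] by (simp add: reduced_gram_entry)
qed

text \<open>\<open>m\<close> is the Cartan integer, an integer because the reflection matrix is
  integral. Its equation is multiplied out before reduction, as the label might vanish modulo
  \<open>p\<close>.\<close>

lemma reduced_cartan_entry:
  assumes "j < n" "l < n"
  obtains m where "2 * (B $$ (l, j) / B $$ (j, j)) = of_int m"
    and "2 * \<beta> $$ (l, j) = of_int m * \<beta> $$ (j, j)"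
proof -
  have "refl_matrix n B j $$ (j, l) \<in> \<int>"
    using gram_integral assms by blast
  moreover have "2 * (B $$ (l, j) / B $$ (j, j)) = (if j = l then 1 else 0) - refl_matrix n B j $$ (j, l)"
    using refl_matrix_entry[OF gram_carrier assms(1,1,2)] by simp
  ultimately have "2 * (B $$ (l, j) / B $$ (j, j)) \<in> \<int>"
    by auto
  then obtain m where m: "2 * (B $$ (l, j) / B $$ (j, j)) = of_int m"
    by (auto elim: Ints_cases)
  then have "of_int 2 * B $$ (l, j) = of_int m * B $$ (j, j)"
    using gram_pos[OF assms(1)] by (simp add: field_simps)
  then have "(dyadic_mod (of_int 2 * B $$ (l, j)) :: 'p mod_ring) = dyadic_mod (of_int m * B $$ (j, j))"
    by (rule arg_cong)
  then have "2 * \<beta> $$ (l, j) = of_int m * \<beta> $$ (j, j)"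
    using assms gram_dyadic by (simp only: dyadic_mod_int_mult[OF p_odd] reduced_gram_entry) simp
  then show thesis
    using that m by blast
qed

text \<open>The labels need not be units modulo \<open>p\<close> (the basic system could be scaled by \<open>p\<close> on a
  component), but a root whose label vanishes modulo \<open>p\<close> lies in the radical.\<close>

lemma label_nonzero:
  assumes "nonsingular \<beta> (coord_subspace n J)" and j: "j < n" "j \<notin> J"
  shows "\<beta> $$ (j, j) \<noteq> 0"
proof
  interpret symmetric_form n \<beta>
    by (rule symmetric_form_reduced)
  assume z: "\<beta> $$ (j, j) = 0"
  have row: "\<beta> $$ (j, l) = 0" if l: "l < n" for l
  proof -
    obtain m where "2 * \<beta> $$ (l, j) = of_int m * \<beta> $$ (j, j)"
      using reduced_cartan_entry[OF j(1) l] by blast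
    then have "2 * \<beta> $$ (l, j) = 0"
      by (simp add: z)
    then have "\<beta> $$ (l, j) = 0"
      using two by (metis mult_eq_0_iff)
    then show ?thesis
      using reduced_gram_sym[OF j(1) l] by simp
  qed
  have "form \<beta> (unit_vec n j) y = 0" if "y \<in> coord_subspace n J" for y
    by (rule orthogonal_coord[OF _ _ that]) (use j(1) row in \<open>simp_all add: form_unit\<close>)
  then have "unit_vec n j = (0\<^sub>v n :: 'p mod_ring vec)"
    using j by (intro nonsingularD[OF assms(1) subsp_coord]) (auto simp: coord_subspace_eq)
  then show False
    using j(1) by (metis index_unit_vec(1) index_zero_vec(1) zero_neq_one)
qed

text \<open>Both matrices are built from the same Cartan integers, on which
  \<open>dyadic_mod\<close> is the ordinary reduction.\<close>

lemma refl_matrix_reduced: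
  assumes "\<beta> $$ (j, j) \<noteq> 0" "j < n"
  shows "map_mat dyadic_mod (refl_matrix n B j) = refl_matrix n \<beta> j"
proof (rule eq_matI)
  fix k l assume "k < dim_row (refl_matrix n \<beta> j)" "l < dim_col (refl_matrix n \<beta> j)"
  then have kl: "k < n" "l < n"
    by (simp_all add: refl_matrix_def)
  obtain m where m: "2 * (B $$ (l, j) / B $$ (j, j)) = of_int m" "2 * \<beta> $$ (l, j) = of_int m * \<beta> $$ (j, j)"
    using reduced_cartan_entry[OF assms(2) kl(2)] by blast
  have m': "2 * (\<beta> $$ (l, j) / \<beta> $$ (j, j)) = of_int m"
    using m(2) assms(1) by (simp add: field_simps)
  let ?z = "(if k = l then 1 else 0) - (if k = j then m else 0)"
  have "refl_matrix n B j $$ (k, l) = of_int ?z"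
    unfolding refl_matrix_entry[OF gram_carrier assms(2) kl] m(1) by simp
  then have "map_mat dyadic_mod (refl_matrix n B j) $$ (k, l) = (dyadic_mod (of_int ?z) :: 'p mod_ring)"
    using kl by (simp add: refl_matrix_def)
  also have "\<dots> = of_int ?z"
    by (rule dyadic_mod_of_int[OF p_odd])
  also have "\<dots> = refl_matrix n \<beta> j $$ (k, l)"
    unfolding refl_matrix_entry[OF reduced_gram_carrier assms(2) kl] m' by simp
  finally show "map_mat dyadic_mod (refl_matrix n B j) $$ (k, l) = refl_matrix n \<beta> j $$ (k, l)" .
qed (simp_all add: refl_matrix_def)

lemma reduced_group_eq:
  assumes "\<And>j. j < n \<Longrightarrow> \<beta> $$ (j, j) \<noteq> 0"
  shows "reduced_group n B J = symmetric_form.matrix_group n \<beta> J"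
proof -
  have "{map_mat dyadic_mod (refl_matrix n B j) | j. j < n \<and> j \<notin> J}
      = {refl_matrix n \<beta> j | j. j < n \<and> j \<notin> J}"
    using refl_matrix_reduced assms by (metis (no_types, lifting))
  then show ?thesis
    by (simp add: reduced_group_def symmetric_form.matrix_group_def[OF symmetric_form_reduced])
qed

lemma string_basis_reduced:
  assumes "3 \<le> n" "\<And>j. j < n \<Longrightarrow> \<beta> $$ (j, j) \<noteq> 0" "\<exists>i\<in>{1..n - 2}. nonzero_square (\<beta> $$ (i, i))"
  shows "symmetric_form.string_basis n \<beta>"
proof -
  interpret symmetric_form n \<beta>
    by (rule symmetric_form_reduced)
  have "(3 :: 'p mod_ring) \<noteq> 0 \<or> (\<forall>z :: 'p mod_ring. z = 0 \<or> z * z = 1)"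
  proof (cases "CARD('p) = 3")
    case True
    then have "CARD('p mod_ring) = 3"
      by simp
    then show ?thesis
      using square_eq_1_of_card_3[OF two] by blast
  qed (use three_mod_ring_nonzero in blast)
  then show ?thesis
    using assms reduced_gram_far by (auto simp: string_basis_def)
qed

end

theorem theorem2p3:
  fixes n :: nat and ps :: "nat \<Rightarrow> enat" and B :: "real mat"
    and \<beta> :: "'p::prime_card mod_ring mat"
    and V :: "nat set \<Rightarrow> 'p mod_ring vec set"
    and G :: "nat set \<Rightarrow> 'p mod_ring mat set"
  assumes n: "n \<ge> 3"
    and cox: "crystallographic_coxeter n ps B"
    and p_odd: "odd CARD('p)"
    and p_generic: "generic_prime n ps CARD('p)"
    and \<beta>: "\<beta> = map_mat dyadic_mod B"
    and V: "V = coord_subspace n"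
    and G: "G = reduced_group n B"
    and label: "\<exists>i\<in>{1..n - 2}. nonzero_square (\<beta> $$ (i, i))"
  shows
    \<comment> \<open>(a)\<close>
    "(nonsingular \<beta> (V {0}) \<and> nonsingular \<beta> (V {n - 1}) \<and> nonsingular \<beta> (V {0, n - 1})
        \<and> orthogonal_type \<beta> (V {0}) (G {0}) \<and> orthogonal_type \<beta> (V {n - 1}) (G {n - 1})
      \<longrightarrow>
        (\<forall>g \<in> G {0} \<inter> G {n - 1}. \<forall>x \<in> perp \<beta> (V {0, n - 1}). g *\<^sub>v x = x)
        \<and> inj_on (restr (V {0, n - 1})) (G {0} \<inter> G {n - 1})
        \<and> refl_subgroup \<beta> 1 (V {0, n - 1}) \<subseteq> restr (V {0, n - 1}) ` (G {0} \<inter> G {n - 1})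
        \<and> restr (V {0, n - 1}) ` (G {0} \<inter> G {n - 1}) \<subseteq> isometries \<beta> (V {0, n - 1})
        \<and> (restr (V {0}) ` G {0} = isometries \<beta> (V {0})
             \<and> restr (V {n - 1}) ` G {n - 1} = isometries \<beta> (V {n - 1})
           \<longrightarrow> restr (V {0, n - 1}) ` (G {0} \<inter> G {n - 1}) = isometries \<beta> (V {0, n - 1}))
        \<and> (restr (V {0}) ` G {0} = refl_subgroup \<beta> 1 (V {0})
             \<or> restr (V {n - 1}) ` G {n - 1} = refl_subgroup \<beta> 1 (V {n - 1})
           \<longrightarrow> restr (V {0, n - 1}) ` (G {0} \<inter> G {n - 1}) = refl_subgroup \<beta> 1 (V {0, n - 1})))
    \<and>
    \<comment> \<open>(b)\<close>
     (nonsingular \<beta> (V {}) \<and> nonsingular \<beta> (V {0}) \<and> nonsingular \<beta> (V {n - 1})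
        \<and> \<not> nonsingular \<beta> (V {0, n - 1})
        \<and> orthogonal_type \<beta> (V {0}) (G {0}) \<and> orthogonal_type \<beta> (V {n - 1}) (G {n - 1})
      \<longrightarrow>
        (\<forall>g \<in> G {0} \<inter> G {n - 1}. \<forall>x \<in> perp \<beta> (V {0, n - 1}). g *\<^sub>v x = x)
        \<and> inj_on (restr (V {0, n - 1})) (G {0} \<inter> G {n - 1})
        \<and> refl_subgroup_hat \<beta> (V {0, n - 1}) \<subseteq> restr (V {0, n - 1}) ` (G {0} \<inter> G {n - 1})
        \<and> restr (V {0, n - 1}) ` (G {0} \<inter> G {n - 1}) \<subseteq> isometries_hat \<beta> (V {0, n - 1})
        \<and> (restr (V {0}) ` G {0} = isometries \<beta> (V {0})
             \<and> restr (V {n - 1}) ` G {n - 1} = isometries \<beta> (V {n - 1})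
           \<longrightarrow> restr (V {0, n - 1}) ` (G {0} \<inter> G {n - 1}) = isometries_hat \<beta> (V {0, n - 1}))
        \<and> (restr (V {0}) ` G {0} = refl_subgroup \<beta> 1 (V {0})
             \<or> restr (V {n - 1}) ` G {n - 1} = refl_subgroup \<beta> 1 (V {n - 1})
           \<longrightarrow> restr (V {0, n - 1}) ` (G {0} \<inter> G {n - 1}) = refl_subgroup_hat \<beta> (V {0, n - 1})))
    \<and>
    \<comment> \<open>(c)\<close>
     (nonsingular \<beta> (V {}) \<and> nonsingular \<beta> (V {0, n - 1})
        \<and> (\<not> nonsingular \<beta> (V {0}) \<or> \<not> nonsingular \<beta> (V {n - 1}))
        \<and> orthogonal_type \<beta> (V {0, n - 1}) (G {0, n - 1})
        \<and> (restr (V {0, n - 1}) ` G {0, n - 1} = refl_subgroup \<beta> 1 (V {0, n - 1})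
           \<longrightarrow> restr (V {}) ` G {} = refl_subgroup \<beta> 1 (V {}))
      \<longrightarrow> G {0} \<inter> G {n - 1} = G {0, n - 1})"
proof -
  interpret symmetric_form n \<beta>
    by (rule symmetric_form_reduced[OF cox p_odd \<beta>])
  have one: "nonzero_square (1 :: 'p mod_ring)"
    by (auto simp: nonzero_square_def intro: exI[of _ 1])
  have diag: "\<beta> $$ (j, j) \<noteq> 0"
    if ns: "nonsingular \<beta> (V {}) \<or> nonsingular \<beta> (V {0}) \<and> nonsingular \<beta> (V {n - 1})" and j: "j < n" for j
  proof -
    \<comment> \<open>Each node lies outside a set whose subspace is non-singular: if not
      \<open>{}\<close>, then \<open>{n - 1}\<close> for node 0 and \<open>{0}\<close> for all
      others.\<close>
    have "nonsingular \<beta> (coord_subspace n {})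
        \<or> nonsingular \<beta> (coord_subspace n {if j = 0 then n - 1 else 0})"
      using ns unfolding V by auto
    then show ?thesis
      using n j label_nonzero[OF cox p_odd \<beta> _ j, of "{}"]
        label_nonzero[OF cox p_odd \<beta> _ j, of "{if j = 0 then n - 1 else 0}"]
      by (auto split: if_splits)
  qed
  have sb: string_basis and G': "G = matrix_group"
    if "nonsingular \<beta> (V {}) \<or> nonsingular \<beta> (V {0}) \<and> nonsingular \<beta> (V {n - 1})"
    using string_basis_reduced[OF cox p_odd \<beta> n diag[OF that] label]
      reduced_group_eq[OF cox p_odd \<beta> diag[OF that]] by (auto simp: G)
  have hat: "refl_subgroup \<beta> 1 (V J) = refl_subgroup_hat \<beta> (V J)" for J
    unfolding V by (rule refl_subgroup_square[OF subsp_coord one])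
  show ?thesis
  proof ((rule conjI[OF _ conjI]; rule impI), goal_cases)
    case 1
    then have ns: "nonsingular \<beta> (V {0})" "nonsingular \<beta> (V {n - 1})" "nonsingular \<beta> (V {0, n - 1})"
      and ot: "orthogonal_type \<beta> (V {0}) (G {0})" "orthogonal_type \<beta> (V {n - 1}) (G {n - 1})"
      by blast+
    then have or: "nonsingular \<beta> (V {}) \<or> nonsingular \<beta> (V {0}) \<and> nonsingular \<beta> (V {n - 1})"
      by blast
    have iso: "isometries \<beta> (V {0, n - 1}) = isometries_hat \<beta> (V {0, n - 1})"
      using ns(3) unfolding V by (rule isometries_nonsingular[OF subsp_coord])
    note main = intersection_orthogonal_type[folded V G'[OF or], OF sb[OF or] ns(1,2) disjI1[OF ns(3)] ot]
    show ?case
      unfolding iso hat using main[unfolded hat] by blast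
  next
    case 2
    then have ns: "nonsingular \<beta> (V {0})" "nonsingular \<beta> (V {n - 1})" "nonsingular \<beta> (V {})"
      and ot: "orthogonal_type \<beta> (V {0}) (G {0})" "orthogonal_type \<beta> (V {n - 1}) (G {n - 1})"
      by blast+
    then have or: "nonsingular \<beta> (V {}) \<or> nonsingular \<beta> (V {0}) \<and> nonsingular \<beta> (V {n - 1})"
      by blast
    note main = intersection_orthogonal_type[folded V G'[OF or], OF sb[OF or] ns(1,2) disjI2[OF ns(3)] ot]
    show ?case
      using main by blast
  next
    case 3
    then have ns: "nonsingular \<beta> (V {})" "nonsingular \<beta> (V {0, n - 1})"
      and ot: "orthogonal_type \<beta> (V {0, n - 1}) (G {0, n - 1})"
      and top: "restr (V {0, n - 1}) ` G {0, n - 1} = refl_subgroup \<beta> 1 (V {0, n - 1})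
        \<Longrightarrow> restr (V {}) ` G {} = refl_subgroup \<beta> 1 (V {})"
      by blast+
    then have or: "nonsingular \<beta> (V {}) \<or> nonsingular \<beta> (V {0}) \<and> nonsingular \<beta> (V {n - 1})"
      by blast
    show ?case
      by (rule intersection_singular_ends[folded V G'[OF or], OF sb[OF or] ns ot top])
  qed
qed

end
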